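(* Let $G$ be a (finite or infinite) group such that $\overline G := G/Z(G)$ is not simple and $\Xi(G)$ has an edge. Then at least one of the following holds. (i) $\Xi(G)$ has an isolated vertex, and $\mathrm{diam}(\Xi^+(G)) = 2$. Moreover, if $\overline G$ has a proper non-cyclic quotient, then $G$ is soluble. (ii) $\Xi(\overline G)$ has an isolated vertex, and $\mathrm{diam}(\Xi^+(G)) \in \{2,3,4\}$. Additionally, $\overline G$ is an infinite, insoluble primitive group with every proper quotient cyclic. (iii) $\Xi(G)$ is connected with diameter $2$ or $3$. (iv) $\Xi(G)$ is connected with diameter $4$, $G$ is infinite, and $\overline G$ has a proper non-cyclic quotient. (v) $\Xi(G)$ is the union of two connected components of diameter $2$.
   Context: For a group $H$, the non-commuting, non-generating graph $\Xi(H)$ is the simple graph with vertex set $H \setminus Z(H)$, in which two vertices $x$ and $y$ are adjacent if and only if $[x,y] \neq 1$ and $\langle x,y\rangle \neq H$. $\Xi^+(H)$ denotes the subgraph of $\Xi(H)$ induced by its non-isolated vertices. $\mathrm{diam}(\Gamma)$ is the diameter of the graph $\Gamma$ (a finite diameter means in particular that $\Gamma$ is connected). A proper quotient of a group is a quotient by a nontrivial normal subgroup. A group is primitive if it has a core-free maximal subgroup (one containing no nontrivial normal subgroup of the group). *)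

theory Defs
  imports
    "HOL-Algebra.Elementary_Groups"
    "HOL-Algebra.Solvable_Groups"
    "Graph_Theory.Digraph_Component"
    "Graph_Theory.Shortest_Path"
begin

section \<open>Groups\<close>

definition center :: "('a, 'b) monoid_scheme \<Rightarrow> 'a set" where
  "center G = {z \<in> carrier G. \<forall>x \<in> carrier G. z \<otimes>\<^bsub>G\<^esub> x = x \<otimes>\<^bsub>G\<^esub> z}"

definition commutator :: "('a, 'b) monoid_scheme \<Rightarrow> 'a \<Rightarrow> 'a \<Rightarrow> 'a" where
  "commutator G x y = x \<otimes>\<^bsub>G\<^esub> y \<otimes>\<^bsub>G\<^esub> inv\<^bsub>G\<^esub> x \<otimes>\<^bsub>G\<^esub> inv\<^bsub>G\<^esub> y"

text \<open>The locale \<open>simple_group\<close> of HOL-Algebra requires \<open>order G > 1\<close>, where \<open>order\<close> is the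
  cardinality as a natural number and so is \<open>0\<close> for infinite groups; hence it excludes all
  infinite simple groups. The following notion covers infinite groups too.\<close>

definition is_simple :: "('a, 'b) monoid_scheme \<Rightarrow> bool" where
  "is_simple G \<longleftrightarrow> group G \<and> carrier G \<noteq> {\<one>\<^bsub>G\<^esub>} \<and>
     (\<forall>N. N \<lhd> G \<longrightarrow> N = carrier G \<or> N = {\<one>\<^bsub>G\<^esub>})"

definition has_proper_noncyclic_quotient :: "('a, 'b) monoid_scheme \<Rightarrow> bool" where
  "has_proper_noncyclic_quotient G \<longleftrightarrow>
     (\<exists>N. N \<lhd> G \<and> N \<noteq> {\<one>\<^bsub>G\<^esub>} \<and> \<not> cyclic_group (G Mod N))"

definition every_proper_quotient_cyclic :: "('a, 'b) monoid_scheme \<Rightarrow> bool" where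
  "every_proper_quotient_cyclic G \<longleftrightarrow>
     (\<forall>N. N \<lhd> G \<and> N \<noteq> {\<one>\<^bsub>G\<^esub>} \<longrightarrow> cyclic_group (G Mod N))"

definition maximal_subgroup :: "'a set \<Rightarrow> ('a, 'b) monoid_scheme \<Rightarrow> bool" where
  "maximal_subgroup M G \<longleftrightarrow> subgroup M G \<and> M \<noteq> carrier G \<and>
     (\<forall>K. subgroup K G \<and> M \<subseteq> K \<longrightarrow> K = M \<or> K = carrier G)"

definition core_free :: "'a set \<Rightarrow> ('a, 'b) monoid_scheme \<Rightarrow> bool" where
  "core_free M G \<longleftrightarrow> (\<forall>N. N \<lhd> G \<and> N \<subseteq> M \<longrightarrow> N = {\<one>\<^bsub>G\<^esub>})"

definition primitive_group :: "('a, 'b) monoid_scheme \<Rightarrow> bool" where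
  "primitive_group G \<longleftrightarrow> group G \<and> (\<exists>M. maximal_subgroup M G \<and> core_free M G)"


section \<open>Graphs\<close>

text \<open>As in \<open>Graph_Theory\<close>, an undirected graph is a symmetric digraph, an edge being
  represented by its two arcs. The locales for finite graphs are not used, since the graphs
  here may be infinite.\<close>

definition isolated :: "('a, 'b) pre_digraph \<Rightarrow> 'a \<Rightarrow> bool" where
  "isolated \<Gamma> v \<longleftrightarrow> v \<in> verts \<Gamma> \<and> in_arcs \<Gamma> v = {} \<and> out_arcs \<Gamma> v = {}"

definition has_isolated_vertex :: "('a, 'b) pre_digraph \<Rightarrow> bool" where
  "has_isolated_vertex \<Gamma> \<longleftrightarrow> (\<exists>v. isolated \<Gamma> v)"

definition remove_isolated :: "('a, 'b) pre_digraph \<Rightarrow> ('a, 'b) pre_digraph" where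
  "remove_isolated \<Gamma> = \<Gamma> \<restriction> {v \<in> verts \<Gamma>. \<not> isolated \<Gamma> v}"

text \<open>Here \<open>\<mu>\<close> with unit weights is the graph distance, which is \<open>\<infinity>\<close> between vertices not joined
  by a walk. So the diameter of a disconnected graph is \<open>\<infinity>\<close> (and that of the graph without
  vertices is \<open>-\<infinity>\<close>).\<close>

definition diameter :: "('a, 'b) pre_digraph \<Rightarrow> ereal" where
  "diameter \<Gamma> = (SUP u \<in> verts \<Gamma>. SUP v \<in> verts \<Gamma>. wf_digraph.\<mu> \<Gamma> (\<lambda>_. 1) u v)"

definition connected_components :: "('a, 'b) pre_digraph \<Rightarrow> ('a, 'b) pre_digraph set" where
  "connected_components \<Gamma> = {C. pre_digraph.max_subgraph \<Gamma> Digraph_Component.connected C}"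


section \<open>The non-commuting, non-generating graph\<close>

definition Xi :: "('a, 'b) monoid_scheme \<Rightarrow> ('a, 'a \<times> 'a) pre_digraph" where
  "Xi G = with_proj
     \<lparr> pverts = carrier G - center G,
       parcs = {(x, y). x \<in> carrier G - center G \<and> y \<in> carrier G - center G \<and>
                  commutator G x y \<noteq> \<one>\<^bsub>G\<^esub> \<and> generate G {x, y} \<noteq> carrier G} \<rparr>"

definition Xi_plus :: "('a, 'b) monoid_scheme \<Rightarrow> ('a, 'a \<times> 'a) pre_digraph" where
  "Xi_plus G = remove_isolated (Xi G)"

lemma wf_digraph_Xi: "wf_digraph (Xi G)"
  by unfold_locales (auto simp: Xi_def)

lemma (in group) commutator_eq_one_iff:
  assumes "x \<in> carrier G" "y \<in> carrier G"
  shows "commutator G x y = \<one> \<longleftrightarrow> x \<otimes> y = y \<otimes> x"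
proof -
  have "commutator G x y = (x \<otimes> y) \<otimes> inv (y \<otimes> x)"
    using assms by (simp add: commutator_def inv_mult_group m_assoc)
  then show ?thesis
    using assms by (metis inv_closed inv_equality inv_inv m_closed r_inv)
qed

lemma (in group) Xi_simple_graph: "loopfree_digraph (Xi G)" "sym_digraph (Xi G)"
proof -
  interpret wf_digraph "Xi G" by (rule wf_digraph_Xi)
  show "loopfree_digraph (Xi G)"
    by unfold_locales (auto simp: Xi_def commutator_eq_one_iff)
  show "sym_digraph (Xi G)"
  proof
    show "symmetric (Xi G)"
      unfolding symmetric_def
      by (rule symI) (auto simp: Xi_def commutator_eq_one_iff insert_commute)
  qed
qed

end

theory Submission
  imports Defs "Jordan_Normal_Form.Schur_Decomposition" "Jordan_Normal_Form.Spectral_Radius"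
    "HOL-Algebra.Multiplicative_Group" "HOL-Algebra.Sylow"
begin

text \<open>
  Write \<open>Z\<close> for the centre of \<open>G\<close>. If \<open>N\<close> is normal and \<open>G \<noteq> N\<langle>x\<rangle>\<close>, then \<open>x\<close> is adjacent to every element of
  \<open>N\<close> not commuting with it; and \<open>G/N\<close> cyclic means \<open>G = N\<langle>w\<rangle>\<close> for some \<open>w\<close>.

  Suppose first that \<open>G/N\<close> is not cyclic for some normal \<open>N > Z\<close>, and let \<open>C = C\<^sub>G(N)\<close>. Elements outside of
  \<open>C\<close> have common neighbours in \<open>N\<close>, as a group is not the union of two proper subgroups. If \<open>G/C\<close> is not
  cyclic, this gives diameter at most \<open>3\<close>. Otherwise \<open>N\<close> is abelian and \<open>N \<le> C\<close>, and one distinguishes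
  whether \<open>C\<close> is abelian and whether \<open>G/C\<close> has prime order. The two components of case (v) are \<open>C - Z(C)\<close>
  and the remaining vertices, in the absence of edges between them. For finite \<open>G\<close>, distance \<open>4\<close> is excluded
  because \<open>c \<mapsto> [c, w]\<close> is then a bijection of \<open>C/Z(C)\<close> if no element of \<open>C - Z(C)\<close> commutes with \<open>w\<close>.

  Now suppose that \<open>G/N\<close> is cyclic for all normal \<open>N > Z\<close>. If some such \<open>N\<close> is abelian, or abelian modulo \<open>Z\<close>
  when there are isolated vertices, then its centralizer (modulo \<open>Z\<close>) behaves like a Frobenius kernel, and
  \<open>\<Xi>\<^sup>+\<close> has diameter \<open>2\<close>. Otherwise \<open>C\<^sub>G(N) = Z\<close> for all normal \<open>N > Z\<close>, and \<open>\<Xi>\<^sup>+\<close> has diameter at most \<open>3\<close>.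
  The centralizer \<open>M\<close> in \<open>G/Z\<close> of an isolated vertex is then a core-free maximal subgroup meeting its other
  conjugates trivially. If \<open>G/Z\<close> were finite, it would be a Frobenius group with complement \<open>M\<close>. Extending
  an irreducible representation of \<open>M\<close> as in the proof of Frobenius's theorem shows that a minimal normal
  subgroup \<open>S\<close> avoids \<open>M\<close>; then \<open>s \<mapsto> [s, x]\<close> is a permutation of \<open>S\<close>, so a conjugate of \<open>x\<close> normalizes a given
  Sylow subgroup of \<open>S\<close>. This contradicts the fact that \<open>M\<close> is the only maximal subgroup containing \<open>x\<close>.
\<close>

section \<open>Centralizers and cyclic extensions of normal subgroups\<close>

text \<open>Non-edges carry the structure: if \<open>y\<close> and \<open>w\<close> neither commute
  nor are adjacent, every subgroup containing both is \<open>G\<close>, so \<open>D\<close> and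
  \<open>w\<close> generate \<open>G\<close> for every normal \<open>D\<close> with
  \<open>y \<in> D\<close>. Every element is then \<open>d\<close> times a power of
  \<open>w\<close>. Applied to a known neighbour with \<open>D\<close> inside a subgroup at hand,
  the \<open>D\<close>-part becomes a common neighbour. The groups may be infinite: minimal normal
  subgroups may be missing, and conjugation can map a subgroup properly into itself, so invariance
  is checked under \<open>x\<close> and \<open>inv x\<close>. Finiteness enters in two places, the
  passage from an injective map on cosets to a surjective one, and the exclusion of finite
  \<open>G/Z\<close> in the case of an isolated vertex. There the character argument treats one
  element at a time: for \<open>d \<noteq> 1\<close> in \<open>M\<close>, an irreducible character
  of \<open>M\<close> separating \<open>d\<close> from \<open>1\<close> extends to \<open>G\<close>,
  and its kernel \<open>L\<close> omits \<open>d\<close>. If \<open>d\<close> were in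
  \<open>S\<close>, then \<open>L\<close> and \<open>S\<close> would meet trivially and hence
  commute, against the triviality of centralizers.\<close>

definition centralizer :: "('a, 'b) monoid_scheme \<Rightarrow> 'a set \<Rightarrow> 'a set" where
  "centralizer G S = {g \<in> carrier G. \<forall>s\<in>S. g \<otimes>\<^bsub>G\<^esub> s = s \<otimes>\<^bsub>G\<^esub> g}"

text \<open>A proper subgroup containing both elements replaces the condition on
  \<open>generate\<close>: an edge is shown by naming any such subgroup, and a non-edge can be
  applied to every subgroup.\<close>

definition adjacent :: "('a, 'b) monoid_scheme \<Rightarrow> 'a \<Rightarrow> 'a \<Rightarrow> bool" where
  "adjacent G x y \<longleftrightarrow> x \<in> carrier G \<and> y \<in> carrier G \<and> x \<otimes>\<^bsub>G\<^esub> y \<noteq> y \<otimes>\<^bsub>G\<^esub> x \<and>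
     (\<exists>H. subgroup H G \<and> H \<noteq> carrier G \<and> x \<in> H \<and> y \<in> H)"

text \<open>For normal \<open>N\<close> this product set is the subgroup generated by
  \<open>N\<close> and \<open>w\<close>; the arguments exploit the explicit form of its
  elements.\<close>

definition cyclic_extension :: "('a, 'b) monoid_scheme \<Rightarrow> 'a set \<Rightarrow> 'a \<Rightarrow> 'a set" where
  "cyclic_extension G N w = {n \<otimes>\<^bsub>G\<^esub> (w [^]\<^bsub>G\<^esub> i) |n (i::int). n \<in> N}"

definition cyclic_mod :: "('a, 'b) monoid_scheme \<Rightarrow> 'a set \<Rightarrow> bool" where
  "cyclic_mod G N \<longleftrightarrow> (\<exists>w\<in>carrier G. cyclic_extension G N w = carrier G)"

context group
begin

lemma mem_centralizer_iff:
  "g \<in> centralizer G S \<longleftrightarrow> g \<in> carrier G \<and> (\<forall>s\<in>S. g \<otimes> s = s \<otimes> g)"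
  by (simp add: centralizer_def)

lemma center_eq_centralizer: "center G = centralizer G (carrier G)"
  by (simp add: center_def centralizer_def)

lemma commute_inv:
  assumes "x \<in> carrier G" "y \<in> carrier G" "x \<otimes> y = y \<otimes> x"
  shows "inv x \<otimes> y = y \<otimes> inv x"
  by (metis assms inv_closed inv_solve_left inv_solve_right m_assoc m_closed)

lemma subgroup_centralizer:
  assumes "S \<subseteq> carrier G"
  shows "subgroup (centralizer G S) G"
proof (rule subgroupI)
  show "centralizer G S \<noteq> {}"
    using assms by (auto simp: centralizer_def intro!: exI[of _ \<one>])
  fix a b assume a: "a \<in> centralizer G S"
  then show "inv a \<in> centralizer G S"
    using assms commute_inv by (auto simp: centralizer_def subset_iff)
  assume b: "b \<in> centralizer G S"
  show "a \<otimes> b \<in> centralizer G S"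
    unfolding mem_centralizer_iff
  proof (intro conjI ballI)
    fix s assume s: "s \<in> S"
    then have "s \<in> carrier G" "a \<in> carrier G" "b \<in> carrier G" "a \<otimes> s = s \<otimes> a" "b \<otimes> s = s \<otimes> b"
      using a b assms by (auto simp: centralizer_def)
    then show "a \<otimes> b \<otimes> s = s \<otimes> (a \<otimes> b)"
      by (metis m_assoc)
  qed (use a b in \<open>auto simp: centralizer_def\<close>)
qed (auto simp: centralizer_def)

lemma subgroup_centralizer1: "x \<in> carrier G \<Longrightarrow> subgroup (centralizer G {x}) G"
  by (rule subgroup_centralizer) simp

lemma mem_centralizer1_iff:
  "g \<in> centralizer G {x} \<longleftrightarrow> g \<in> carrier G \<and> g \<otimes> x = x \<otimes> g"
  by (simp add: centralizer_def)

lemma centralizer1_sym: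
  assumes "g \<in> carrier G" "x \<in> carrier G"
  shows "g \<in> centralizer G {x} \<longleftrightarrow> x \<in> centralizer G {g}"
  using assms by (auto simp: centralizer_def)

lemma subgroup_center: "subgroup (center G) G"
  by (simp add: center_eq_centralizer subgroup_centralizer)

lemma center_subset: "center G \<subseteq> carrier G"
  by (auto simp: center_def)

lemma centralizer_eq_carrier_iff:
  "x \<in> carrier G \<Longrightarrow> centralizer G {x} = carrier G \<longleftrightarrow> x \<in> center G"
  unfolding center_def centralizer_def by auto (metis (mono_tags, lifting) mem_Collect_eq)

lemma subgroup_mult_cancel_right:
  assumes "subgroup H G" "a \<in> carrier G" "n \<in> H"
  shows "a \<otimes> n \<in> H \<longleftrightarrow> a \<in> H"
  by (metis assms inv_solve_right subgroup.m_closed subgroup.m_inv_closed subgroup.mem_carrier)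

lemma subgroup_mult_cancel_left:
  assumes "subgroup H G" "a \<in> carrier G" "n \<in> H"
  shows "n \<otimes> a \<in> H \<longleftrightarrow> a \<in> H"
  by (metis assms inv_solve_left subgroup.m_closed subgroup.m_inv_closed subgroup.mem_carrier)

lemma inv_mult_cancel:
  assumes "g \<in> carrier G" "b \<in> carrier G"
  shows "inv g \<otimes> (g \<otimes> b) = b" "g \<otimes> (inv g \<otimes> b) = b"
  using assms by (simp_all add: m_assoc[symmetric])

lemma conj_mult:
  assumes "g \<in> carrier G" "a \<in> carrier G" "b \<in> carrier G"
  shows "g \<otimes> (a \<otimes> b) \<otimes> inv g = (g \<otimes> a \<otimes> inv g) \<otimes> (g \<otimes> b \<otimes> inv g)"
proof -
  have "(g \<otimes> a \<otimes> inv g) \<otimes> (g \<otimes> b \<otimes> inv g) = g \<otimes> a \<otimes> (inv g \<otimes> g) \<otimes> b \<otimes> inv g"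
    using assms by (simp add: m_assoc inv_mult_cancel)
  then show ?thesis using assms by (simp add: m_assoc inv_mult_cancel)
qed

lemma conj_conj:
  assumes "g \<in> carrier G" "h \<in> carrier G" "a \<in> carrier G"
  shows "g \<otimes> (h \<otimes> a \<otimes> inv h) \<otimes> inv g = (g \<otimes> h) \<otimes> a \<otimes> inv (g \<otimes> h)"
  using assms by (simp add: m_assoc inv_mult_group)

lemma conj_inv_cancel:
  assumes "g \<in> carrier G" "a \<in> carrier G"
  shows "inv g \<otimes> (g \<otimes> a \<otimes> inv g) \<otimes> inv (inv g) = a"
  using assms conj_conj[of "inv g" g a] by simp

lemma conj_inv_cancel2:
  assumes "g \<in> carrier G" "a \<in> carrier G"
  shows "g \<otimes> (inv g \<otimes> a \<otimes> g) \<otimes> inv g = a"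
  using assms by (simp add: m_assoc inv_mult_cancel)

lemma conj_eq_self_iff:
  assumes "g \<in> carrier G" "a \<in> carrier G"
  shows "g \<otimes> a \<otimes> inv g = a \<longleftrightarrow> g \<otimes> a = a \<otimes> g"
  using assms by (metis inv_closed inv_solve_right' m_closed)

lemma conj_commute_iff:
  assumes "g \<in> carrier G" "a \<in> carrier G" "b \<in> carrier G"
  shows "(g \<otimes> a \<otimes> inv g) \<otimes> (g \<otimes> b \<otimes> inv g) = (g \<otimes> b \<otimes> inv g) \<otimes> (g \<otimes> a \<otimes> inv g) \<longleftrightarrow> a \<otimes> b = b \<otimes> a"
proof -
  have "(g \<otimes> a \<otimes> inv g) \<otimes> (g \<otimes> b \<otimes> inv g) = (g \<otimes> b \<otimes> inv g) \<otimes> (g \<otimes> a \<otimes> inv g) \<longleftrightarrow>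
     g \<otimes> (a \<otimes> b) \<otimes> inv g = g \<otimes> (b \<otimes> a) \<otimes> inv g"
    using assms by (simp add: conj_mult)
  also have "\<dots> \<longleftrightarrow> a \<otimes> b = b \<otimes> a"
    using assms by (metis conj_inv_cancel m_closed)
  finally show ?thesis .
qed

lemma normal_conj: "\<lbrakk>N \<lhd> G; g \<in> carrier G; n \<in> N\<rbrakk> \<Longrightarrow> g \<otimes> n \<otimes> inv g \<in> N"
  by (simp add: normal_inv_iff)

lemma normal_centralizer:
  assumes "N \<lhd> G"
  shows "centralizer G N \<lhd> G"
  unfolding normal_inv_iff
proof (intro conjI ballI)
  have N: "N \<subseteq> carrier G" using assms normal_imp_subgroup subgroup.subset by blast
  show "subgroup (centralizer G N) G" using N by (rule subgroup_centralizer)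
  fix g c assume g: "g \<in> carrier G" and c: "c \<in> centralizer G N"
  then have cc: "c \<in> carrier G" by (simp add: centralizer_def)
  show "g \<otimes> c \<otimes> inv g \<in> centralizer G N"
    unfolding mem_centralizer_iff
  proof (intro conjI ballI)
    fix n assume n: "n \<in> N"
    then have nc: "n \<in> carrier G" using N by auto
    have "inv g \<otimes> n \<otimes> inv (inv g) \<in> N" using assms g n by (intro normal_conj) auto
    then have n': "inv g \<otimes> n \<otimes> g \<in> N" using g by simp
    then have "c \<otimes> (inv g \<otimes> n \<otimes> g) = (inv g \<otimes> n \<otimes> g) \<otimes> c" using c by (simp add: centralizer_def)
    then have "(g \<otimes> c \<otimes> inv g) \<otimes> (g \<otimes> (inv g \<otimes> n \<otimes> g) \<otimes> inv g) = (g \<otimes> (inv g \<otimes> n \<otimes> g) \<otimes> inv g) \<otimes> (g \<otimes> c \<otimes> inv g)"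
      using g cc nc by (subst conj_commute_iff) auto
    then show "g \<otimes> c \<otimes> inv g \<otimes> n = n \<otimes> (g \<otimes> c \<otimes> inv g)"
      using g nc by (simp add: conj_inv_cancel2)
  qed (use g cc in auto)
qed

lemma normal_center: "center G \<lhd> G"
  unfolding center_eq_centralizer by (rule normal_centralizer[OF normal_self])

text \<open>Take \<open>a\<close> in \<open>H\<close> outside of \<open>A\<close> and
  \<open>b\<close> in \<open>H\<close> outside of \<open>B\<close>. The only case left is
  \<open>a \<in> B\<close>, \<open>b \<in> A\<close>, and then \<open>a \<otimes> b\<close> avoids
  both.\<close>

lemma subgroups_not_cover:
  assumes "subgroup H G" "subgroup A G" "subgroup B G" "\<not> H \<subseteq> A" "\<not> H \<subseteq> B"
  shows "\<exists>h\<in>H. h \<notin> A \<and> h \<notin> B"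
proof (rule ccontr)
  assume *: "\<not> ?thesis"
  obtain a where a: "a \<in> H" "a \<notin> A" using assms(4) by blast
  obtain b where b: "b \<in> H" "b \<notin> B" using assms(5) by blast
  have aB: "a \<in> B" and bA: "b \<in> A" using * a b by blast+
  have car: "a \<in> carrier G" "b \<in> carrier G" using a b subgroup.mem_carrier[OF assms(1)] by auto
  have "a \<otimes> b \<in> H" using subgroup.m_closed[OF assms(1)] a b by auto
  then have "a \<otimes> b \<in> A \<or> a \<otimes> b \<in> B" using * by blast
  then show False
    using subgroup_mult_cancel_right[OF assms(2) car(1) bA] subgroup_mult_cancel_left[OF assms(3) car(2) aB] a b by auto
qed

lemma proper_subgroups_not_cover:
  assumes "subgroup A G" "subgroup B G" "A \<noteq> carrier G" "B \<noteq> carrier G"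
  shows "\<exists>h\<in>carrier G. h \<notin> A \<and> h \<notin> B"
  using subgroups_not_cover[OF subgroup_self assms(1,2)] assms subgroup.subset by blast

lemma adjacent_sym: "adjacent G x y \<Longrightarrow> adjacent G y x"
  unfolding adjacent_def by metis

lemma adjacentI:
  "\<lbrakk>subgroup H G; H \<noteq> carrier G; x \<in> H; y \<in> H; x \<otimes> y \<noteq> y \<otimes> x\<rbrakk> \<Longrightarrow> adjacent G x y"
  unfolding adjacent_def by (meson subgroup.mem_carrier)

lemma not_adjacentD:
  "\<lbrakk>\<not> adjacent G x y; x \<otimes> y \<noteq> y \<otimes> x; subgroup H G; x \<in> H; y \<in> H\<rbrakk> \<Longrightarrow> H = carrier G"
  using adjacentI by blast

lemma adjacent_carrier: "adjacent G x y \<Longrightarrow> x \<in> carrier G \<and> y \<in> carrier G"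
  by (simp add: adjacent_def)

lemma adjacent_not_commute: "adjacent G x y \<Longrightarrow> x \<otimes> y \<noteq> y \<otimes> x"
  by (simp add: adjacent_def)

lemma adjacent_not_center: "adjacent G x y \<Longrightarrow> x \<notin> center G \<and> y \<notin> center G"
  unfolding adjacent_def center_def by force

lemma adjacentE:
  assumes "adjacent G x y"
  obtains H where "subgroup H G" "H \<noteq> carrier G" "x \<in> H" "y \<in> H"
  using assms unfolding adjacent_def by blast

lemma adjacent_arcs_iff:
  "adjacent G x y \<longleftrightarrow> x \<in> carrier G - center G \<and> y \<in> carrier G - center G \<and>
     commutator G x y \<noteq> \<one> \<and> generate G {x, y} \<noteq> carrier G"
proof
  assume L: "adjacent G x y"
  then obtain H where H: "subgroup H G" "H \<noteq> carrier G" "x \<in> H" "y \<in> H" by (rule adjacentE)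
  then have "generate G {x,y} \<subseteq> H" by (intro generate_subgroup_incl) auto
  then have "generate G {x,y} \<noteq> carrier G" using H subgroup.subset by blast
  then show "x \<in> carrier G - center G \<and> y \<in> carrier G - center G \<and>
     commutator G x y \<noteq> \<one> \<and> generate G {x, y} \<noteq> carrier G"
    using L adjacent_carrier[OF L] adjacent_not_center[OF L] adjacent_not_commute[OF L]
    by (simp add: commutator_eq_one_iff)
next
  assume R: "x \<in> carrier G - center G \<and> y \<in> carrier G - center G \<and>
     commutator G x y \<noteq> \<one> \<and> generate G {x, y} \<noteq> carrier G"
  show "adjacent G x y"
  proof (rule adjacentI)
    show "subgroup (generate G {x,y}) G" using R by (intro generate_is_subgroup) auto
    show "x \<in> generate G {x,y}" "y \<in> generate G {x,y}" by (auto intro: generate.incl)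
    show "x \<otimes> y \<noteq> y \<otimes> x" using R by (auto simp: commutator_eq_one_iff)
  qed (use R in auto)
qed

lemma subgroup_cyclic_extension:
  assumes N: "N \<lhd> G" and w: "w \<in> carrier G"
  shows "subgroup (cyclic_extension G N w) G"
proof (rule subgroupI)
  have sub: "subgroup N G" using N normal_imp_subgroup by blast
  have Nc: "n \<in> carrier G" if "n \<in> N" for n using subgroup.mem_carrier[OF sub that] .
  show "cyclic_extension G N w \<subseteq> carrier G" using Nc w by (auto simp: cyclic_extension_def)
  show "cyclic_extension G N w \<noteq> {}"
    using subgroup.one_closed[OF sub] by (auto simp: cyclic_extension_def)
  fix a b assume "a \<in> cyclic_extension G N w"
  then obtain n i where a: "a = n \<otimes> w [^] (i::int)" "n \<in> N" by (auto simp: cyclic_extension_def)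
  have nc: "n \<in> carrier G" using Nc a by auto
  have "inv a = inv (w [^] i) \<otimes> inv n" using a nc w by (simp add: inv_mult_group)
  also have "\<dots> = (w [^] (-i) \<otimes> inv n \<otimes> inv (w [^] (-i))) \<otimes> w [^] (-i)"
    using nc w by (simp add: int_pow_neg m_assoc)
  finally have "inv a = (w [^] (-i) \<otimes> inv n \<otimes> inv (w [^] (-i))) \<otimes> w [^] (-i)" .
  moreover have "w [^] (-i) \<otimes> inv n \<otimes> inv (w [^] (-i)) \<in> N"
    using N w a subgroup.m_inv_closed[OF sub] by (intro normal_conj) auto
  ultimately show "inv a \<in> cyclic_extension G N w" unfolding cyclic_extension_def by blast
  assume "b \<in> cyclic_extension G N w"
  then obtain m j where b: "b = m \<otimes> w [^] (j::int)" "m \<in> N" by (auto simp: cyclic_extension_def)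
  have mc: "m \<in> carrier G" using Nc b by auto
  have "a \<otimes> b = (n \<otimes> (w [^] i \<otimes> m \<otimes> inv (w [^] i))) \<otimes> (w [^] i \<otimes> w [^] j)"
    using a b nc mc w by (simp add: m_assoc inv_solve_left)
  also have "\<dots> = (n \<otimes> (w [^] i \<otimes> m \<otimes> inv (w [^] i))) \<otimes> w [^] (i + j)"
    using w by (simp add: int_pow_mult)
  finally have "a \<otimes> b = (n \<otimes> (w [^] i \<otimes> m \<otimes> inv (w [^] i))) \<otimes> w [^] (i + j)" .
  moreover have "n \<otimes> (w [^] i \<otimes> m \<otimes> inv (w [^] i)) \<in> N"
    using N w a b by (intro subgroup.m_closed[OF sub] normal_conj) auto
  ultimately show "a \<otimes> b \<in> cyclic_extension G N w" unfolding cyclic_extension_def by blast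
qed

lemma cyclic_extensionI: "n \<in> N \<Longrightarrow> n \<otimes> w [^] (i::int) \<in> cyclic_extension G N w"
  by (auto simp: cyclic_extension_def)

lemma cyclic_extension_incl: "\<lbrakk>N \<lhd> G; w \<in> carrier G; n \<in> N\<rbrakk> \<Longrightarrow> n \<in> cyclic_extension G N w"
  using cyclic_extensionI[of n N w 0] normal_imp_subgroup subgroup.mem_carrier by fastforce

lemma cyclic_extension_pow: "\<lbrakk>N \<lhd> G; w \<in> carrier G\<rbrakk> \<Longrightarrow> w [^] (i::int) \<in> cyclic_extension G N w"
  using cyclic_extensionI[of \<one> N w i] normal_imp_subgroup subgroup.one_closed by fastforce

lemma cyclic_extension_self: "\<lbrakk>N \<lhd> G; w \<in> carrier G\<rbrakk> \<Longrightarrow> w \<in> cyclic_extension G N w"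
  using cyclic_extension_pow[of N w 1] by simp

lemma cyclic_extensionE:
  assumes "x \<in> cyclic_extension G N w"
  obtains n i where "n \<in> N" "x = n \<otimes> w [^] (i::int)"
  using assms by (auto simp: cyclic_extension_def)

lemma cyclic_extension_minimal:
  assumes "subgroup K G" "N \<subseteq> K" "w \<in> K"
  shows "cyclic_extension G N w \<subseteq> K"
  using assms subgroup.m_closed subgroup_int_pow_closed by (fastforce simp: cyclic_extension_def)

lemma cyclic_group_FactGroup_iff:
  assumes N: "N \<lhd> G"
  shows "cyclic_group (G Mod N) \<longleftrightarrow> cyclic_mod G N"
proof -
  interpret N: normal N G by (rule N)
  interpret Q: group "G Mod N" by (rule N.factorgroup_is_group)
  have sub: "subgroup N G" by (rule N.subgroup_axioms)
  have pow: "(N #> w) [^]\<^bsub>G Mod N\<^esub> (i::int) = N #> (w [^] i)" if "w \<in> carrier G" for w i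
    by (rule N.FactGroup_int_pow[OF that])
  have eq: "carrier (G Mod N) = range (\<lambda>i::int. (N #> w) [^]\<^bsub>G Mod N\<^esub> i) \<longleftrightarrow> cyclic_extension G N w = carrier G"
    (is "?L \<longleftrightarrow> ?R") if w: "w \<in> carrier G" for w
  proof
    assume L: ?L
    show ?R
    proof
      show "cyclic_extension G N w \<subseteq> carrier G"
        using subgroup_cyclic_extension[OF N w] subgroup.subset by blast
      show "carrier G \<subseteq> cyclic_extension G N w"
      proof
        fix g assume g: "g \<in> carrier G"
        then have "N #> g \<in> carrier (G Mod N)" by (auto simp: carrier_FactGroup)
        then obtain i :: int where "N #> g = N #> (w [^] i)" using L pow[OF w] by auto
        then have "g \<in> N #> (w [^] i)" using rcos_self[OF g sub] by simp
        then show "g \<in> cyclic_extension G N w" by (auto simp: r_coset_def cyclic_extension_def)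
      qed
    qed
  next
    assume R: ?R
    show ?L
    proof
      show "range (\<lambda>i::int. (N #> w) [^]\<^bsub>G Mod N\<^esub> i) \<subseteq> carrier (G Mod N)"
        using pow[OF w] w by (auto simp: carrier_FactGroup)
      show "carrier (G Mod N) \<subseteq> range (\<lambda>i::int. (N #> w) [^]\<^bsub>G Mod N\<^esub> i)"
      proof
        fix X assume "X \<in> carrier (G Mod N)"
        then obtain g where g: "g \<in> carrier G" "X = N #> g" by (auto simp: carrier_FactGroup)
        then obtain n i where ni: "n \<in> N" "g = n \<otimes> w [^] (i::int)"
          using R by (metis cyclic_extensionE)
        then have "g \<in> N #> (w [^] i)" by (auto simp: r_coset_def)
        then have "X = N #> (w [^] i)" using g w sub repr_independence by auto
        then show "X \<in> range (\<lambda>i::int. (N #> w) [^]\<^bsub>G Mod N\<^esub> i)" using pow[OF w] by auto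
      qed
    qed
  qed
  show ?thesis
  proof
    assume "cyclic_group (G Mod N)"
    then obtain X where X: "X \<in> carrier (G Mod N)" "carrier (G Mod N) = range (\<lambda>i::int. X [^]\<^bsub>G Mod N\<^esub> i)"
      using Q.cyclic_group by metis
    from X(1) obtain w where w: "w \<in> carrier G" "X = N #> w"
      unfolding carrier_FactGroup by blast
    show "cyclic_mod G N"
      unfolding cyclic_mod_def using eq[OF w(1)] X(2) w by blast
  next
    assume "cyclic_mod G N"
    then obtain w where w: "w \<in> carrier G" "cyclic_extension G N w = carrier G"
      unfolding cyclic_mod_def by blast
    have "N #> w \<in> carrier (G Mod N)" using w(1) unfolding carrier_FactGroup by blast
    then show "cyclic_group (G Mod N)"
      using eq[OF w(1)] w(2) Q.cyclic_group by metis
  qed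
qed

end

text \<open>The disjunct \<open>x = y\<close> at every stage makes this a walk of length at most
  \<open>n\<close>, hence monotone in \<open>n\<close>: a bound on the distance.\<close>

fun reach :: "('a \<Rightarrow> 'a \<Rightarrow> bool) \<Rightarrow> nat \<Rightarrow> 'a \<Rightarrow> 'a \<Rightarrow> bool" where
  "reach E 0 x y \<longleftrightarrow> x = y"
| "reach E (Suc n) x y \<longleftrightarrow> x = y \<or> (\<exists>z. E x z \<and> reach E n z y)"

lemma reach_refl [simp]: "reach E n x x"
  by (cases n) auto

lemma reach_append: "reach E m x y \<Longrightarrow> reach E n y z \<Longrightarrow> reach E (m + n) x z"
proof (induction m arbitrary: x)
  case (Suc m)
  show ?case
  proof (cases "x = y")
    case True
    have "reach E n x z \<Longrightarrow> reach E (k + n) x z" for k x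
    proof (induction n arbitrary: x)
      case (Suc n)
      then show ?case by auto
    qed simp
    then show ?thesis using True Suc.prems by blast
  qed (use Suc in auto)
qed simp

lemma reach_mono: "reach E m x y \<Longrightarrow> m \<le> n \<Longrightarrow> reach E n x y"
  using reach_append[of E m x y "n - m" y] by simp

lemma reach_1: "E x y \<Longrightarrow> reach E (Suc n) x y"
  by auto

lemma reach_2: "E x z \<Longrightarrow> E z y \<Longrightarrow> reach E 2 x y"
  by (auto simp: numeral_2_eq_2)

lemma reach_3: "E x z \<Longrightarrow> E z u \<Longrightarrow> E u y \<Longrightarrow> reach E 3 x y"
  by (auto simp: numeral_3_eq_3)

lemma reach_step: "E x z \<Longrightarrow> reach E n z y \<Longrightarrow> reach E (Suc n) x y"
  by auto

lemma reach_sym: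
  assumes "\<And>x y. E x y \<Longrightarrow> E y x" "reach E n x y"
  shows "reach E n y x"
  using assms(2)
proof (induction n arbitrary: x)
  case (Suc n)
  show ?case
  proof (cases "x = y")
    case False
    then obtain z where z: "E x z" "reach E n z y" using Suc.prems by auto
    have "reach E n y z" using Suc.IH z by blast
    moreover have "reach E 1 z x" using assms(1) z by auto
    ultimately have "reach E (n + 1) y x" by (rule reach_append)
    then show ?thesis by (simp del: reach.simps)
  qed simp
qed simp

context group
begin

lemma mem_subgroup: "subgroup H G \<Longrightarrow> x \<in> H \<Longrightarrow> x \<in> carrier G"
  by (rule subgroup.mem_carrier)

lemma mem_normal: "N \<lhd> G \<Longrightarrow> x \<in> N \<Longrightarrow> x \<in> carrier G"
  using normal_imp_subgroup mem_subgroup by metis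

lemma center_commute: "\<lbrakk>z \<in> center G; x \<in> carrier G\<rbrakk> \<Longrightarrow> z \<otimes> x = x \<otimes> z"
  by (simp add: center_def)

lemma center_subset_centralizer: "S \<subseteq> carrier G \<Longrightarrow> center G \<subseteq> centralizer G S"
  by (auto simp: center_def centralizer_def)

lemma int_pow_commute: "x \<in> carrier G \<Longrightarrow> x [^] (i::int) \<otimes> x [^] (j::int) = x [^] j \<otimes> x [^] i"
  by (metis int_pow_mult add.commute)

lemma int_pow_commute_self: "x \<in> carrier G \<Longrightarrow> x [^] (i::int) \<otimes> x = x \<otimes> x [^] i"
  using int_pow_commute[of x i 1] by simp

lemma int_pow_in_centralizer: "x \<in> carrier G \<Longrightarrow> x [^] (i::int) \<in> centralizer G {x}"
  by (simp add: mem_centralizer1_iff int_pow_commute_self)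

lemma subgroup_int_pow: "subgroup H G \<Longrightarrow> x \<in> H \<Longrightarrow> x [^] (i::int) \<in> H"
  by (rule subgroup_int_pow_closed)

text \<open>\<open>H\<close> modulo the central subgroup \<open>H \<inter> C\<close> embeds in the
  cyclic group \<open>G Mod C\<close>, and a group that is cyclic modulo a central subgroup is
  abelian.\<close>

lemma abelian_if_cyclic_mod:
  assumes H: "subgroup H G" and C: "C \<lhd> G" and cyc: "cyclic_mod G C"
    and com: "\<And>h k. \<lbrakk>h \<in> H; h \<in> C; k \<in> H\<rbrakk> \<Longrightarrow> h \<otimes> k = k \<otimes> h"
    and h: "h \<in> H" and k: "k \<in> H"
  shows "h \<otimes> k = k \<otimes> h"
proof -
  interpret C: normal C G by (rule C)
  interpret Q: group "G Mod C" by (rule C.factorgroup_is_group)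
  interpret pi: group_hom G "G Mod C" "\<lambda>x. C #> x"
    by (simp add: group_hom_def group_hom_axioms_def group_axioms Q.group_axioms C.r_coset_hom_Mod)
  have Csub: "subgroup C G" using C normal_imp_subgroup by blast
  obtain g where g: "g \<in> carrier G" "cyclic_extension G C g = carrier G"
    using cyc by (auto simp: cyclic_mod_def)
  let ?c = "C #> g"
  have gc: "?c \<in> carrier (G Mod C)" using pi.hom_closed g(1) by blast
  have pow: "\<exists>i::int. C #> x = ?c [^]\<^bsub>G Mod C\<^esub> i" if "x \<in> carrier G" for x
  proof -
    have "x \<in> cyclic_extension G C g" using that g(2) by simp
    then obtain n i where ni: "n \<in> C" "x = n \<otimes> g [^] (i::int)" by (rule cyclic_extensionE)
    have nc: "n \<in> carrier G" using mem_normal[OF C ni(1)] .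
    have "C #> n = C" using coset_join2[OF nc Csub ni(1)] .
    then have "C #> x = \<one>\<^bsub>G Mod C\<^esub> \<otimes>\<^bsub>G Mod C\<^esub> (C #> g [^] i)"
      using pi.hom_mult[OF nc, of "g [^] i"] ni(2) g(1) by simp
    also have "\<dots> = C #> g [^] i" using Q.l_one pi.hom_closed[of "g [^] i"] g(1) by simp
    also have "\<dots> = ?c [^]\<^bsub>G Mod C\<^esub> i" using pi.hom_int_pow g(1) by simp
    finally show ?thesis by blast
  qed
  have hc: "h \<in> carrier G" and kc: "k \<in> carrier G" using mem_subgroup[OF H] h k by auto
  obtain i where i: "C #> h = ?c [^]\<^bsub>G Mod C\<^esub> (i::int)" using pow[OF hc] by blast
  obtain j where j: "C #> k = ?c [^]\<^bsub>G Mod C\<^esub> (j::int)" using pow[OF kc] by blast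
  \<comment> \<open>A generator of \<open>G Mod C\<close> need not come from \<open>H\<close>.
    Bezout coefficients give an \<open>m \<in> H\<close> whose image is the power with exponent
    \<open>gcd i j\<close>; then \<open>h\<close> and \<open>k\<close> are powers of
    \<open>m\<close> up to factors in \<open>H \<inter> C\<close>.\<close>
  obtain a b where ab: "a * i + b * j = gcd i j" using bezout_int by metis
  define d where "d = gcd i j"
  obtain s where s: "i = d * s" unfolding d_def using gcd_dvd1 dvd_def by metis
  obtain t where t: "j = d * t" unfolding d_def using gcd_dvd2 dvd_def by metis
  define m where "m = h [^] a \<otimes> k [^] b"
  have mH: "m \<in> H" unfolding m_def using subgroup_int_pow[OF H] subgroup.m_closed[OF H] h k by blast
  have mc: "m \<in> carrier G" using mem_subgroup[OF H mH] .
  have pm: "C #> m = ?c [^]\<^bsub>G Mod C\<^esub> d"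
  proof -
    have "C #> m = (C #> h) [^]\<^bsub>G Mod C\<^esub> a \<otimes>\<^bsub>G Mod C\<^esub> (C #> k) [^]\<^bsub>G Mod C\<^esub> b"
      unfolding m_def using pi.hom_mult pi.hom_int_pow hc kc int_pow_closed by presburger
    also have "\<dots> = ?c [^]\<^bsub>G Mod C\<^esub> (i * a) \<otimes>\<^bsub>G Mod C\<^esub> ?c [^]\<^bsub>G Mod C\<^esub> (j * b)"
      unfolding i j using Q.int_pow_pow[OF gc] by presburger
    also have "\<dots> = ?c [^]\<^bsub>G Mod C\<^esub> (i * a + j * b)" using Q.int_pow_mult[OF gc] by simp
    also have "i * a + j * b = d" using ab d_def by (simp add: mult.commute)
    finally show ?thesis .
  qed
  have in_C: "x \<otimes> inv (m [^] u) \<in> C"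
    if x: "x \<in> carrier G" "C #> x = ?c [^]\<^bsub>G Mod C\<^esub> (d * u)" for x and u :: int
  proof -
    have "C #> (m [^] u) = ?c [^]\<^bsub>G Mod C\<^esub> (d * u)"
      using pi.hom_int_pow[OF mc] pm Q.int_pow_pow[OF gc] by presburger
    then have "C #> x = C #> (m [^] u)" using x by simp
    then have "x \<in> C #> (m [^] u)" using rcos_self[OF x(1) Csub] by simp
    then show ?thesis using C.rcos_module_imp[OF is_group, of "m [^] u" x] mc by simp
  qed
  define z z' where "z = h \<otimes> inv (m [^] s)" and "z' = k \<otimes> inv (m [^] t)"
  have ms: "m [^] s \<in> H" "m [^] t \<in> H" using subgroup_int_pow[OF H mH] by auto
  have zC: "z \<in> C" unfolding z_def using in_C hc i s by simp
  have z'C: "z' \<in> C" unfolding z'_def using in_C kc j t by simp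
  have zH: "z \<in> H" "z' \<in> H" unfolding z_def z'_def
    using subgroup.m_closed[OF H] subgroup.m_inv_closed[OF H] h k ms by auto
  have car: "z \<in> carrier G" "z' \<in> carrier G" using zH mem_subgroup[OF H] by auto
  have he: "h = z \<otimes> m [^] s" unfolding z_def using hc mc by (simp add: m_assoc)
  have ke: "k = z' \<otimes> m [^] t" unfolding z'_def using kc mc by (simp add: m_assoc)
  have sub1: "subgroup (centralizer G {m [^] s}) G" using mc by (intro subgroup_centralizer1) auto
  have "z' \<in> centralizer G {m [^] s}" using com[OF zH(2) z'C ms(1)] car by (simp add: mem_centralizer1_iff)
  moreover have "m [^] t \<in> centralizer G {m [^] s}" using mc by (simp add: mem_centralizer1_iff int_pow_commute)
  ultimately have "k \<in> centralizer G {m [^] s}" unfolding ke by (rule subgroup.m_closed[OF sub1])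
  then have "m [^] s \<in> centralizer G {k}" using kc mc by (simp add: centralizer1_sym)
  moreover have "z \<in> centralizer G {k}" using com[OF zH(1) zC k] car by (simp add: mem_centralizer1_iff)
  ultimately have "h \<in> centralizer G {k}"
    unfolding he using subgroup.m_closed[OF subgroup_centralizer1[OF kc]] by blast
  then show ?thesis by (simp add: mem_centralizer1_iff)
qed

text \<open>This is the product of \<open>H\<close> and the powers of \<open>z\<close>, described so
  that membership directly hands over an element of \<open>H\<close>.\<close>

lemma subgroup_mult_central_powers:
  assumes H: "subgroup H G" and z: "z \<in> center G"
  shows "subgroup {g \<in> carrier G. \<exists>k::int. g \<otimes> z [^] k \<in> H} G"
proof (rule subgroupI)
  have zc: "z \<in> carrier G" using z center_subset by blast
  have zp: "z [^] k \<in> center G" for k :: int using subgroup_int_pow[OF subgroup_center z] .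
  show "{g \<in> carrier G. \<exists>k::int. g \<otimes> z [^] k \<in> H} \<noteq> {}"
    using subgroup.one_closed[OF H] by (auto intro!: exI[of _ \<one>] exI[of _ 0])
  fix a assume "a \<in> {g \<in> carrier G. \<exists>k::int. g \<otimes> z [^] k \<in> H}"
  then obtain k :: int where a: "a \<in> carrier G" "a \<otimes> z [^] k \<in> H" by blast
  have "inv (a \<otimes> z [^] k) = inv a \<otimes> z [^] (-k)"
    using a(1) zc center_commute[OF zp[of "-k"], of "inv a"] by (simp add: inv_mult_group int_pow_neg)
  then show "inv a \<in> {g \<in> carrier G. \<exists>k::int. g \<otimes> z [^] k \<in> H}"
    using a subgroup.m_inv_closed[OF H a(2)] by force
  fix b assume "b \<in> {g \<in> carrier G. \<exists>k::int. g \<otimes> z [^] k \<in> H}"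
  then obtain l :: int where b: "b \<in> carrier G" "b \<otimes> z [^] l \<in> H" by blast
  have "(a \<otimes> z [^] k) \<otimes> (b \<otimes> z [^] l) = a \<otimes> (z [^] k \<otimes> b) \<otimes> z [^] l"
    using a b zc by (simp add: m_assoc)
  also have "\<dots> = (a \<otimes> b) \<otimes> z [^] (k + l)"
    using a b zc by (simp add: center_commute[OF zp b(1)] m_assoc int_pow_mult)
  finally show "a \<otimes> b \<in> {g \<in> carrier G. \<exists>k::int. g \<otimes> z [^] k \<in> H}"
    using a b subgroup.m_closed[OF H a(2) b(2)] by auto
qed auto

lemma subgroup_mult_center:
  assumes H: "subgroup H G"
  shows "subgroup {g \<in> carrier G. \<exists>z\<in>center G. g \<otimes> z \<in> H} G"
proof (rule subgroupI)
  have zc: "z \<in> carrier G" if "z \<in> center G" for z using that center_subset by blast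
  show "{g \<in> carrier G. \<exists>z\<in>center G. g \<otimes> z \<in> H} \<noteq> {}"
    using subgroup.one_closed[OF H] subgroup.one_closed[OF subgroup_center] by (auto intro!: exI[of _ \<one>] bexI[of _ \<one>])
  fix a assume "a \<in> {g \<in> carrier G. \<exists>z\<in>center G. g \<otimes> z \<in> H}"
  then obtain z where a: "a \<in> carrier G" "z \<in> center G" "a \<otimes> z \<in> H" by blast
  have iz: "inv z \<in> center G" using subgroup.m_inv_closed[OF subgroup_center a(2)] .
  have "inv (a \<otimes> z) = inv a \<otimes> inv z"
    using a zc center_commute[OF iz, of "inv a"] by (simp add: inv_mult_group)
  then show "inv a \<in> {g \<in> carrier G. \<exists>z\<in>center G. g \<otimes> z \<in> H}"
    using a subgroup.m_inv_closed[OF H a(3)] iz by force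
  fix b assume "b \<in> {g \<in> carrier G. \<exists>z\<in>center G. g \<otimes> z \<in> H}"
  then obtain y where b: "b \<in> carrier G" "y \<in> center G" "b \<otimes> y \<in> H" by blast
  have "(a \<otimes> z) \<otimes> (b \<otimes> y) = a \<otimes> (z \<otimes> b) \<otimes> y"
    using a b zc by (simp add: m_assoc)
  also have "\<dots> = (a \<otimes> b) \<otimes> (z \<otimes> y)"
    using a b zc by (simp add: center_commute[OF a(2) b(1)] m_assoc)
  finally show "a \<otimes> b \<in> {g \<in> carrier G. \<exists>z\<in>center G. g \<otimes> z \<in> H}"
    using a b subgroup.m_closed[OF H a(3) b(3)] subgroup.m_closed[OF subgroup_center a(2) b(2)] by auto
qed auto

text \<open>The normalizer of \<open>D\<close> contains \<open>x\<close> and \<open>D\<close>, hence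
  is everything. Both directions of conjugation by \<open>x\<close> are assumed because
  \<open>x D x^-1\<close> can be properly contained in an infinite \<open>D\<close>.\<close>

lemma normal_if_normalized_by_generators:
  assumes D: "subgroup D G" and K: "\<And>K. \<lbrakk>subgroup K G; x \<in> K; D \<subseteq> K\<rbrakk> \<Longrightarrow> K = carrier G"
    and x: "x \<in> carrier G"
    and cx: "\<And>d. d \<in> D \<Longrightarrow> x \<otimes> d \<otimes> inv x \<in> D" "\<And>d. d \<in> D \<Longrightarrow> inv x \<otimes> d \<otimes> x \<in> D"
  shows "D \<lhd> G"
proof -
  let ?N = "{g \<in> carrier G. \<forall>d\<in>D. g \<otimes> d \<otimes> inv g \<in> D \<and> inv g \<otimes> d \<otimes> g \<in> D}"
  have Dc: "d \<in> carrier G" if "d \<in> D" for d using mem_subgroup[OF D that] .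
  have "subgroup ?N G"
  proof (rule subgroupI)
    show "?N \<noteq> {}" using Dc by (force intro!: exI[of _ \<one>])
    fix a assume a: "a \<in> ?N"
    then show "inv a \<in> ?N" by auto
    fix b assume b: "b \<in> ?N"
    have "a \<otimes> b \<otimes> d \<otimes> inv (a \<otimes> b) \<in> D \<and> inv (a \<otimes> b) \<otimes> d \<otimes> (a \<otimes> b) \<in> D" if d: "d \<in> D" for d
    proof -
      have c: "a \<in> carrier G" "b \<in> carrier G" using a b by auto
      have "a \<otimes> b \<otimes> d \<otimes> inv (a \<otimes> b) = a \<otimes> (b \<otimes> d \<otimes> inv b) \<otimes> inv a"
        using conj_conj c Dc[OF d] by simp
      moreover have "inv (a \<otimes> b) \<otimes> d \<otimes> (a \<otimes> b) = inv b \<otimes> (inv a \<otimes> d \<otimes> a) \<otimes> b"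
        using c Dc[OF d] by (simp add: inv_mult_group m_assoc)
      ultimately show ?thesis using a b d by auto
    qed
    then show "a \<otimes> b \<in> ?N" using a b by auto
  qed auto
  moreover have "x \<in> ?N" using x cx by auto
  moreover have "D \<subseteq> ?N"
    using Dc subgroup.m_closed[OF D] subgroup.m_inv_closed[OF D] by auto
  ultimately have "?N = carrier G" using K by blast
  then show ?thesis unfolding normal_inv_iff using D by blast
qed

lemma conj_int_pow_shift:
  assumes "x \<in> carrier G" "n \<in> carrier G"
  shows "x \<otimes> (x [^] (i::int) \<otimes> n \<otimes> inv (x [^] i)) \<otimes> inv x = x [^] (i + 1) \<otimes> n \<otimes> inv (x [^] (i + 1))"
proof -
  have "x \<otimes> x [^] i = x [^] (i + 1)" using assms int_pow_mult[of x 1 i] by (simp add: add.commute)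
  then show ?thesis using conj_conj[of x "x [^] i" n] assms by simp
qed

lemma conj_in_centralizer_iff:
  assumes "g \<in> carrier G" "c \<in> carrier G" "s \<in> carrier G"
  shows "(g \<otimes> c \<otimes> inv g) \<otimes> s = s \<otimes> (g \<otimes> c \<otimes> inv g) \<longleftrightarrow> c \<otimes> (inv g \<otimes> s \<otimes> g) = (inv g \<otimes> s \<otimes> g) \<otimes> c"
  using conj_commute_iff[of g c "inv g \<otimes> s \<otimes> g"] assms by (simp add: conj_inv_cancel2)

end

section \<open>Cyclic proper quotients\<close>

context group
begin

lemma reach_adjacent_sym: "reach (adjacent G) n x y \<Longrightarrow> reach (adjacent G) n y x"
  by (rule reach_sym) (rule adjacent_sym)

lemma normal_proper_adjacent:
  assumes "N \<lhd> G" "N \<noteq> carrier G" "n \<in> N" "m \<in> N" "n \<otimes> m \<noteq> m \<otimes> n"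
  shows "adjacent G n m"
  using adjacentI[OF normal_imp_subgroup[OF assms(1)] assms(2-5)] .

text \<open>The centralizers of \<open>x\<close> and \<open>y\<close> meet \<open>N\<close> in
  proper subgroups, whose union is not \<open>N\<close>. Any element of \<open>N\<close> outside of
  both works, with \<open>N\<close> itself as the proper subgroup behind the edges.\<close>

lemma common_neighbour_in_normal:
  assumes N: "N \<lhd> G" "N \<noteq> carrier G" and x: "x \<in> N" "\<not> N \<subseteq> centralizer G {x}"
    and y: "y \<in> N" "\<not> N \<subseteq> centralizer G {y}"
  shows "\<exists>m\<in>N. adjacent G x m \<and> adjacent G m y"
proof -
  have sub: "subgroup N G" using N normal_imp_subgroup by blast
  have c: "x \<in> carrier G" "y \<in> carrier G" using mem_subgroup[OF sub] x y by auto
  obtain m where m: "m \<in> N" "m \<notin> centralizer G {x}" "m \<notin> centralizer G {y}"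
    using subgroups_not_cover[OF sub subgroup_centralizer1[OF c(1)] subgroup_centralizer1[OF c(2)]] x y by blast
  then have "m \<otimes> x \<noteq> x \<otimes> m" "m \<otimes> y \<noteq> y \<otimes> m"
    using mem_subgroup[OF sub] by (auto simp: mem_centralizer1_iff)
  then show ?thesis
    using m normal_proper_adjacent[OF N x(1) m(1)] normal_proper_adjacent[OF N m(1) y(1)] by metis
qed

text \<open>The standard use of a non-edge: the subgroup generated by \<open>D\<close> and
  \<open>w\<close> contains two noncommuting, nonadjacent elements, so it is not proper.\<close>

lemma not_adjacent_cyclic_extension:
  assumes "\<not> adjacent G y w" "y \<otimes> w \<noteq> w \<otimes> y" "D \<lhd> G" "y \<in> D" "w \<in> carrier G"
  shows "cyclic_extension G D w = carrier G"
  using not_adjacentD[OF assms(1,2) subgroup_cyclic_extension[OF assms(3,5)]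
      cyclic_extension_incl[OF assms(3,5,4)] cyclic_extension_self[OF assms(3,5)]] .

end

text \<open>The common setting of the families, soluble or not, where \<open>\<Xi>\<^sup>+\<close> has diameter \<open>2\<close> and \<open>\<Xi>\<close>
  can have isolated vertices.\<close>

locale frobenius_like = group +
  fixes C
  assumes C: "C \<lhd> G" and not_central: "\<not> C \<subseteq> center G" and proper: "C \<noteq> carrier G"
    and no_commute: "\<And>y w. \<lbrakk>y \<in> C; y \<notin> center G; w \<in> carrier G; w \<notin> C\<rbrakk> \<Longrightarrow> y \<otimes> w \<noteq> w \<otimes> y"
begin

lemma sub: "subgroup C G"
  using C normal_imp_subgroup by blast

lemma Cc: "x \<in> C \<Longrightarrow> x \<in> carrier G"
  using mem_subgroup[OF sub] .

text \<open>A power of \<open>w\<close> commutes with \<open>w\<close>, which by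
  \<open>no_commute\<close> no noncentral element of \<open>C\<close> does.\<close>

lemma pow_in_center:
  assumes "w \<in> carrier G" "w \<notin> C" "w [^] (i::int) \<in> C"
  shows "w [^] i \<in> center G"
  using no_commute[OF assms(3) _ assms(1,2)] int_pow_commute_self[OF assms(1)] by blast

lemma adj: "\<lbrakk>y \<in> C; y \<notin> center G; w \<notin> C; subgroup H G; H \<noteq> carrier G; y \<in> H; w \<in> H\<rbrakk> \<Longrightarrow> adjacent G y w"
  using adjacentI no_commute mem_subgroup by metis

text \<open>If \<open>C\<close> and \<open>w\<close> generate a proper subgroup, every noncentral
  element of \<open>C\<close> is a neighbour. Otherwise \<open>v = c w^i\<close>, and
  \<open>c\<close> lies in every subgroup containing \<open>w\<close> and \<open>v\<close>; were
  \<open>c\<close> central, \<open>v\<close> would commute with \<open>w\<close>.\<close>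

lemma neighbour_in_C:
  assumes "adjacent G w v" "w \<notin> C"
  shows "\<exists>y\<in>C. adjacent G y w"
proof (cases "v \<in> C")
  case True
  then show ?thesis using assms adjacent_sym by blast
next
  case False
  have w: "w \<in> carrier G" and v: "v \<in> carrier G" using assms adjacent_carrier by auto
  show ?thesis
  proof (cases "cyclic_extension G C w = carrier G")
    case True
    then have "v \<in> cyclic_extension G C w" using v by simp
    then obtain c i where ci: "c \<in> C" "v = c \<otimes> w [^] (i::int)" by (rule cyclic_extensionE)
    obtain H where H: "subgroup H G" "H \<noteq> carrier G" "w \<in> H" "v \<in> H"
      using assms(1) by (rule adjacentE)
    have "c \<in> H"
      using subgroup_mult_cancel_right[OF H(1) Cc[OF ci(1)] subgroup_int_pow[OF H(1,3), of i]] H(4) ci(2) by simp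
    moreover have "c \<notin> center G"
    proof
      assume "c \<in> center G"
      then have "c \<in> centralizer G {w}" using center_subset_centralizer[of "{w}"] w by auto
      then have "v \<in> centralizer G {w}" unfolding ci(2)
        using subgroup.m_closed[OF subgroup_centralizer1[OF w]] int_pow_in_centralizer[OF w] by blast
      then show False using adjacent_not_commute[OF assms(1)] by (simp add: mem_centralizer1_iff)
    qed
    ultimately show ?thesis using adj[OF ci(1) _ assms(2) H(1,2) _ H(3)] ci(1) by blast
  next
    case False
    obtain y where y: "y \<in> C" "y \<notin> center G" using not_central by blast
    have "adjacent G y w"
      using adj[OF y assms(2) subgroup_cyclic_extension[OF C w] False
          cyclic_extension_incl[OF C w y(1)] cyclic_extension_self[OF C w]] .
    then show ?thesis using y by blast
  qed
qed

text \<open>The power of \<open>w\<close> lies in \<open>C\<close>, so it is central. Thus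
  \<open>y\<close> can be replaced by the noncentral \<open>h\<close> in the smaller subgroup
  \<open>D\<close>, at the cost of a central factor.\<close>

lemma cyclic_extension_decompose:
  assumes D: "D \<lhd> G" "D \<subseteq> C" and ext: "cyclic_extension G D w = carrier G"
    and w: "w \<in> carrier G" "w \<notin> C" and y: "y \<in> C" "y \<notin> center G"
  obtains h i where "h \<in> D" "y = h \<otimes> w [^] (i::int)" "w [^] i \<in> center G" "h \<notin> center G" "h \<in> carrier G"
proof -
  have "y \<in> cyclic_extension G D w" using ext Cc[OF y(1)] by simp
  then obtain h i where hi: "h \<in> D" "y = h \<otimes> w [^] (i::int)" by (rule cyclic_extensionE)
  have hC: "h \<in> C" using hi D by blast
  have wi: "w [^] i \<in> C" using subgroup_mult_cancel_left[OF sub _ hC, of "w [^] i"] hi y w by simp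
  have wz: "w [^] i \<in> center G" using pow_in_center[OF w wi] .
  have "h \<notin> center G" using y(2) hi(2) subgroup.m_closed[OF subgroup_center _ wz] by blast
  then show ?thesis using that hi wz Cc[OF hC] by blast
qed

text \<open>Two vertices outside of \<open>C\<close> with neighbours \<open>y\<close>, \<open>y'\<close> in \<open>C\<close>: the component of \<open>y\<close> in
  \<open>G = (H \<inter> C)\<langle>w\<rangle>\<close> is a common neighbour, where \<open>H = \<langle>y', w'\<rangle>\<close>.\<close>

lemma reach_outside:
  assumes w: "w \<notin> C" "adjacent G y w" "y \<in> C" and w': "w' \<notin> C" "adjacent G y' w'" "y' \<in> C"
    and nrm: "\<And>H. \<lbrakk>subgroup H G; w' \<in> H; y' \<in> H; cyclic_extension G C w' = carrier G\<rbrakk> \<Longrightarrow> H \<inter> C \<lhd> G"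
  shows "reach (adjacent G) 2 w w'"
proof (cases "adjacent G y' w \<or> adjacent G y w'")
  case True
  then show ?thesis
    using w w' reach_2[of "adjacent G" w y' w'] reach_2[of "adjacent G" w y w'] adjacent_sym by blast
next
  case False
  have c: "w \<in> carrier G" "w' \<in> carrier G" using adjacent_carrier w w' by auto
  have nz: "y \<notin> center G" "y' \<notin> center G" using adjacent_not_center w w' by auto
  have ext: "cyclic_extension G C w' = carrier G"
    using not_adjacent_cyclic_extension[OF _ no_commute[OF w(3) nz(1) c(2) w'(1)] C w(3) c(2)] False by blast
  obtain H where H: "subgroup H G" "H \<noteq> carrier G" "y' \<in> H" "w' \<in> H"
    using w'(2) by (rule adjacentE)
  have D: "H \<inter> C \<lhd> G" using nrm H ext by blast
  have ext2: "cyclic_extension G (H \<inter> C) w = carrier G"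
    using not_adjacent_cyclic_extension[OF _ no_commute[OF w'(3) nz(2) c(1) w(1)] D _ c(1)] False H w'(3) by blast
  obtain h i where h: "h \<in> H \<inter> C" "y = h \<otimes> w [^] (i::int)" "h \<notin> center G"
    using cyclic_extension_decompose[OF D _ ext2 c(1) w(1) w(3) nz(1)] by blast
  obtain H1 where H1: "subgroup H1 G" "H1 \<noteq> carrier G" "y \<in> H1" "w \<in> H1"
    using w(2) by (rule adjacentE)
  have "h \<in> H1"
    using subgroup_mult_cancel_right[OF H1(1) _ subgroup_int_pow[OF H1(1,4), of i]] H1(3) h mem_subgroup[OF H(1)] by blast
  then have "adjacent G h w" using adj h w(1) H1 by blast
  moreover have "adjacent G h w'" using adj h w'(1) H by blast
  ultimately show ?thesis using reach_2[of "adjacent G" w h w'] adjacent_sym by blast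
qed

end

locale abelian_frobenius_like = frobenius_like +
  assumes abelian: "\<And>x y. \<lbrakk>x \<in> C; y \<in> C\<rbrakk> \<Longrightarrow> x \<otimes> y = y \<otimes> x"
begin

text \<open>\<open>w\<close> normalizes \<open>H \<inter> C\<close>, the abelian group
  \<open>C\<close> centralizes it, and together they generate \<open>G\<close>.\<close>

lemma normal_Int:
  assumes H: "subgroup H G" and w: "w \<in> H" and ext: "cyclic_extension G C w = carrier G"
  shows "H \<inter> C \<lhd> G"
  unfolding normal_inv_iff
proof (intro conjI ballI)
  show "subgroup (H \<inter> C) G" using H sub by (rule subgroups_Inter_pair)
  fix g d assume g: "g \<in> carrier G" and d: "d \<in> H \<inter> C"
  have wc: "w \<in> carrier G" using mem_subgroup[OF H w] .
  have dc: "d \<in> carrier G" using d Cc by blast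
  have "g \<in> cyclic_extension G C w" using ext g by simp
  then obtain c i where ci: "c \<in> C" "g = c \<otimes> w [^] (i::int)" by (rule cyclic_extensionE)
  let ?d = "w [^] i \<otimes> d \<otimes> inv (w [^] i)"
  have dC: "?d \<in> C" using normal_conj[OF C] d wc by simp
  have dH: "?d \<in> H"
    using d subgroup_int_pow[OF H w, of i] subgroup.m_closed[OF H] subgroup.m_inv_closed[OF H] by simp
  have "g \<otimes> d \<otimes> inv g = c \<otimes> ?d \<otimes> inv c"
    unfolding ci(2) using conj_conj[OF Cc[OF ci(1)] _ dc, of "w [^] i"] wc by simp
  also have "\<dots> = ?d" using conj_eq_self_iff[OF Cc[OF ci(1)] Cc[OF dC]] abelian[OF ci(1) dC] by blast
  finally show "g \<otimes> d \<otimes> inv g \<in> H \<inter> C" using dC dH by simp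
qed

text \<open>The common neighbour is \<open>w^j h1\<close>, which shares \<open>H\<close> with
  \<open>y\<close> and \<open>H2\<close> with \<open>w\<close>. It lies outside of \<open>C\<close>,
  so it does not commute with \<open>y\<close>; its factor \<open>h1\<close> is noncentral in
  \<open>C\<close>, so it does not commute with \<open>w\<close>.\<close>

lemma reach_mixed:
  assumes y: "y \<in> C" and w: "w \<notin> C" and yw1: "adjacent G y w1" and wv: "adjacent G w v"
  shows "reach (adjacent G) 2 y w"
proof (cases "adjacent G y w")
  case True
  then show ?thesis using reach_1[of "adjacent G" y w 1] by (simp add: numeral_2_eq_2)
next
  case False
  have c: "w \<in> carrier G" "w1 \<in> carrier G" "y \<in> carrier G" using adjacent_carrier wv yw1 by auto
  have nz: "y \<notin> center G" using adjacent_not_center yw1 by auto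
  have w1: "w1 \<notin> C" using abelian[OF y] adjacent_not_commute[OF yw1] by blast
  obtain y1 where y1: "y1 \<in> C" "adjacent G y1 w" using neighbour_in_C[OF wv w] by blast
  have y1z: "y1 \<notin> center G" using adjacent_not_center y1 by auto
  \<comment> \<open>If \<open>C\<close> and \<open>w1\<close> generate a proper subgroup, that
    subgroup is used, and its intersection with \<open>C\<close> is \<open>C\<close>. Otherwise
    \<open>normal_Int\<close> applies to any subgroup behind the edge.\<close>
  have "\<exists>H. subgroup H G \<and> H \<noteq> carrier G \<and> y \<in> H \<and> w1 \<in> H \<and> H \<inter> C \<lhd> G"
  proof (cases "cyclic_extension G C w1 = carrier G")
    case True
    obtain H where "subgroup H G" "H \<noteq> carrier G" "y \<in> H" "w1 \<in> H" using yw1 by (rule adjacentE)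
    then show ?thesis using normal_Int[of H w1] True by blast
  next
    case ne: False
    have "cyclic_extension G C w1 \<inter> C = C" using cyclic_extension_incl[OF C c(2)] by blast
    then show ?thesis
      using subgroup_cyclic_extension[OF C c(2)] ne cyclic_extension_incl[OF C c(2) y] cyclic_extension_self[OF C c(2)] C
      by (intro exI[of _ "cyclic_extension G C w1"]) simp
  qed
  then obtain H where H: "subgroup H G" "H \<noteq> carrier G" "y \<in> H" "w1 \<in> H" "H \<inter> C \<lhd> G" by blast
  have ext: "cyclic_extension G (H \<inter> C) w = carrier G"
    using not_adjacent_cyclic_extension[OF False no_commute[OF y nz c(1) w] H(5) _ c(1)] H y by blast
  then have "w1 \<in> cyclic_extension G (H \<inter> C) w" using c by simp
  then obtain h j where hj: "h \<in> H \<inter> C" "w1 = h \<otimes> w [^] (j::int)" by (rule cyclic_extensionE)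
  have wjc: "w [^] j \<in> carrier G" using c by simp
  have wjH: "w [^] j \<in> H" using subgroup_mult_cancel_left[OF H(1) wjc, of h] hj H(4) by simp
  have wjC: "w [^] j \<notin> C" using subgroup_mult_cancel_left[OF sub wjc, of h] hj w1 by simp
  obtain h1 i where h1: "h1 \<in> H \<inter> C" "y1 = h1 \<otimes> w [^] (i::int)" "h1 \<notin> center G" "h1 \<in> carrier G"
    using cyclic_extension_decompose[OF H(5) _ ext c(1) w y1(1) y1z] by blast
  let ?u = "w [^] j \<otimes> h1"
  have uH: "?u \<in> H" using subgroup.m_closed[OF H(1) wjH] h1 by blast
  have uC: "?u \<notin> C" using subgroup_mult_cancel_right[OF sub wjc, of h1] h1 wjC by simp
  have yu: "adjacent G y ?u" using adj[OF y nz uC H(1,2,3) uH] .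
  obtain H2 where H2: "subgroup H2 G" "H2 \<noteq> carrier G" "y1 \<in> H2" "w \<in> H2"
    using y1(2) by (rule adjacentE)
  have "h1 \<in> H2"
    using subgroup_mult_cancel_right[OF H2(1) h1(4) subgroup_int_pow[OF H2(1,4), of i]] H2(3) h1 by blast
  then have uH2: "?u \<in> H2" using subgroup.m_closed[OF H2(1) subgroup_int_pow[OF H2(1,4), of j]] by blast
  have "?u \<notin> centralizer G {w}"
  proof
    assume "?u \<in> centralizer G {w}"
    then have "h1 \<in> centralizer G {w}"
      using subgroup_mult_cancel_left[OF subgroup_centralizer1[OF c(1)] h1(4) int_pow_in_centralizer[OF c(1)]] by blast
    then show False using no_commute[of h1 w] h1 w c by (simp add: mem_centralizer1_iff)
  qed
  then have "?u \<otimes> w \<noteq> w \<otimes> ?u" using h1 c by (simp add: mem_centralizer1_iff)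
  then have "adjacent G ?u w" using adjacentI[OF H2(1,2) uH2 H2(4)] by blast
  then show ?thesis using yu reach_2 by metis
qed

text \<open>The non-edges give first \<open>y' = h z\<close> with \<open>h \<in> H\<close> and
  \<open>z = w'^i\<close> central, then that \<open>H\<close> and \<open>z\<close> generate
  \<open>G\<close>. So \<open>w' z^k\<close> lies in \<open>H\<close>, together with
  \<open>y\<close>, for some \<open>k\<close>; being a power of \<open>w'\<close>, it also shares a
  proper subgroup with \<open>y'\<close>.\<close>

lemma reach_inside:
  assumes y: "y \<in> C" "adjacent G y w" and y': "y' \<in> C" "adjacent G y' w'"
  shows "reach (adjacent G) 2 y y'"
proof (cases "adjacent G y' w \<or> adjacent G y w'")
  case True
  then show ?thesis
    using y y' reach_2[of "adjacent G" y w y'] reach_2[of "adjacent G" y w' y'] adjacent_sym by blast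
next
  case False
  have c: "w \<in> carrier G" "w' \<in> carrier G" "y \<in> carrier G" "y' \<in> carrier G" using adjacent_carrier y y' by auto
  have nz: "y \<notin> center G" "y' \<notin> center G" using adjacent_not_center y y' by auto
  have wC: "w \<notin> C" "w' \<notin> C" using abelian y y' adjacent_not_commute by metis+
  have ext: "cyclic_extension G C w = carrier G"
    using not_adjacent_cyclic_extension[OF _ no_commute[OF y'(1) nz(2) c(1) wC(1)] C y'(1) c(1)] False by blast
  obtain H where H: "subgroup H G" "H \<noteq> carrier G" "y \<in> H" "w \<in> H" using y(2) by (rule adjacentE)
  have D: "H \<inter> C \<lhd> G" using normal_Int[OF H(1,4) ext] .
  have ext2: "cyclic_extension G (H \<inter> C) w' = carrier G"
    using not_adjacent_cyclic_extension[OF _ no_commute[OF y(1) nz(1) c(2) wC(2)] D _ c(2)] False H y by blast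
  obtain h i where h: "h \<in> H \<inter> C" "y' = h \<otimes> w' [^] (i::int)" "w' [^] i \<in> center G" "h \<in> carrier G"
    using cyclic_extension_decompose[OF D _ ext2 c(2) wC(2) y'(1) nz(2)] by blast
  let ?z = "w' [^] i"
  let ?K = "{g \<in> carrier G. \<exists>k::int. g \<otimes> ?z [^] k \<in> H}"
  have zc: "?z \<in> carrier G" using c by simp
  have K: "subgroup ?K G" using subgroup_mult_central_powers[OF H(1) h(3)] .
  have yz: "y' \<otimes> ?z [^] (-1::int) = h" using h zc by (simp add: int_pow_neg m_assoc)
  have "y' \<otimes> ?z [^] (-1::int) \<in> H" unfolding yz using h(1) by blast
  then have "y' \<in> ?K" using c(4) by blast
  moreover have "w \<in> ?K" using H(4) c by (auto intro!: exI[of _ 0])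
  ultimately have "?K = carrier G"
    using not_adjacentD[OF _ no_commute[OF y'(1) nz(2) c(1) wC(1)] K] False by blast
  then obtain k :: int where k: "w' \<otimes> ?z [^] k \<in> H" using c by blast
  have zC: "?z \<in> C"
    using subgroup_mult_cancel_left[OF sub zc, of h] h y'(1) by simp
  let ?v = "w' \<otimes> ?z [^] k"
  have vC: "?v \<notin> C" using subgroup_mult_cancel_right[OF sub c(2) subgroup_int_pow[OF sub zC]] wC by blast
  have "adjacent G y ?v" using adj[OF y(1) nz(1) vC H(1,2,3) k] .
  moreover have "adjacent G y' ?v"
  proof -
    obtain H3 where H3: "subgroup H3 G" "H3 \<noteq> carrier G" "y' \<in> H3" "w' \<in> H3" using y'(2) by (rule adjacentE)
    have "?v \<in> H3" using subgroup.m_closed[OF H3(1,4)] subgroup_int_pow[OF H3(1)] H3(4) by blast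
    then show ?thesis using adj[OF y'(1) nz(2) vC H3(1,2,3)] by blast
  qed
  ultimately show ?thesis using reach_2 adjacent_sym by metis
qed

lemma reach_2_not_isolated:
  assumes "adjacent G x x'" "adjacent G y y'"
  shows "reach (adjacent G) 2 x y"
proof -
  consider "x \<in> C" "y \<in> C" | "x \<in> C" "y \<notin> C" | "x \<notin> C" "y \<in> C" | "x \<notin> C" "y \<notin> C" by blast
  then show ?thesis
  proof cases
    case 1
    then show ?thesis using reach_inside assms by blast
  next
    case 2
    then show ?thesis using reach_mixed assms by blast
  next
    case 3
    then show ?thesis using reach_mixed assms reach_adjacent_sym by blast
  next
    case 4
    obtain a where a: "a \<in> C" "adjacent G a x" using neighbour_in_C[OF assms(1) 4(1)] by blast
    obtain b where b: "b \<in> C" "adjacent G b y" using neighbour_in_C[OF assms(2) 4(2)] by blast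
    show ?thesis using reach_outside[OF 4(1) a(2,1) 4(2) b(2,1)] normal_Int by blast
  qed
qed

end

section \<open>Frobenius-like kernels that are abelian only modulo the centre\<close>

definition all_cyclic_mod :: "('a, 'b) monoid_scheme \<Rightarrow> bool" where
  "all_cyclic_mod G \<longleftrightarrow> (\<forall>K. K \<lhd> G \<and> center G \<subset> K \<longrightarrow> cyclic_mod G K)"

text \<open>The shape of the preimage in \<open>G\<close> of the centralizer of an abelian normal
  subgroup of \<open>G/Z\<close>: commutators of \<open>C\<close> are central, but no noncentral
  element of \<open>C\<close> is central in \<open>C\<close>.\<close>

locale class_two_frobenius_like = frobenius_like +
  assumes all_cyclic: "all_cyclic_mod G" and Z_less: "center G \<subseteq> C"
    and class_two: "\<And>a b. \<lbrakk>a \<in> C; b \<in> C\<rbrakk> \<Longrightarrow> \<exists>z\<in>center G. a \<otimes> b = z \<otimes> (b \<otimes> a)"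
    and not_centralized: "\<And>a. \<lbrakk>a \<in> C; a \<notin> center G\<rbrakk> \<Longrightarrow> \<not> C \<subseteq> centralizer G {a}"
begin

text \<open>The claim is \<open>G = L\<close> for \<open>L = H Z\<close>. Conjugation by
  \<open>C\<close> changes elements of \<open>L \<inter> C\<close> only by central factors, which
  lie in \<open>L\<close>, and \<open>y\<close> lies in \<open>L\<close>; so
  \<open>L \<inter> C\<close> is normal. Because of \<open>a\<close> it exceeds the centre, hence
  \<open>L \<inter> C\<close> and some \<open>u\<close> generate \<open>G\<close>. As powers of
  \<open>u\<close> in \<open>C\<close> are central, \<open>C \<subseteq> L\<close>.\<close>

lemma covers_modulo_center:
  assumes H: "subgroup H G" "a \<in> H" "a \<in> C" "a \<notin> center G" "y \<in> H"
    and ext: "cyclic_extension G C y = carrier G" and g: "g \<in> carrier G"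
  shows "\<exists>z\<in>center G. g \<otimes> z \<in> H"
proof -
  let ?L = "{g \<in> carrier G. \<exists>z\<in>center G. g \<otimes> z \<in> H}"
  have L: "subgroup ?L G" using subgroup_mult_center[OF H(1)] .
  have HL: "H \<subseteq> ?L" using mem_subgroup[OF H(1)] subgroup.one_closed[OF subgroup_center] by force
  have ZL: "center G \<subseteq> ?L"
  proof
    fix z assume z: "z \<in> center G"
    then have "z \<in> carrier G" using center_subset by blast
    moreover have "z \<otimes> inv z \<in> H" using \<open>z \<in> carrier G\<close> subgroup.one_closed[OF H(1)] by simp
    ultimately show "z \<in> ?L" using subgroup.m_inv_closed[OF subgroup_center z] by blast
  qed
  have yc: "y \<in> carrier G" using mem_subgroup[OF H(1,5)] .
  have yL: "y \<in> ?L" using HL H(5) by blast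
  have nrm: "?L \<inter> C \<lhd> G"
    unfolding normal_inv_iff
  proof (intro conjI ballI)
    show "subgroup (?L \<inter> C) G" using L sub by (rule subgroups_Inter_pair)
    fix g d assume g: "g \<in> carrier G" and d: "d \<in> ?L \<inter> C"
    have dc: "d \<in> carrier G" using d Cc by blast
    have "g \<in> cyclic_extension G C y" using ext g by simp
    then obtain c i where ci: "c \<in> C" "g = c \<otimes> y [^] (i::int)" by (rule cyclic_extensionE)
    let ?d = "y [^] i \<otimes> d \<otimes> inv (y [^] i)"
    have dC: "?d \<in> C" using normal_conj[OF C] d yc by simp
    have yiL: "y [^] i \<in> ?L" by (rule subgroup_int_pow[OF L yL])
    have dL: "?d \<in> ?L"
      by (rule subgroup.m_closed[OF L subgroup.m_closed[OF L yiL] subgroup.m_inv_closed[OF L yiL]]) (use d in blast)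
    have "g \<otimes> d \<otimes> inv g = c \<otimes> ?d \<otimes> inv c"
      unfolding ci(2) using conj_conj[OF Cc[OF ci(1)] _ dc, of "y [^] i"] yc by simp
    moreover obtain z where z: "z \<in> center G" "c \<otimes> ?d = z \<otimes> (?d \<otimes> c)"
      using class_two[OF ci(1) dC] by blast
    moreover have "z \<otimes> (?d \<otimes> c) \<otimes> inv c = z \<otimes> ?d"
      using z(1) center_subset Cc[OF ci(1)] Cc[OF dC] by (simp add: m_assoc subset_iff del: inv_mult_group)
    ultimately have eq: "g \<otimes> d \<otimes> inv g = z \<otimes> ?d" by simp
    have "z \<in> ?L" using ZL z(1) by blast
    then have "z \<otimes> ?d \<in> ?L" using dL by (rule subgroup.m_closed[OF L])
    moreover have "z \<otimes> ?d \<in> C" using Z_less z(1) dC subgroup.m_closed[OF sub] by blast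
    ultimately show "g \<otimes> d \<otimes> inv g \<in> ?L \<inter> C" unfolding eq by blast
  qed
  have "a \<in> ?L \<inter> C" using HL H by blast
  then have "center G \<subset> ?L \<inter> C" using ZL Z_less H(4) by blast
  then have "cyclic_mod G (?L \<inter> C)" using all_cyclic nrm unfolding all_cyclic_mod_def by blast
  then obtain u where u: "u \<in> carrier G" "cyclic_extension G (?L \<inter> C) u = carrier G"
    unfolding cyclic_mod_def by blast
  have "u \<notin> C"
    using cyclic_extension_minimal[OF sub, of "?L \<inter> C" u] u(2) proper mem_subgroup[OF sub] by blast
  have "C \<subseteq> ?L"
  proof
    fix x assume x: "x \<in> C"
    show "x \<in> ?L"
    proof (cases "x \<in> center G")
      case False
      obtain h i where h: "h \<in> ?L \<inter> C" "x = h \<otimes> u [^] (i::int)" "u [^] i \<in> center G"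
        by (rule cyclic_extension_decompose[OF nrm Int_lower2 u(2,1) \<open>u \<notin> C\<close> x False])
      have "h \<in> ?L" "u [^] i \<in> ?L" using h(1,3) ZL by blast+
      then show ?thesis unfolding h(2) by (rule subgroup.m_closed[OF L])
    qed (use ZL in blast)
  qed
  then have "carrier G \<subseteq> ?L"
    using cyclic_extension_minimal[OF L _ yL] ext by blast
  then show ?thesis using g by blast
qed

text \<open>By \<open>covers_modulo_center\<close>, conjugation by any element of \<open>G\<close>
  is conjugation by an element of \<open>H\<close>.\<close>

lemma normal_Int_class_two:
  assumes H: "subgroup H G" "a \<in> H" "a \<in> C" "a \<notin> center G" "y \<in> H"
    and ext: "cyclic_extension G C y = carrier G"
  shows "H \<inter> C \<lhd> G"
  unfolding normal_inv_iff
proof (intro conjI ballI)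
  show "subgroup (H \<inter> C) G" using H(1) sub by (rule subgroups_Inter_pair)
  fix g d assume g: "g \<in> carrier G" and d: "d \<in> H \<inter> C"
  have dc: "d \<in> carrier G" using d Cc by blast
  obtain z where z: "z \<in> center G" "g \<otimes> z \<in> H" using covers_modulo_center[OF H ext g] by blast
  have zc: "z \<in> carrier G" using z center_subset by blast
  have "z \<otimes> d \<otimes> inv z = d" using conj_eq_self_iff[OF zc dc] center_commute[OF z(1) dc] by blast
  then have "g \<otimes> d \<otimes> inv g = (g \<otimes> z) \<otimes> d \<otimes> inv (g \<otimes> z)"
    using conj_conj[OF g zc dc] by simp
  also have "\<dots> \<in> H" using z(2) d subgroup.m_closed[OF H(1)] subgroup.m_inv_closed[OF H(1)] by simp
  finally show "g \<otimes> d \<otimes> inv g \<in> H \<inter> C" using normal_conj[OF C g] d by blast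
qed

text \<open>\<open>H \<inter> C\<close> cannot centralize \<open>a\<close>, for otherwise
  \<open>C = (H \<inter> C) Z\<close> would. An element \<open>h\<close> of
  \<open>H \<inter> C\<close> not commuting with \<open>a\<close> is adjacent to \<open>a\<close>
  within \<open>C\<close> and to \<open>y\<close> within \<open>H\<close>.\<close>

lemma reach_mixed_class_two:
  assumes a: "a \<in> C" and y: "y \<notin> C" and ab: "adjacent G a b" and yv: "adjacent G y v"
  shows "reach (adjacent G) 2 a y"
proof (cases "adjacent G a y")
  case True
  then show ?thesis using reach_1[of "adjacent G" a y 1] by (simp add: numeral_2_eq_2)
next
  case False
  have c: "a \<in> carrier G" "y \<in> carrier G" using adjacent_carrier ab yv by auto
  have nz: "a \<notin> center G" using adjacent_not_center ab by auto
  have ext: "cyclic_extension G C y = carrier G"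
    using not_adjacent_cyclic_extension[OF False no_commute[OF a nz c(2) y] C a c(2)] .
  obtain a1 where a1: "a1 \<in> C" "adjacent G a1 y" using neighbour_in_C[OF yv y] by blast
  have a1z: "a1 \<notin> center G" using adjacent_not_center a1 by auto
  obtain H where H: "subgroup H G" "H \<noteq> carrier G" "a1 \<in> H" "y \<in> H" using a1(2) by (rule adjacentE)
  have "\<exists>h\<in>H \<inter> C. h \<notin> centralizer G {a}"
  proof (rule ccontr)
    assume n: "\<not> ?thesis"
    have "C \<subseteq> centralizer G {a}"
    proof
      fix x assume x: "x \<in> C"
      obtain z where z: "z \<in> center G" "x \<otimes> z \<in> H"
        using covers_modulo_center[OF H(1,3) a1(1) a1z H(4) ext Cc[OF x]] by blast
      have "x \<otimes> z \<in> C" using subgroup.m_closed[OF sub x] z(1) Z_less by blast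
      then have "x \<otimes> z \<in> centralizer G {a}" using n z(2) by blast
      moreover have "z \<in> centralizer G {a}" using center_subset_centralizer[of "{a}"] c z(1) by blast
      ultimately show "x \<in> centralizer G {a}"
        using subgroup_mult_cancel_right[OF subgroup_centralizer1[OF c(1)] Cc[OF x]] by blast
    qed
    then show False using not_centralized[OF a nz] by blast
  qed
  then obtain h where h: "h \<in> H" "h \<in> C" "h \<notin> centralizer G {a}" by blast
  have ha: "h \<otimes> a \<noteq> a \<otimes> h" using h Cc by (simp add: mem_centralizer1_iff)
  have hz: "h \<notin> center G" using ha center_commute[OF _ c(1)] by blast
  have "adjacent G h y" using adj[OF h(2) hz y H(1,2) h(1) H(4)] .
  moreover have "adjacent G a h" using normal_proper_adjacent[OF C proper a h(2)] ha by metis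
  ultimately show ?thesis using reach_2 by metis
qed

lemma reach_2_not_isolated:
  assumes "adjacent G x x'" "adjacent G y y'"
  shows "reach (adjacent G) 2 x y"
proof -
  have nz: "x \<notin> center G" "y \<notin> center G" using adjacent_not_center assms by auto
  consider "x \<in> C" "y \<in> C" | "x \<in> C" "y \<notin> C" | "x \<notin> C" "y \<in> C" | "x \<notin> C" "y \<notin> C" by blast
  then show ?thesis
  proof cases
    case 1
    then show ?thesis
      using common_neighbour_in_normal[OF C proper 1(1) not_centralized[OF 1(1) nz(1)] 1(2) not_centralized[OF 1(2) nz(2)]]
        reach_2 by metis
  next
    case 2
    then show ?thesis using reach_mixed_class_two assms by blast
  next
    case 3
    then show ?thesis using reach_mixed_class_two assms reach_adjacent_sym by blast
  next
    case 4
    obtain a where a: "a \<in> C" "adjacent G a x" using neighbour_in_C[OF assms(1) 4(1)] by blast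
    obtain b where b: "b \<in> C" "adjacent G b y" using neighbour_in_C[OF assms(2) 4(2)] by blast
    have bz: "b \<notin> center G" using adjacent_not_center b by auto
    show ?thesis
      using reach_outside[OF 4(1) a(2,1) 4(2) b(2,1)] normal_Int_class_two b(1) bz by blast
  qed
qed

end

section \<open>Centralizers of normal subgroups when the proper quotients of \<open>G/Z\<close> are
  cyclic\<close>

context group
begin

text \<open>\<open>?D\<close> contains \<open>A\<close>, so \<open>G\<close> is cyclic modulo
  \<open>?D\<close>, and the elements of \<open>?C\<close> lying in \<open>?D\<close> are central in
  \<open>?C\<close>.\<close>

lemma abelian_centralizer:
  assumes cyc: "all_cyclic_mod G" and A: "A \<lhd> G" "center G \<subset> A" "\<And>x y. \<lbrakk>x \<in> A; y \<in> A\<rbrakk> \<Longrightarrow> x \<otimes> y = y \<otimes> x"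
    and x: "x \<in> centralizer G A" and y: "y \<in> centralizer G A"
  shows "x \<otimes> y = y \<otimes> x"
proof -
  let ?C = "centralizer G A" and ?D = "centralizer G (centralizer G A)"
  have C: "?C \<lhd> G" using normal_centralizer[OF A(1)] .
  have D: "?D \<lhd> G" using normal_centralizer[OF C] .
  have "A \<subseteq> ?D" using mem_normal[OF A(1)] by (auto simp: centralizer_def)
  then have "cyclic_mod G ?D" using cyc D A(2) unfolding all_cyclic_mod_def by blast
  then show ?thesis
    using abelian_if_cyclic_mod[OF normal_imp_subgroup[OF C] D _ _ x y] by (simp add: mem_centralizer_iff)
qed

text \<open>The point is \<open>no_commute\<close>. If \<open>w\<close> outside of \<open>?C\<close>
  commuted with a noncentral \<open>y\<close> in \<open>?C\<close>, the centralizer of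
  \<open>w\<close> in \<open>?C\<close> would be an abelian normal subgroup exceeding the centre, so
  its centralizer in \<open>G\<close> would be abelian too. That one contains \<open>?C\<close> and
  \<open>w\<close>, whence \<open>w\<close> would centralize \<open>A\<close>.\<close>

lemma centralizer_frobenius_like:
  assumes cyc: "all_cyclic_mod G" and A: "A \<lhd> G" "center G \<subset> A" "\<And>x y. \<lbrakk>x \<in> A; y \<in> A\<rbrakk> \<Longrightarrow> x \<otimes> y = y \<otimes> x"
  shows "abelian_frobenius_like G (centralizer G A)"
proof -
  let ?C = "centralizer G A"
  have Ac: "A \<subseteq> carrier G" using mem_normal[OF A(1)] by blast
  have C: "?C \<lhd> G" using normal_centralizer[OF A(1)] .
  have Csub: "subgroup ?C G" using C normal_imp_subgroup by blast
  have ab: "x \<otimes> y = y \<otimes> x" if "x \<in> ?C" "y \<in> ?C" for x y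
    using abelian_centralizer[OF cyc A that] by blast
  have AC: "A \<subseteq> ?C" using A(3) Ac by (auto simp: centralizer_def)
  have ZC: "center G \<subset> ?C" using AC A(2) by blast
  have "cyclic_mod G ?C" using cyc C ZC unfolding all_cyclic_mod_def by blast
  then obtain g where g: "g \<in> carrier G" "cyclic_extension G ?C g = carrier G"
    unfolding cyclic_mod_def by blast
  have CcC: "w \<in> ?C" if "w \<in> carrier G" "\<And>c. c \<in> ?C \<Longrightarrow> w \<otimes> c = c \<otimes> w" for w
    using that AC by (auto simp: centralizer_def)
  show ?thesis
  proof (intro abelian_frobenius_like.intro frobenius_like.intro frobenius_like_axioms.intro
      abelian_frobenius_like_axioms.intro)
    show "group G" by (rule is_group)
    show "?C \<lhd> G" by (rule C)
    show "\<not> ?C \<subseteq> center G" using ZC by blast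
    show "?C \<noteq> carrier G"
    proof
      assume eq: "?C = carrier G"
      have "x \<in> center G" if x: "x \<in> A" for x
      proof -
        have "x \<otimes> g = g \<otimes> x" if "g \<in> carrier G" for g
          using that x eq mem_centralizer_iff[of g A] by simp
        then show ?thesis using x Ac by (auto simp: center_def)
      qed
      then show False using A(2) by blast
    qed
    show "x \<otimes> y = y \<otimes> x" if "x \<in> ?C" "y \<in> ?C" for x y using ab that .
    fix y w assume y: "y \<in> ?C" "y \<notin> center G" and w: "w \<in> carrier G" "w \<notin> ?C"
    show "y \<otimes> w \<noteq> w \<otimes> y"
    proof
      assume yw: "y \<otimes> w = w \<otimes> y"
      let ?D = "?C \<inter> centralizer G {w}"
      have Dsub: "subgroup ?D G"
        using Csub subgroup_centralizer1[OF w(1)] by (rule subgroups_Inter_pair)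
      have "w \<in> cyclic_extension G ?C g" using w(1) g(2) by simp
      then obtain c j where cj: "c \<in> ?C" "w = c \<otimes> g [^] (j::int)" by (rule cyclic_extensionE)
      have cc: "c \<in> carrier G" using cj mem_subgroup[OF Csub] by blast
      \<comment> \<open>Since \<open>?C\<close> is abelian, only the factor \<open>g^j\<close> of
        \<open>w\<close> matters here. It commutes with \<open>g\<close>, which makes
        \<open>?D\<close> invariant under \<open>g\<close> and thus normal.\<close>
      have Dj: "a \<in> ?D \<longleftrightarrow> a \<in> ?C \<and> a \<in> centralizer G {g [^] j}" for a
      proof (cases "a \<in> ?C")
        case True
        have a: "a \<in> carrier G" using True mem_subgroup[OF Csub] by blast
        have "c \<in> centralizer G {a}" using ab[OF cj(1) True] cc by (simp add: mem_centralizer1_iff)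
        then have "w \<in> centralizer G {a} \<longleftrightarrow> g [^] j \<in> centralizer G {a}"
          unfolding cj(2) using subgroup_mult_cancel_left[OF subgroup_centralizer1[OF a], of "g [^] j" c] g(1) by simp
        then show ?thesis using True centralizer1_sym[OF a] w(1) g(1) by simp
      qed simp
      have D: "?D \<lhd> G"
        unfolding normal_inv_iff
      proof (intro conjI ballI)
        show "subgroup ?D G" by (rule Dsub)
        fix h a assume h: "h \<in> carrier G" and a: "a \<in> ?D"
        have ac: "a \<in> carrier G" using a mem_subgroup[OF Dsub] by blast
        have "h \<in> cyclic_extension G ?C g" using h g(2) by simp
        then obtain d i where di: "d \<in> ?C" "h = d \<otimes> g [^] (i::int)" by (rule cyclic_extensionE)
        have dc: "d \<in> carrier G" using di mem_subgroup[OF Csub] by blast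
        let ?a = "g [^] i \<otimes> a \<otimes> inv (g [^] i)"
        have aC: "?a \<in> ?C" using normal_conj[OF C] a g(1) by simp
        have "g [^] i \<otimes> g [^] j \<otimes> inv (g [^] i) = g [^] j"
          using conj_eq_self_iff[of "g [^] i" "g [^] j"] int_pow_commute[OF g(1)] g(1) by simp
        then have "?a \<otimes> g [^] j = g [^] j \<otimes> ?a"
          using conj_commute_iff[of "g [^] i" a "g [^] j"] a Dj[of a] g(1) ac by (simp add: mem_centralizer1_iff)
        then have "?a \<in> ?D" using Dj[of ?a] aC g(1) ac by (simp add: mem_centralizer1_iff)
        moreover have "h \<otimes> a \<otimes> inv h = ?a"
        proof -
          have "h \<otimes> a \<otimes> inv h = d \<otimes> ?a \<otimes> inv d"
            unfolding di(2) using conj_conj[OF dc _ ac, of "g [^] i"] g(1) by simp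
          also have "\<dots> = ?a" using conj_eq_self_iff[OF dc, of ?a] ab[OF di(1) aC] g(1) ac by simp
          finally show ?thesis .
        qed
        ultimately show "h \<otimes> a \<otimes> inv h \<in> ?D" by simp
      qed
      have yD: "y \<in> ?D" using y yw mem_subgroup[OF Csub] by (simp add: mem_centralizer1_iff)
      have ZD: "center G \<subset> ?D"
        using ZC center_subset_centralizer[of "{w}"] w(1) yD y(2) by blast
      have abD: "a \<otimes> b = b \<otimes> a" if "a \<in> ?D" "b \<in> ?D" for a b using ab that by blast
      have "c \<in> centralizer G ?D" if "c \<in> ?C" for c
        unfolding mem_centralizer_iff using ab[OF that] mem_subgroup[OF Csub that] by blast
      moreover have "w \<in> centralizer G ?D"
        using w(1) by (auto simp: centralizer_def)
      ultimately have "w \<otimes> c = c \<otimes> w" if "c \<in> ?C" for c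
        using abelian_centralizer[OF cyc D ZD abD, of w c] that by blast
      then show False using CcC[OF w(1)] w(2) by blast
    qed
  qed
qed

text \<open>Otherwise \<open>G\<close> is cyclic modulo \<open>?D\<close>; as \<open>?D\<close>
  centralizes \<open>K\<close>, the group \<open>K\<close> would be abelian.\<close>

lemma centralizer_normal_eq_center:
  assumes cyc: "all_cyclic_mod G"
    and no_abelian: "\<And>A. \<lbrakk>A \<lhd> G; center G \<subset> A\<rbrakk> \<Longrightarrow> \<exists>x\<in>A. \<exists>y\<in>A. x \<otimes> y \<noteq> y \<otimes> x"
    and K: "K \<lhd> G" "center G \<subset> K"
  shows "centralizer G K = center G"
proof (rule ccontr)
  let ?D = "centralizer G K"
  assume "?D \<noteq> center G"
  moreover have "K \<subseteq> carrier G" using mem_normal[OF K(1)] by blast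
  ultimately have "center G \<subset> ?D" using center_subset_centralizer by blast
  moreover have D: "?D \<lhd> G" using normal_centralizer[OF K(1)] .
  ultimately have "cyclic_mod G ?D" using cyc unfolding all_cyclic_mod_def by blast
  then have "x \<otimes> y = y \<otimes> x" if "x \<in> K" "y \<in> K" for x y
    using abelian_if_cyclic_mod[OF normal_imp_subgroup[OF K(1)] D _ _ that] by (simp add: mem_centralizer_iff)
  then show False using no_abelian[OF K] by blast
qed

end

section \<open>Central centralizers of normal subgroups: distance at most \<open>3\<close>\<close>

locale centralizer_free = group +
  fixes N
  assumes N: "N \<lhd> G" "center G \<subset> N" "N \<noteq> carrier G"
    and cent: "\<And>K. \<lbrakk>K \<lhd> G; center G \<subset> K\<rbrakk> \<Longrightarrow> centralizer G K = center G"
begin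

lemma not_centralized: 
  assumes "n \<in> carrier G" "n \<notin> center G"
  shows "\<exists>m\<in>N. m \<otimes> n \<noteq> n \<otimes> m"
proof (rule ccontr)
  assume "\<not> ?thesis"
  then have "n \<in> centralizer G N" using assms by (auto simp: mem_centralizer_iff)
  then show False using cent[OF N(1,2)] assms by blast
qed

lemma neighbour_in_N:
  assumes yz: "adjacent G y z"
  shows "\<exists>n\<in>N. adjacent G y n"
proof -
  have c: "y \<in> carrier G" "z \<in> carrier G" using adjacent_carrier yz by auto
  have nz: "y \<notin> center G" using adjacent_not_center yz by auto
  obtain n where n: "n \<in> N" "n \<otimes> y \<noteq> y \<otimes> n" using not_centralized[OF c(1) nz] by blast
  show ?thesis
  proof (cases "cyclic_extension G N y = carrier G")
    case False
    then show ?thesis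
      using adjacentI[OF subgroup_cyclic_extension[OF N(1) c(1)] False cyclic_extension_self[OF N(1) c(1)]
          cyclic_extension_incl[OF N(1) c(1) n(1)]] n by metis
  next
    case True
    then have "z \<in> cyclic_extension G N y" using c by simp
    then obtain m i where mi: "m \<in> N" "z = m \<otimes> y [^] (i::int)" by (rule cyclic_extensionE)
    have mc: "m \<in> carrier G" using mem_normal[OF N(1) mi(1)] .
    obtain H where H: "subgroup H G" "H \<noteq> carrier G" "y \<in> H" "z \<in> H" using yz by (rule adjacentE)
    have mH: "m \<in> H"
      using subgroup_mult_cancel_right[OF H(1) mc subgroup_int_pow[OF H(1,3), of i]] H(4) mi(2) by simp
    have "m \<notin> centralizer G {y}"
    proof
      assume "m \<in> centralizer G {y}"
      then have "z \<in> centralizer G {y}" unfolding mi(2)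
        using subgroup.m_closed[OF subgroup_centralizer1[OF c(1)]] int_pow_in_centralizer[OF c(1)] by blast
      then show False using adjacent_not_commute[OF yz] by (simp add: mem_centralizer1_iff)
    qed
    then have "adjacent G y m" using adjacentI[OF H(1-3) mH] mc by (force simp: mem_centralizer1_iff)
    then show ?thesis using mi by blast
  qed
qed

text \<open>If \<open>n'\<close> commutes with all \<open>x\<close>-conjugates of \<open>n\<close>, then \<open>x\<close> and \<open>n'\<close> cannot generate \<open>G\<close>:
  otherwise the centralizer of these conjugates would be normal, but it is centralized by \<open>n\<close>.\<close>

lemma adjacent_if_commutes_with_conjugates:
  assumes x: "x \<in> carrier G" and n: "n \<in> carrier G" "n \<notin> center G" and n': "n' \<in> carrier G" "n' \<notin> center G"
    and com: "\<And>i::int. n' \<otimes> (x [^] i \<otimes> n \<otimes> inv (x [^] i)) = (x [^] i \<otimes> n \<otimes> inv (x [^] i)) \<otimes> n'"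
    and xn': "x \<otimes> n' \<noteq> n' \<otimes> x"
  shows "adjacent G x n'"
proof (rule ccontr)
  assume na: "\<not> adjacent G x n'"
  let ?S = "range (\<lambda>i::int. x [^] i \<otimes> n \<otimes> inv (x [^] i))"
  let ?D = "centralizer G ?S"
  have Sc: "?S \<subseteq> carrier G" using x n by auto
  have D: "subgroup ?D G" using subgroup_centralizer[OF Sc] .
  have n'D: "n' \<in> ?D" using n' com by (auto simp: mem_centralizer_iff)
  have shift: "x \<otimes> (x [^] i \<otimes> n \<otimes> inv (x [^] i)) \<otimes> inv x = x [^] (i + 1) \<otimes> n \<otimes> inv (x [^] (i + 1))" for i :: int
    using conj_int_pow_shift[OF x n(1)] .
  have shift': "inv x \<otimes> (x [^] i \<otimes> n \<otimes> inv (x [^] i)) \<otimes> x = x [^] (i - 1) \<otimes> n \<otimes> inv (x [^] (i - 1))" for i :: int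
    using conj_inv_cancel[OF x, of "x [^] (i - 1) \<otimes> n \<otimes> inv (x [^] (i - 1))"] shift[of "i - 1"] x n by simp
  have nrm: "?D \<lhd> G"
  proof (rule normal_if_normalized_by_generators[OF D _ x])
    fix K assume "subgroup K G" "x \<in> K" "?D \<subseteq> K"
    then show "K = carrier G" using not_adjacentD[OF na xn'] n'D by blast
  next
    fix d assume d: "d \<in> ?D"
    then have dc: "d \<in> carrier G" by (simp add: mem_centralizer_iff)
    have dS: "d \<otimes> (x [^] i \<otimes> n \<otimes> inv (x [^] i)) = (x [^] i \<otimes> n \<otimes> inv (x [^] i)) \<otimes> d" for i :: int
      using d by (simp add: mem_centralizer_iff)
    show "x \<otimes> d \<otimes> inv x \<in> ?D"
      unfolding mem_centralizer_iff
    proof (intro conjI ballI)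
      fix s assume "s \<in> ?S"
      then obtain i :: int where s: "s = x [^] i \<otimes> n \<otimes> inv (x [^] i)" by blast
      show "x \<otimes> d \<otimes> inv x \<otimes> s = s \<otimes> (x \<otimes> d \<otimes> inv x)"
        using conj_in_centralizer_iff[OF x dc, of s] x n dS[of "i - 1"] by (simp add: s shift')
    qed (use x dc in simp)
    show "inv x \<otimes> d \<otimes> x \<in> ?D"
      unfolding mem_centralizer_iff
    proof (intro conjI ballI)
      fix s assume "s \<in> ?S"
      then obtain i :: int where s: "s = x [^] i \<otimes> n \<otimes> inv (x [^] i)" by blast
      show "inv x \<otimes> d \<otimes> x \<otimes> s = s \<otimes> (inv x \<otimes> d \<otimes> x)"
        using conj_in_centralizer_iff[of "inv x" d s] x dc n dS[of "i + 1"] by (simp add: s shift)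
    qed (use x dc in simp)
  qed
  have "center G \<subset> ?D" using center_subset_centralizer[OF Sc] n'D n'(2) by blast
  then have "centralizer G ?D = center G" using cent[OF nrm] by blast
  moreover have "n \<in> centralizer G ?D"
  proof -
    have nS: "n \<in> ?S" using x n by (auto intro!: range_eqI[of _ _ "0::int"])
    have "n \<otimes> d = d \<otimes> n" if d: "d \<in> ?D" for d
      using d bspec[OF conjunct2[OF iffD1[OF mem_centralizer_iff d]] nS] by simp
    then show ?thesis using n(1) mem_centralizer_iff by blast
  qed
  ultimately show False using n(2) by blast
qed

lemma adjacent_conj:
  assumes xn: "adjacent G x n" and g: "g \<in> carrier G" "g \<otimes> x = x \<otimes> g" and H: "subgroup H G" "H \<noteq> carrier G" "x \<in> H" "n \<in> H" "g \<in> H"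
  shows "adjacent G x (g \<otimes> n \<otimes> inv g)"
proof -
  have c: "x \<in> carrier G" "n \<in> carrier G" using adjacent_carrier xn by auto
  have "g \<otimes> x \<otimes> inv g = x" using conj_eq_self_iff[OF g(1) c(1)] g(2) by blast
  then have "x \<otimes> (g \<otimes> n \<otimes> inv g) \<noteq> (g \<otimes> n \<otimes> inv g) \<otimes> x"
    using conj_commute_iff[OF g(1) c] adjacent_not_commute[OF xn] by simp
  moreover have "g \<otimes> n \<otimes> inv g \<in> H" using H subgroup.m_closed[OF H(1)] subgroup.m_inv_closed[OF H(1)] by simp
  ultimately show ?thesis using adjacentI[OF H(1-3)] by blast
qed

text \<open>Suppose the distance exceeds \<open>3\<close>. Neighbours of \<open>x\<close> and of
  \<open>y\<close> in \<open>N\<close> then commute, as noncommuting elements of \<open>N\<close>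
  are adjacent. In particular \<open>n'\<close> commutes with all conjugates of \<open>n\<close> by
  powers of \<open>x\<close>, so \<open>x\<close> commutes with \<open>n'\<close>, or else
  \<open>n'\<close> would be a common neighbour; likewise \<open>y\<close> commutes with
  \<open>n\<close>. But now \<open>n \<otimes> n'\<close> is a common neighbour, sharing the
  centralizer of \<open>n'\<close> with \<open>x\<close> and that of \<open>n\<close> with
  \<open>y\<close>.\<close>

lemma reach_3_not_isolated:
  assumes "adjacent G x x'" "adjacent G y y'"
  shows "reach (adjacent G) 3 x y"
proof (rule ccontr)
  assume nr: "\<not> ?thesis"
  have no_pair: "m \<otimes> m' = m' \<otimes> m" if "m \<in> N" "m' \<in> N" "adjacent G x m" "adjacent G y m'" for m m'
    using normal_proper_adjacent[OF N(1,3) that(1,2)] reach_3[of "adjacent G" x m m' y] that nr adjacent_sym by blast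
  have no_common: "\<not> (adjacent G x m \<and> adjacent G y m)" for m
    using nr reach_2[of "adjacent G" x m y] reach_mono[of "adjacent G" 2 x y 3] adjacent_sym by auto
  obtain n where n: "n \<in> N" "adjacent G x n" using neighbour_in_N[OF assms(1)] by blast
  obtain n' where n': "n' \<in> N" "adjacent G y n'" using neighbour_in_N[OF assms(2)] by blast
  have c: "x \<in> carrier G" "y \<in> carrier G" "n \<in> carrier G" "n' \<in> carrier G" using adjacent_carrier n n' by auto
  have nz: "x \<notin> center G" "y \<notin> center G" "n \<notin> center G" "n' \<notin> center G" using adjacent_not_center n n' by auto
  obtain H where H: "subgroup H G" "H \<noteq> carrier G" "x \<in> H" "n \<in> H" using n(2) by (rule adjacentE)
  obtain H' where H': "subgroup H' G" "H' \<noteq> carrier G" "y \<in> H'" "n' \<in> H'" using n'(2) by (rule adjacentE)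
  have "x \<otimes> n' = n' \<otimes> x"
  proof (rule ccontr)
    assume ne: "x \<otimes> n' \<noteq> n' \<otimes> x"
    have "n' \<otimes> (x [^] i \<otimes> n \<otimes> inv (x [^] i)) = (x [^] i \<otimes> n \<otimes> inv (x [^] i)) \<otimes> n'" for i :: int
    proof -
      have "adjacent G x (x [^] i \<otimes> n \<otimes> inv (x [^] i))"
        using adjacent_conj[OF n(2) _ _ H subgroup_int_pow[OF H(1,3)]] int_pow_commute_self c by simp
      moreover have "x [^] i \<otimes> n \<otimes> inv (x [^] i) \<in> N" using normal_conj[OF N(1) _ n(1)] c by simp
      ultimately show ?thesis using no_pair n' by metis
    qed
    then have "adjacent G x n'" using adjacent_if_commutes_with_conjugates[OF c(1,3) nz(3) c(4) nz(4) _ ne] by blast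
    then show False using no_common n' by blast
  qed
  moreover have "y \<otimes> n = n \<otimes> y"
  proof (rule ccontr)
    assume ne: "y \<otimes> n \<noteq> n \<otimes> y"
    have "n \<otimes> (y [^] i \<otimes> n' \<otimes> inv (y [^] i)) = (y [^] i \<otimes> n' \<otimes> inv (y [^] i)) \<otimes> n" for i :: int
    proof -
      have "adjacent G y (y [^] i \<otimes> n' \<otimes> inv (y [^] i))"
        using adjacent_conj[OF n'(2) _ _ H' subgroup_int_pow[OF H'(1,3)]] int_pow_commute_self c by simp
      moreover have "y [^] i \<otimes> n' \<otimes> inv (y [^] i) \<in> N" using normal_conj[OF N(1) _ n'(1)] c by simp
      ultimately show ?thesis using no_pair n by metis
    qed
    then have "adjacent G y n" using adjacent_if_commutes_with_conjugates[OF c(2,4) nz(4) c(3) nz(3) _ ne] by blast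
    then show False using no_common n by blast
  qed
  ultimately have com: "x \<in> centralizer G {n'}" "y \<in> centralizer G {n}" "n \<in> centralizer G {n'}" "n' \<in> centralizer G {n}"
    "n \<in> centralizer G {n}" "n' \<in> centralizer G {n'}"
    using c no_pair[OF n(1) n'(1) n(2) n'(2)] by (auto simp: mem_centralizer1_iff)
  have "n \<otimes> n' \<in> centralizer G {n'}" "n \<otimes> n' \<in> centralizer G {n}"
    using com subgroup.m_closed[OF subgroup_centralizer1] c by auto
  moreover have "x \<otimes> (n \<otimes> n') \<noteq> (n \<otimes> n') \<otimes> x"
  proof
    assume "x \<otimes> (n \<otimes> n') = (n \<otimes> n') \<otimes> x"
    then have "n \<otimes> n' \<in> centralizer G {x}" using c by (simp add: mem_centralizer1_iff)
    then have "n \<in> centralizer G {x}"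
      using subgroup_mult_cancel_right[OF subgroup_centralizer1[OF c(1)] c(3)] com(1) centralizer1_sym c by blast
    then show False using adjacent_not_commute[OF n(2)] by (simp add: mem_centralizer1_iff)
  qed
  moreover have "y \<otimes> (n \<otimes> n') \<noteq> (n \<otimes> n') \<otimes> y"
  proof
    assume "y \<otimes> (n \<otimes> n') = (n \<otimes> n') \<otimes> y"
    then have "n \<otimes> n' \<in> centralizer G {y}" using c by (simp add: mem_centralizer1_iff)
    then have "n' \<in> centralizer G {y}"
      using subgroup_mult_cancel_left[OF subgroup_centralizer1[OF c(2)] c(4)] com(2) centralizer1_sym c by blast
    then show False using adjacent_not_commute[OF n'(2)] by (simp add: mem_centralizer1_iff)
  qed
  moreover have "centralizer G {n} \<noteq> carrier G" "centralizer G {n'} \<noteq> carrier G"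
    using centralizer_eq_carrier_iff c nz by auto
  ultimately have "adjacent G x (n \<otimes> n')" "adjacent G y (n \<otimes> n')"
    using adjacentI[OF subgroup_centralizer1[OF c(4)] _ com(1)] adjacentI[OF subgroup_centralizer1[OF c(3)] _ com(2)] by blast+
  then show False using no_common by blast
qed

end

section \<open>A noncyclic quotient\<close>

context group
begin

lemma conj_subgroup:
  assumes "subgroup H G" "g \<in> carrier G"
  shows "subgroup ((\<lambda>h. g \<otimes> h \<otimes> inv g) ` H) G"
proof (rule subgroupI)
  have Hc: "h \<in> carrier G" if "h \<in> H" for h using mem_subgroup[OF assms(1) that] .
  show "(\<lambda>h. g \<otimes> h \<otimes> inv g) ` H \<subseteq> carrier G" using Hc assms(2) by auto
  show "(\<lambda>h. g \<otimes> h \<otimes> inv g) ` H \<noteq> {}" using subgroup.one_closed[OF assms(1)] by auto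
  fix a assume "a \<in> (\<lambda>h. g \<otimes> h \<otimes> inv g) ` H"
  then obtain h where h: "h \<in> H" "a = g \<otimes> h \<otimes> inv g" by auto
  have "inv a = g \<otimes> inv h \<otimes> inv g" using h Hc assms(2) by (simp add: inv_mult_group m_assoc)
  then show "inv a \<in> (\<lambda>h. g \<otimes> h \<otimes> inv g) ` H" using subgroup.m_inv_closed[OF assms(1) h(1)] by blast
  fix b assume "b \<in> (\<lambda>h. g \<otimes> h \<otimes> inv g) ` H"
  then obtain k where k: "k \<in> H" "b = g \<otimes> k \<otimes> inv g" by auto
  have "a \<otimes> b = g \<otimes> (h \<otimes> k) \<otimes> inv g" using conj_mult[OF assms(2) Hc[OF h(1)] Hc[OF k(1)]] h k by simp
  then show "a \<otimes> b \<in> (\<lambda>h. g \<otimes> h \<otimes> inv g) ` H" using subgroup.m_closed[OF assms(1) h(1) k(1)] by blast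
qed

lemma conj_subgroup_eq_carrier:
  assumes "subgroup H G" "g \<in> carrier G" "(\<lambda>h. g \<otimes> h \<otimes> inv g) ` H = carrier G"
  shows "H = carrier G"
proof -
  have "x \<in> H" if x: "x \<in> carrier G" for x
  proof -
    have "g \<otimes> x \<otimes> inv g \<in> (\<lambda>h. g \<otimes> h \<otimes> inv g) ` H" using x assms by simp
    then obtain h where h: "h \<in> H" "g \<otimes> x \<otimes> inv g = g \<otimes> h \<otimes> inv g" by auto
    then have "x = h" using conj_inv_cancel[OF assms(2)] x mem_subgroup[OF assms(1) h(1)] by metis
    then show ?thesis using h by simp
  qed
  then show ?thesis using mem_subgroup[OF assms(1)] by blast
qed

lemma adjacent_conjugate:
  assumes "adjacent G x y" "g \<in> carrier G"
  shows "adjacent G (g \<otimes> x \<otimes> inv g) (g \<otimes> y \<otimes> inv g)"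
proof -
  obtain H where H: "subgroup H G" "H \<noteq> carrier G" "x \<in> H" "y \<in> H" using assms(1) by (rule adjacentE)
  have c: "x \<in> carrier G" "y \<in> carrier G" using adjacent_carrier[OF assms(1)] by auto
  show ?thesis
  proof (rule adjacentI[OF conj_subgroup[OF H(1) assms(2)]])
    show "(\<lambda>h. g \<otimes> h \<otimes> inv g) ` H \<noteq> carrier G" using conj_subgroup_eq_carrier[OF H(1) assms(2)] H(2) by blast
    show "(g \<otimes> x \<otimes> inv g) \<otimes> (g \<otimes> y \<otimes> inv g) \<noteq> (g \<otimes> y \<otimes> inv g) \<otimes> (g \<otimes> x \<otimes> inv g)"
      using conj_commute_iff[OF assms(2) c] adjacent_not_commute[OF assms(1)] by simp
  qed (use H in auto)
qed

lemma normal_centralizer_conjugates: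
  assumes t: "t \<in> carrier G"
  shows "centralizer G {g \<otimes> t \<otimes> inv g |g. g \<in> carrier G} \<lhd> G" (is "centralizer G ?S \<lhd> G")
  unfolding normal_inv_iff
proof (intro conjI ballI)
  have S: "?S \<subseteq> carrier G" using t by auto
  show "subgroup (centralizer G ?S) G" using S by (rule subgroup_centralizer)
  fix x d assume x: "x \<in> carrier G" and d: "d \<in> centralizer G ?S"
  have dc: "d \<in> carrier G" using d by (simp add: mem_centralizer_iff)
  show "x \<otimes> d \<otimes> inv x \<in> centralizer G ?S"
    unfolding mem_centralizer_iff
  proof (intro conjI ballI)
    fix s assume "s \<in> ?S"
    then obtain g where g: "g \<in> carrier G" "s = g \<otimes> t \<otimes> inv g" by auto
    have "inv x \<otimes> s \<otimes> x = (inv x \<otimes> g) \<otimes> t \<otimes> inv (inv x \<otimes> g)"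
      using conj_conj[of "inv x" g t] x g t by simp
    then have "inv x \<otimes> s \<otimes> x \<in> ?S" using x g(1) by blast
    then have "d \<otimes> (inv x \<otimes> s \<otimes> x) = (inv x \<otimes> s \<otimes> x) \<otimes> d"
      using bspec[OF conjunct2[OF iffD1[OF mem_centralizer_iff d]]] by blast
    then show "x \<otimes> d \<otimes> inv x \<otimes> s = s \<otimes> (x \<otimes> d \<otimes> inv x)"
      using conj_in_centralizer_iff[OF x dc, of s] g t by simp
  qed (use x dc in simp)
qed

text \<open>Otherwise \<open>y\<close> and \<open>b\<close> both lie in the centralizer of
  \<open>b^m\<close>, which is proper for noncentral \<open>b^m\<close>, and would be
  adjacent.\<close>

lemma pow_not_in_centralizer:
  assumes "\<not> adjacent G y b" "y \<otimes> b \<noteq> b \<otimes> y" "y \<in> carrier G" "b \<in> carrier G" "b [^] (m::int) \<notin> center G"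
  shows "b [^] m \<notin> centralizer G {y}"
proof
  assume *: "b [^] m \<in> centralizer G {y}"
  have bm: "b [^] m \<in> carrier G" using assms by simp
  have "y \<in> centralizer G {b [^] m}" using * centralizer1_sym[OF bm assms(3)] by simp
  moreover have "b \<in> centralizer G {b [^] m}"
    using int_pow_in_centralizer[OF assms(4), of m] centralizer1_sym[OF bm assms(4)] by simp
  ultimately have "centralizer G {b [^] m} = carrier G"
    using not_adjacentD[OF assms(1,2) subgroup_centralizer1[OF bm]] by blast
  then show False using centralizer_eq_carrier_iff[OF bm] assms(5) by blast
qed

end

section \<open>Adjacency when \<open>G/N\<close> is not cyclic\<close>

locale noncyclic_quotient = group +
  fixes N
  assumes N: "N \<lhd> G" "center G \<subset> N" and noncyclic: "\<not> cyclic_mod G N"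
begin

definition "C = centralizer G N"

lemma Nc: "n \<in> N \<Longrightarrow> n \<in> carrier G"
  using mem_normal[OF N(1)] .

lemma N_ext: "w \<in> carrier G \<Longrightarrow> cyclic_extension G N w \<noteq> carrier G"
  using noncyclic unfolding cyclic_mod_def by blast

lemma C_normal: "C \<lhd> G"
  unfolding C_def by (rule normal_centralizer[OF N(1)])

lemma C_sub: "subgroup C G"
  using C_normal normal_imp_subgroup by blast

lemma Cc: "c \<in> C \<Longrightarrow> c \<in> carrier G"
  using mem_subgroup[OF C_sub] .

lemma Z_C: "center G \<subseteq> C"
  unfolding C_def using Nc by (intro center_subset_centralizer) blast

lemma CN: "c \<in> C \<Longrightarrow> n \<in> N \<Longrightarrow> c \<otimes> n = n \<otimes> c"
  by (simp add: C_def mem_centralizer_iff)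

lemma C_proper: "C \<noteq> carrier G"
proof
  assume "C = carrier G"
  then have "n \<otimes> g = g \<otimes> n" if "n \<in> N" "g \<in> carrier G" for n g
    using CN[of g n] that by simp
  then have "N \<subseteq> center G" using Nc by (auto simp: center_def)
  then show False using N(2) by blast
qed

text \<open>The use of noncyclicity: \<open>N\<close> and any single \<open>w\<close> generate a
  proper subgroup, so adjacency to elements of \<open>N\<close> is just noncommutation.\<close>

lemma adjacent_N: "\<lbrakk>n \<in> N; w \<in> carrier G; n \<otimes> w \<noteq> w \<otimes> n\<rbrakk> \<Longrightarrow> adjacent G n w"
  using adjacentI[OF subgroup_cyclic_extension[OF N(1)] N_ext cyclic_extension_incl[OF N(1)] cyclic_extension_self[OF N(1)]] .

lemma outside_C:
  assumes "w \<in> carrier G" "w \<notin> C"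
  obtains n where "n \<in> N" "n \<notin> centralizer G {w}" "n \<otimes> w \<noteq> w \<otimes> n"
proof -
  obtain n where n: "n \<in> N" "w \<otimes> n \<noteq> n \<otimes> w" using assms by (auto simp: C_def mem_centralizer_iff)
  then have "n \<otimes> w \<noteq> w \<otimes> n" by metis
  then show ?thesis using that[of n] n by (simp add: mem_centralizer1_iff)
qed

lemma reach_outside_C:
  assumes w: "w \<in> carrier G" "w \<notin> C" and w': "w' \<in> carrier G" "w' \<notin> C"
  shows "\<exists>n\<in>N. adjacent G w n \<and> adjacent G n w'"
proof -
  have sub: "subgroup N G" using N normal_imp_subgroup by blast
  have "\<not> N \<subseteq> centralizer G {w}" using outside_C[OF w] by blast
  moreover have "\<not> N \<subseteq> centralizer G {w'}" using outside_C[OF w'] by blast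
  ultimately obtain n where n: "n \<in> N" "n \<notin> centralizer G {w}" "n \<notin> centralizer G {w'}"
    using subgroups_not_cover[OF sub subgroup_centralizer1[OF w(1)] subgroup_centralizer1[OF w'(1)]] by blast
  then have "n \<otimes> w \<noteq> w \<otimes> n" "n \<otimes> w' \<noteq> w' \<otimes> n" using Nc by (auto simp: mem_centralizer1_iff)
  then show ?thesis using adjacent_N n(1) w(1) w'(1) adjacent_sym by meson
qed

lemma reach_2_outside_C:
  assumes "w \<in> carrier G" "w \<notin> C" "w' \<in> carrier G" "w' \<notin> C"
  shows "reach (adjacent G) 2 w w'"
  using reach_outside_C[OF assms] reach_2 by metis

lemma reach_3_via_outside:
  assumes "adjacent G y w'" "w' \<notin> C" "w \<in> carrier G" "w \<notin> C"
  shows "reach (adjacent G) 3 y w"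
  using reach_step[of "adjacent G" y w' 2 w] reach_2_outside_C[OF _ assms(2-4)] adjacent_carrier[OF assms(1)] assms(1)
  by (simp add: numeral_3_eq_3 numeral_2_eq_2)

lemma not_center_centralizer: "\<lbrakk>y \<in> carrier G; y \<notin> center G\<rbrakk> \<Longrightarrow> centralizer G {y} \<noteq> carrier G"
  using centralizer_eq_carrier_iff by blast

lemma exists_outside:
  assumes "y \<in> carrier G" "y \<notin> center G"
  obtains b where "b \<in> carrier G" "b \<notin> C" "b \<notin> centralizer G {y}" "y \<otimes> b \<noteq> b \<otimes> y"
proof -
  obtain b where b: "b \<in> carrier G" "b \<notin> C" "b \<notin> centralizer G {y}"
    using proper_subgroups_not_cover[OF C_sub subgroup_centralizer1[OF assms(1)] C_proper not_center_centralizer[OF assms]] by blast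
  then have "y \<otimes> b \<noteq> b \<otimes> y" by (auto simp: mem_centralizer1_iff)
  then show ?thesis using that b by blast
qed

lemma exists_noncommuting_pair:
  assumes "y \<in> carrier G" "y \<notin> center G" "y' \<in> carrier G" "y' \<notin> center G"
  obtains b where "b \<in> carrier G" "b \<notin> centralizer G {y}" "b \<notin> centralizer G {y'}"
    "y \<otimes> b \<noteq> b \<otimes> y" "y' \<otimes> b \<noteq> b \<otimes> y'"
proof -
  obtain b where b: "b \<in> carrier G" "b \<notin> centralizer G {y}" "b \<notin> centralizer G {y'}"
    using proper_subgroups_not_cover[OF subgroup_centralizer1[OF assms(1)] subgroup_centralizer1[OF assms(3)]
        not_center_centralizer[OF assms(1,2)] not_center_centralizer[OF assms(3,4)]] by blast
  then have "y \<otimes> b \<noteq> b \<otimes> y" "y' \<otimes> b \<noteq> b \<otimes> y'" by (auto simp: mem_centralizer1_iff)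
  then show ?thesis using that b by blast
qed

text \<open>Now \<open>C\<close> enjoys the property of \<open>N\<close> in
  \<open>adjacent_N\<close>. So a noncentral element of \<open>C\<close> has a neighbour outside of
  \<open>C\<close>, and the elements outside are at distance at most \<open>2\<close> from each
  other.\<close>

lemma reach_3_if_C_noncyclic:
  assumes nc: "\<not> cyclic_mod G C" and x: "x \<in> carrier G" "x \<notin> center G" and y: "y \<in> carrier G" "y \<notin> center G"
  shows "reach (adjacent G) 3 x y"
proof -
  have adjC: "adjacent G c w" if "c \<in> C" "w \<in> carrier G" "c \<otimes> w \<noteq> w \<otimes> c" for c w
    using adjacentI[OF subgroup_cyclic_extension[OF C_normal that(2)] _
        cyclic_extension_incl[OF C_normal that(2,1)] cyclic_extension_self[OF C_normal that(2)] that(3)] nc that(2)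
    unfolding cyclic_mod_def by blast
  have mixed: "reach (adjacent G) 3 c w" if c: "c \<in> C" "c \<notin> center G" and w: "w \<in> carrier G" "w \<notin> C" for c w
  proof -
    obtain b where b: "b \<in> carrier G" "b \<notin> C" "c \<otimes> b \<noteq> b \<otimes> c" using exists_outside[OF Cc[OF c(1)] c(2)] by blast
    show ?thesis using reach_3_via_outside[OF adjC[OF c(1) b(1,3)] b(2) w] .
  qed
  consider "x \<in> C" "y \<in> C" | "x \<in> C" "y \<notin> C" | "x \<notin> C" "y \<in> C" | "x \<notin> C" "y \<notin> C" by blast
  then show ?thesis
  proof cases
    case 1
    obtain b where b: "b \<in> carrier G" "x \<otimes> b \<noteq> b \<otimes> x" "y \<otimes> b \<noteq> b \<otimes> y"
      using exists_noncommuting_pair[OF x y] by blast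
    then have "reach (adjacent G) 2 x y"
      using reach_2[of "adjacent G" x b y] adjC[OF 1(1) b(1,2)] adjC[OF 1(2) b(1,3)] adjacent_sym by blast
    then show ?thesis using reach_mono by fastforce
  next
    case 4
    then show ?thesis using reach_2_outside_C x y reach_mono[of "adjacent G" 2 x y 3] by simp
  qed (use mixed x y reach_adjacent_sym in blast)+
qed

end

section \<open>Noncyclic \<open>G/N\<close>, cyclic \<open>G/C\<close>\<close>

locale cyclic_centralizer = noncyclic_quotient +
  assumes cycC: "cyclic_mod G C"
begin

lemma N_abelian: "\<lbrakk>n \<in> N; m \<in> N\<rbrakk> \<Longrightarrow> n \<otimes> m = m \<otimes> n"
  using abelian_if_cyclic_mod[OF normal_imp_subgroup[OF N(1)] C_normal cycC] CN by blast

lemma N_C: "N \<subseteq> C"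
  using N_abelian Nc by (auto simp: C_def mem_centralizer_iff)

text \<open>A power of \<open>w\<close> commutes with \<open>w\<close>; the factor \<open>n\<close>
  destroys this without leaving the proper subgroup generated by \<open>N\<close> and
  \<open>w\<close>.\<close>

lemma pow_mult_adjacent:
  assumes w: "w \<in> carrier G" and n: "n \<in> N" "n \<notin> centralizer G {w}"
  shows "adjacent G (w [^] (i::int) \<otimes> n) w"
proof (rule adjacentI[OF subgroup_cyclic_extension[OF N(1) w] N_ext[OF w] _ cyclic_extension_self[OF N(1) w]])
  show "w [^] i \<otimes> n \<in> cyclic_extension G N w"
    using subgroup.m_closed[OF subgroup_cyclic_extension[OF N(1) w] cyclic_extension_pow[OF N(1) w]
        cyclic_extension_incl[OF N(1) w n(1)]] .
  have "w [^] i \<otimes> n \<notin> centralizer G {w}"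
    using subgroup_mult_cancel_left[OF subgroup_centralizer1[OF w] Nc[OF n(1)] int_pow_in_centralizer[OF w]] n(2) by blast
  then show "w [^] i \<otimes> n \<otimes> w \<noteq> w \<otimes> (w [^] i \<otimes> n)" using w Nc[OF n(1)] by (simp add: mem_centralizer1_iff)
qed

lemma mult_N_centralizer_iff:
  assumes "y \<in> C" "a \<in> carrier G" "n \<in> N"
  shows "a \<otimes> n \<in> centralizer G {y} \<longleftrightarrow> a \<in> centralizer G {y}"
  using subgroup_mult_cancel_right[OF subgroup_centralizer1[OF Cc[OF assms(1)]] assms(2)] CN[OF assms(1,3)] Nc[OF assms(3)]
  by (simp add: mem_centralizer1_iff)

text \<open>If \<open>G/C\<close> has a nontrivial proper subgroup, some power \<open>b\<^sup>m\<close> lies outside of \<open>C\<close> but in a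
  proper subgroup containing \<open>C\<close>; then \<open>b\<^sup>m n\<close> replaces \<open>b\<close> where \<open>y\<close> and \<open>b\<close> generate \<open>G\<close>.\<close>

lemma replacement_neighbour:
  assumes w: "w \<in> carrier G" "w \<notin> C" "cyclic_extension G C w \<noteq> carrier G"
    and b: "b \<in> carrier G" "b \<notin> C"
  obtains a where "a \<notin> C" "adjacent G a b"
    "\<And>y. \<lbrakk>y \<in> C; y \<otimes> b \<noteq> b \<otimes> y; \<not> adjacent G y b\<rbrakk> \<Longrightarrow> adjacent G y a"
proof -
  obtain n where n: "n \<in> N" "n \<notin> centralizer G {b}" using outside_C[OF b] by blast
  have nC: "n \<in> C" using n N_C by blast
  show ?thesis
  proof (cases "cyclic_extension G C b = carrier G")
    case False
    \<comment> \<open>Here every relevant \<open>y\<close> is already adjacent to \<open>b\<close>,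
      so \<open>a\<close> only has to be some neighbour of \<open>b\<close> outside of
      \<open>C\<close>; exponent \<open>1\<close> does.\<close>
    have "adjacent G (b [^] (1::int) \<otimes> n) b" using pow_mult_adjacent[OF b(1) n] .
    then have 1: "adjacent G (b \<otimes> n) b" using b by simp
    have 2: "b \<otimes> n \<notin> C" using subgroup_mult_cancel_right[OF C_sub b(1) nC] b(2) by blast
    have "adjacent G y b" if "y \<in> C" "y \<otimes> b \<noteq> b \<otimes> y" for y
      using adjacentI[OF subgroup_cyclic_extension[OF C_normal b(1)] False cyclic_extension_incl[OF C_normal b(1) that(1)]
          cyclic_extension_self[OF C_normal b(1)] that(2)] .
    then show ?thesis using that[OF 2 1] by blast
  next
    case True
    then have "w \<in> cyclic_extension G C b" using w by simp
    then obtain c m where cm: "c \<in> C" "w = c \<otimes> b [^] (m::int)" by (rule cyclic_extensionE)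
    have bmc: "b [^] m \<in> carrier G" using b by simp
    have bmC: "b [^] m \<notin> C" using subgroup_mult_cancel_left[OF C_sub bmc cm(1)] cm(2) w(2) by simp
    \<comment> \<open>Modulo \<open>C\<close> the power \<open>b^m\<close> agrees with
      \<open>w\<close>, so together with \<open>C\<close> it stays in a proper subgroup.\<close>
    have "b [^] m \<in> cyclic_extension G C w"
      using subgroup_mult_cancel_left[OF subgroup_cyclic_extension[OF C_normal w(1)] bmc
          cyclic_extension_incl[OF C_normal w(1) cm(1)]] cyclic_extension_self[OF C_normal w(1)] cm(2) by simp
    moreover have "C \<subseteq> cyclic_extension G C w" using cyclic_extension_incl[OF C_normal w(1)] by blast
    ultimately have "cyclic_extension G C (b [^] m) \<subseteq> cyclic_extension G C w"
      using cyclic_extension_minimal[OF subgroup_cyclic_extension[OF C_normal w(1)]] by blast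
    moreover have E: "subgroup (cyclic_extension G C (b [^] m)) G" using subgroup_cyclic_extension[OF C_normal bmc] .
    ultimately have ne: "cyclic_extension G C (b [^] m) \<noteq> carrier G"
      using w(3) mem_subgroup[OF subgroup_cyclic_extension[OF C_normal w(1)]] by blast
    let ?a = "b [^] m \<otimes> n"
    have aC: "?a \<notin> C" using subgroup_mult_cancel_right[OF C_sub bmc nC] bmC by blast
    have aE: "?a \<in> cyclic_extension G C (b [^] m)"
      using subgroup.m_closed[OF E cyclic_extension_self[OF C_normal bmc] cyclic_extension_incl[OF C_normal bmc nC]] .
    have bmZ: "b [^] m \<notin> center G" using bmC Z_C by blast
    have "adjacent G y ?a" if y: "y \<in> C" "y \<otimes> b \<noteq> b \<otimes> y" "\<not> adjacent G y b" for y
    proof -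
      have "?a \<notin> centralizer G {y}"
        using pow_not_in_centralizer[OF y(3,2) Cc[OF y(1)] b(1) bmZ] mult_N_centralizer_iff[OF y(1) bmc n(1)] by blast
      then have "y \<otimes> ?a \<noteq> ?a \<otimes> y" using Nc[OF n(1)] bmc by (auto simp: mem_centralizer1_iff)
      then show ?thesis using adjacentI[OF E ne cyclic_extension_incl[OF C_normal bmc y(1)] aE] by blast
    qed
    then show ?thesis using that[OF aC pow_mult_adjacent[OF b(1) n]] by blast
  qed
qed

lemma neighbour_outside_C:
  assumes w: "w \<in> carrier G" "w \<notin> C" "cyclic_extension G C w \<noteq> carrier G"
    and y: "y \<in> C" "y \<notin> center G"
  obtains b where "b \<notin> C" "adjacent G y b"
proof -
  obtain b where b: "b \<in> carrier G" "b \<notin> C" "y \<otimes> b \<noteq> b \<otimes> y" using exists_outside[OF Cc[OF y(1)] y(2)] by blast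
  obtain a where a: "a \<notin> C" "\<And>y. \<lbrakk>y \<in> C; y \<otimes> b \<noteq> b \<otimes> y; \<not> adjacent G y b\<rbrakk> \<Longrightarrow> adjacent G y a"
    using replacement_neighbour[OF w b(1,2)] by blast
  show ?thesis using that[OF b(2)] that[OF a(1)] a(2)[OF y(1) b(3)] by blast
qed

lemma reach_3_mixed_nonprime:
  assumes w: "w \<in> carrier G" "w \<notin> C" "cyclic_extension G C w \<noteq> carrier G"
    and y: "y \<in> C" "y \<notin> center G" and v: "v \<in> carrier G" "v \<notin> C"
  shows "reach (adjacent G) 3 y v"
  using neighbour_outside_C[OF w y] reach_3_via_outside[OF _ _ v] by metis

text \<open>For \<open>x\<close>, \<open>y\<close> in \<open>C\<close>, choose \<open>b\<close>
  commuting with neither. Each of them is adjacent to \<open>b\<close> or to its replacement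
  \<open>a\<close>, and \<open>a\<close> and \<open>b\<close> are adjacent.\<close>

lemma reach_3_abelian_nonprime:
  assumes w: "w \<in> carrier G" "w \<notin> C" "cyclic_extension G C w \<noteq> carrier G"
    and ab: "\<And>x y. \<lbrakk>x \<in> C; y \<in> C\<rbrakk> \<Longrightarrow> x \<otimes> y = y \<otimes> x"
    and x: "x \<in> carrier G" "x \<notin> center G" and y: "y \<in> carrier G" "y \<notin> center G"
  shows "reach (adjacent G) 3 x y"
proof -
  consider "x \<in> C" "y \<in> C" | "x \<in> C" "y \<notin> C" | "x \<notin> C" "y \<in> C" | "x \<notin> C" "y \<notin> C" by blast
  then show ?thesis
  proof cases
    case 1
    obtain b where b: "b \<in> carrier G" "x \<otimes> b \<noteq> b \<otimes> x" "y \<otimes> b \<noteq> b \<otimes> y"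
      using exists_noncommuting_pair[OF x y] by blast
    have bC: "b \<notin> C" using ab[OF 1(1)] b(2) by blast
    obtain a where a: "adjacent G a b" "\<And>y. \<lbrakk>y \<in> C; y \<otimes> b \<noteq> b \<otimes> y; \<not> adjacent G y b\<rbrakk> \<Longrightarrow> adjacent G y a"
      using replacement_neighbour[OF w b(1) bC] by blast
    have ba: "adjacent G b a" using adjacent_sym[OF a(1)] .
    have r2: "reach (adjacent G) 3 x y" if "adjacent G x u" "adjacent G y u" for u
      using reach_2[of "adjacent G" x u y] that adjacent_sym reach_mono[of "adjacent G" 2 x y 3] by simp
    consider "adjacent G x b" "adjacent G y b" | "adjacent G x b" "adjacent G y a"
      | "adjacent G x a" "adjacent G y b" | "adjacent G x a" "adjacent G y a"
      using a(2)[OF 1(1) b(2)] a(2)[OF 1(2) b(3)] by blast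
    then show ?thesis
      using r2 reach_3[of "adjacent G" x b a y] reach_3[of "adjacent G" x a b y] ba a(1) adjacent_sym
      by cases blast+
  next
    case 4
    then show ?thesis using reach_2_outside_C x y reach_mono[of "adjacent G" 2 x y 3] by simp
  qed (use reach_3_mixed_nonprime[OF w] x y reach_adjacent_sym in blast)+
qed

lemma abelian_frobenius_like_if_prime:
  assumes prime: "\<And>w. \<lbrakk>w \<in> carrier G; w \<notin> C\<rbrakk> \<Longrightarrow> cyclic_extension G C w = carrier G"
    and ab: "\<And>x y. \<lbrakk>x \<in> C; y \<in> C\<rbrakk> \<Longrightarrow> x \<otimes> y = y \<otimes> x"
  shows "abelian_frobenius_like G C"
proof (intro abelian_frobenius_like.intro frobenius_like.intro frobenius_like_axioms.intro
      abelian_frobenius_like_axioms.intro)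
  show "\<not> C \<subseteq> center G" using N_C N(2) by blast
  fix y w assume y: "y \<in> C" "y \<notin> center G" and w: "w \<in> carrier G" "w \<notin> C"
  show "y \<otimes> w \<noteq> w \<otimes> y"
  proof
    assume "y \<otimes> w = w \<otimes> y"
    then have "w \<in> centralizer G {y}" using w by (simp add: mem_centralizer1_iff)
    moreover have "C \<subseteq> centralizer G {y}" using ab[OF _ y(1)] Cc by (auto simp: mem_centralizer1_iff)
    ultimately have "carrier G \<subseteq> centralizer G {y}"
      using cyclic_extension_minimal[OF subgroup_centralizer1[OF Cc[OF y(1)]], of C w] prime[OF w] by simp
    then have "centralizer G {y} = carrier G" by (auto simp: mem_centralizer1_iff)
    then show False using centralizer_eq_carrier_iff Cc y by blast
  qed
qed (use is_group C_normal C_proper ab in auto)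

text \<open>\<open>G/C\<close> is cyclic, so all commutators lie in the abelian group
  \<open>C\<close> and the second derived subgroup is trivial.\<close>

lemma solvable_if_C_abelian:
  assumes ab: "\<And>x y. \<lbrakk>x \<in> C; y \<in> C\<rbrakk> \<Longrightarrow> x \<otimes> y = y \<otimes> x"
  shows "solvable G"
proof -
  have com: "h \<otimes> k \<otimes> inv h \<otimes> inv k \<in> C" if h: "h \<in> carrier G" and k: "k \<in> carrier G" for h k
  proof -
    interpret C: normal C G by (rule C_normal)
    interpret Q: group "G Mod C" by (rule C.factorgroup_is_group)
    interpret pi: group_hom G "G Mod C" "\<lambda>x. C #> x"
      by (simp add: group_hom_def group_hom_axioms_def group_axioms Q.group_axioms C.r_coset_hom_Mod)
    have "cyclic_group (G Mod C)" using cycC cyclic_group_FactGroup_iff[OF C_normal] by blast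
    then interpret Q: comm_group "G Mod C" by (rule Q.cyclic_imp_abelian_group)
    let ?h = "C #> h" and ?k = "C #> k"
    have c: "?h \<in> carrier (G Mod C)" "?k \<in> carrier (G Mod C)" using pi.hom_closed h k by blast+
    have "C #> (h \<otimes> k \<otimes> inv h \<otimes> inv k) =
        ?h \<otimes>\<^bsub>G Mod C\<^esub> ?k \<otimes>\<^bsub>G Mod C\<^esub> inv\<^bsub>G Mod C\<^esub> ?h \<otimes>\<^bsub>G Mod C\<^esub> inv\<^bsub>G Mod C\<^esub> ?k"
      using pi.hom_mult pi.hom_inv h k by simp
    also have "\<dots> = \<one>\<^bsub>G Mod C\<^esub>"
      using c by (metis Q.inv_closed Q.m_comm Q.inv_solve_right' Q.l_inv Q.m_assoc Q.m_closed Q.r_inv Q.r_one)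
    finally have "C #> (h \<otimes> k \<otimes> inv h \<otimes> inv k) = C" by simp
    then show ?thesis using coset_join1[OF _ _ C_sub] h k mem_subgroup[OF C_sub] by blast
  qed
  have 1: "derived G (carrier G) \<subseteq> C"
    unfolding derived_def by (rule generate_subgroup_incl[OF _ C_sub]) (use com in auto)
  have "derived G (derived G (carrier G)) \<subseteq> {\<one>}"
  proof -
    have "h \<otimes> k \<otimes> inv h \<otimes> inv k = \<one>" if h: "h \<in> C" and k: "k \<in> C" for h k
    proof -
      have "h \<otimes> k \<otimes> inv h = k" using conj_eq_self_iff[OF Cc[OF h] Cc[OF k]] ab[OF h k] by blast
      then show ?thesis using Cc[OF k] by simp
    qed
    then show ?thesis
      unfolding derived_def[of G "derived G (carrier G)"]
      using 1 by (intro generate_subgroup_incl[OF _ triv_subgroup]) blast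
  qed
  moreover have "\<one> \<in> derived G (derived G (carrier G))"
    using subgroup.one_closed[OF derived_is_subgroup] derived_in_carrier by blast
  ultimately have "(derived G ^^ 2) (carrier G) = {\<one>}" by (auto simp: numeral_2_eq_2)
  then show ?thesis using solvable_iff_trivial_derived_seq by blast
qed

end

section \<open>Nonabelian centralizer of \<open>N\<close>\<close>

locale nonabelian_centralizer = cyclic_centralizer +
  assumes nonabelian: "\<exists>x\<in>C. \<exists>y\<in>C. x \<otimes> y \<noteq> y \<otimes> x"
begin

text \<open>The centre of \<open>C\<close>. It contains \<open>N\<close>, and by
  \<open>D_ext\<close> it takes over the role of \<open>N\<close> in producing edges.\<close>

definition "D = C \<inter> centralizer G C"

lemma D_normal: "D \<lhd> G"
  unfolding D_def by (rule normal_subgroup_intersect[OF C_normal normal_centralizer[OF C_normal]])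

lemma D_sub: "subgroup D G"
  using D_normal normal_imp_subgroup by blast

lemma D_C: "d \<in> D \<Longrightarrow> d \<in> C"
  by (simp add: D_def)

lemma D_commute: "\<lbrakk>d \<in> D; c \<in> C\<rbrakk> \<Longrightarrow> d \<otimes> c = c \<otimes> d"
  by (simp add: D_def mem_centralizer_iff)

lemma N_D: "N \<subseteq> D"
proof
  fix n assume n: "n \<in> N"
  have "n \<otimes> c = c \<otimes> n" if "c \<in> C" for c using CN[OF that n] by (rule sym)
  then show "n \<in> D" using n N_C Nc by (auto simp: D_def mem_centralizer_iff)
qed

lemma Z_D: "center G \<subseteq> D"
  using N_D N(2) by blast

lemma not_D: "\<lbrakk>t \<in> C; t \<notin> D\<rbrakk> \<Longrightarrow> \<not> C \<subseteq> centralizer G {t}"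
  using Cc by (fastforce simp: D_def mem_centralizer_iff mem_centralizer1_iff)

lemma not_D_if_noncommuting: "\<lbrakk>t \<in> C; c \<in> C; t \<otimes> c \<noteq> c \<otimes> t\<rbrakk> \<Longrightarrow> t \<notin> D"
  using D_commute by blast

text \<open>Otherwise every element of \<open>C\<close> is a factor central in \<open>C\<close>
  times a power of \<open>w\<close>; such elements commute, against
  \<open>nonabelian\<close>.\<close>

lemma D_ext:
  assumes w: "w \<in> carrier G"
  shows "cyclic_extension G D w \<noteq> carrier G"
proof
  assume e: "cyclic_extension G D w = carrier G"
  have dec: "\<exists>d i. d \<in> D \<and> x = d \<otimes> w [^] (i::int) \<and> w [^] i \<in> C" if x: "x \<in> C" for x
  proof -
    have "x \<in> cyclic_extension G D w" using e Cc[OF x] by simp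
    then obtain d i where d: "d \<in> D" "x = d \<otimes> w [^] (i::int)" by (rule cyclic_extensionE)
    have "w [^] i \<in> C" using subgroup_mult_cancel_left[OF C_sub _ D_C[OF d(1)], of "w [^] i"] d(2) x w by simp
    then show ?thesis using d by blast
  qed
  have "x \<otimes> y = y \<otimes> x" if x: "x \<in> C" and y: "y \<in> C" for x y
  proof -
    obtain d i where d: "d \<in> D" "x = d \<otimes> w [^] (i::int)" "w [^] i \<in> C" using dec[OF x] by blast
    obtain f j where f: "f \<in> D" "y = f \<otimes> w [^] (j::int)" "w [^] j \<in> C" using dec[OF y] by blast
    have "f \<in> centralizer G {w [^] i}" using D_commute[OF f(1) d(3)] Cc D_C f(1) by (simp add: mem_centralizer1_iff)
    moreover have "w [^] j \<in> centralizer G {w [^] i}" using w by (simp add: mem_centralizer1_iff int_pow_commute)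
    ultimately have "y \<in> centralizer G {w [^] i}"
      unfolding f(2) by (rule subgroup.m_closed[OF subgroup_centralizer1[OF Cc[OF d(3)]]])
    then have "w [^] i \<in> centralizer G {y}" using centralizer1_sym Cc d(3) y by blast
    moreover have "d \<in> centralizer G {y}" using D_commute[OF d(1) y] Cc D_C d(1) by (simp add: mem_centralizer1_iff)
    ultimately have "x \<in> centralizer G {y}"
      unfolding d(2) using subgroup.m_closed[OF subgroup_centralizer1[OF Cc[OF y]]] by blast
    then show ?thesis by (simp add: mem_centralizer1_iff)
  qed
  then show False using nonabelian by blast
qed

lemma adjacent_D: "\<lbrakk>y \<in> D; w \<in> carrier G; y \<otimes> w \<noteq> w \<otimes> y\<rbrakk> \<Longrightarrow> adjacent G y w"
  using adjacentI[OF subgroup_cyclic_extension[OF D_normal] D_ext cyclic_extension_incl[OF D_normal] cyclic_extension_self[OF D_normal]] .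

lemma common_neighbour_T:
  assumes "t \<in> C" "t \<notin> D" "t' \<in> C" "t' \<notin> D"
  shows "\<exists>m\<in>C. m \<notin> D \<and> adjacent G t m \<and> adjacent G m t'"
proof -
  obtain m where m: "m \<in> C" "adjacent G t m" "adjacent G m t'"
    using common_neighbour_in_normal[OF C_normal C_proper assms(1) not_D[OF assms(1,2)] assms(3) not_D[OF assms(3,4)]] by blast
  then show ?thesis using not_D_if_noncommuting[OF m(1) assms(3)] adjacent_not_commute[OF m(3)] by blast
qed

lemma reach_2_T: "\<lbrakk>t \<in> C; t \<notin> D; t' \<in> C; t' \<notin> D\<rbrakk> \<Longrightarrow> reach (adjacent G) 2 t t'"
  using common_neighbour_T reach_2 by metis

lemma common_neighbour_D:
  assumes "y \<in> D" "y \<notin> center G" "y' \<in> D" "y' \<notin> center G"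
  shows "\<exists>b\<in>carrier G. b \<notin> C \<and> adjacent G y b \<and> adjacent G b y'"
proof -
  have c: "y \<in> carrier G" "y' \<in> carrier G" using assms Cc D_C by auto
  obtain b where b: "b \<in> carrier G" "y \<otimes> b \<noteq> b \<otimes> y" "y' \<otimes> b \<noteq> b \<otimes> y'"
    using exists_noncommuting_pair[OF c(1) assms(2) c(2) assms(4)] by blast
  then show ?thesis using adjacent_D assms adjacent_sym D_commute by metis
qed

lemma reach_2_D: "\<lbrakk>y \<in> D; y \<notin> center G; y' \<in> D; y' \<notin> center G\<rbrakk> \<Longrightarrow> reach (adjacent G) 2 y y'"
  using common_neighbour_D reach_2 by metis

text \<open>The critical pairs are \<open>t \<in> C\<close> and \<open>d \<in> D\<close>. Choose
  \<open>b\<close> commuting with neither: it is adjacent to \<open>d\<close> by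
  \<open>adjacent_D\<close>, and \<open>t\<close> is adjacent to \<open>b\<close> or to its
  replacement \<open>a\<close>.\<close>

lemma reach_3_nonabelian_nonprime:
  assumes w: "w \<in> carrier G" "w \<notin> C" "cyclic_extension G C w \<noteq> carrier G"
    and x: "x \<in> carrier G" "x \<notin> center G" and y: "y \<in> carrier G" "y \<notin> center G"
  shows "reach (adjacent G) 3 x y"
proof -
  have up: "reach (adjacent G) 2 u v \<Longrightarrow> reach (adjacent G) 3 u v" for u v
    by (rule reach_mono) auto
  have TD: "reach (adjacent G) 3 t d"
    if t: "t \<in> C" "t \<notin> center G" and d: "d \<in> D" "d \<notin> center G" for t d
  proof -
    have c: "t \<in> carrier G" "d \<in> carrier G" using t d Cc D_C by auto
    obtain b where b: "b \<in> carrier G" "t \<otimes> b \<noteq> b \<otimes> t" "d \<otimes> b \<noteq> b \<otimes> d"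
      using exists_noncommuting_pair[OF c(1) t(2) c(2) d(2)] by blast
    have bC: "b \<notin> C" using D_commute[OF d(1)] b(3) by blast
    have db: "adjacent G b d" using adjacent_sym[OF adjacent_D[OF d(1) b(1,3)]] .
    obtain a where a: "adjacent G a b" "\<not> adjacent G t b \<Longrightarrow> adjacent G t a"
      using replacement_neighbour[OF w b(1) bC] t(1) b(2) by metis
    show ?thesis
    proof (cases "adjacent G t b")
      case True
      then show ?thesis using reach_2[of "adjacent G" t b d] db up by blast
    next
      case False
      then show ?thesis using reach_3[of "adjacent G" t a b d] a db by blast
    qed
  qed
  have mixed: "reach (adjacent G) 3 c v" if "c \<in> C" "c \<notin> center G" "v \<in> carrier G" "v \<notin> C" for c v
    using reach_3_mixed_nonprime[OF w that] .
  consider "x \<notin> C" "y \<notin> C" | "x \<in> C" "y \<notin> C" | "x \<notin> C" "y \<in> C" | "x \<in> C" "y \<in> D" | "x \<in> D" "y \<in> C"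
    | "x \<in> C" "x \<notin> D" "y \<in> C" "y \<notin> D" using D_C by blast
  then show ?thesis
  proof cases
    case 1
    then show ?thesis using up reach_2_outside_C x y by blast
  next
    case 6
    then show ?thesis using up reach_2_T by blast
  qed (use mixed TD x y reach_adjacent_sym in blast)+
qed

end

section \<open>Nonabelian centralizer of prime index\<close>

locale prime_nonabelian_centralizer = nonabelian_centralizer +
  assumes prime: "\<And>w. \<lbrakk>w \<in> carrier G; w \<notin> C\<rbrakk> \<Longrightarrow> cyclic_extension G C w = carrier G"
begin

lemma D_no_commute:
  assumes y: "y \<in> D" "y \<notin> center G" and w: "w \<in> carrier G" "w \<notin> C"
  shows "y \<otimes> w \<noteq> w \<otimes> y"
proof
  have yc: "y \<in> carrier G" using y Cc D_C by blast
  assume "y \<otimes> w = w \<otimes> y"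
  then have "w \<in> centralizer G {y}" using w by (simp add: mem_centralizer1_iff)
  moreover have "C \<subseteq> centralizer G {y}" using D_commute[OF y(1)] Cc by (auto simp: mem_centralizer1_iff)
  ultimately have "carrier G \<subseteq> centralizer G {y}"
    using cyclic_extension_minimal[OF subgroup_centralizer1[OF yc], of C w] prime[OF w] by simp
  then have "centralizer G {y} = carrier G" by (auto simp: mem_centralizer1_iff)
  then show False using centralizer_eq_carrier_iff yc y by blast
qed

lemma adjacent_D_outside: "\<lbrakk>y \<in> D; y \<notin> center G; w \<in> carrier G; w \<notin> C\<rbrakk> \<Longrightarrow> adjacent G y w"
  using adjacent_D D_no_commute by blast

lemma reach_2_U:
  assumes x: "x \<in> carrier G" "x \<notin> center G" "x \<notin> C - D" and y: "y \<in> carrier G" "y \<notin> center G" "y \<notin> C - D"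
  shows "reach (adjacent G) 2 x y"
proof -
  have DO: "reach (adjacent G) 2 d w" if "d \<in> D" "d \<notin> center G" "w \<in> carrier G" "w \<notin> C" for d w
    using reach_1[of "adjacent G" d w 1] adjacent_D_outside[OF that] by (simp add: numeral_2_eq_2)
  consider "x \<in> D" "y \<in> D" | "x \<in> D" "y \<notin> C" | "x \<notin> C" "y \<in> D" | "x \<notin> C" "y \<notin> C" using x y by blast
  then show ?thesis
  proof cases
    case 1
    then show ?thesis using reach_2_D x y by blast
  next
    case 4
    then show ?thesis using reach_2_outside_C x y by blast
  qed (use DO x y reach_adjacent_sym in blast)+
qed

lemma edge_from_T:
  assumes "adjacent G t u" "t \<in> C - D" "u \<notin> C - D"
  shows "u \<notin> C"
  using assms D_commute[of u t] adjacent_not_commute[OF assms(1)] by fastforce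

text \<open>One edge leading out of \<open>C\<close> from \<open>C - D\<close> spreads to all of
  \<open>C - D\<close>. Take \<open>w\<close> outside of \<open>C\<close> not commuting with
  \<open>t0\<close>, and suppose there is no edge. A noncentral power of \<open>w\<close> in
  \<open>C\<close>, times a suitable element of \<open>N\<close>, is adjacent to both. If there is
  none, \<open>t0\<close> cannot centralize all conjugates of \<open>t\<close>: otherwise
  \<open>C \<inter> ?E\<close> and \<open>w\<close> generate \<open>G\<close>, so \<open>C\<close>
  is \<open>C \<inter> ?E\<close> times central powers of \<open>w\<close> and centralizes
  \<open>t\<close>. So some conjugate of \<open>t\<close> is adjacent to \<open>t0\<close>, and
  conjugating \<open>u\<close> gives it a neighbour outside of \<open>C\<close>.\<close>

lemma neighbour_with_edge:
  assumes tu: "adjacent G t u" "t \<in> C" "t \<notin> D" "u \<notin> C" and t0: "t0 \<in> C" "t0 \<notin> D"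
  obtains w where "w \<notin> C" "adjacent G t0 w"
    | t1 w where "t1 \<in> C" "adjacent G t0 t1" "w \<notin> C" "adjacent G t1 w"
proof -
  have c: "t0 \<in> carrier G" "t \<in> carrier G" "u \<in> carrier G" using Cc t0 adjacent_carrier[OF tu(1)] by auto
  have z0: "t0 \<notin> center G" using t0 Z_D by blast
  obtain w where w: "w \<in> carrier G" "w \<notin> C" "t0 \<otimes> w \<noteq> w \<otimes> t0" using exists_outside[OF c(1) z0] by blast
  show ?thesis
  proof (cases "adjacent G t0 w")
    case True
    then show ?thesis using that(1) w by blast
  next
    case na: False
    show ?thesis
    proof (cases "\<exists>i::int. w [^] i \<in> C \<and> w [^] i \<notin> center G")
      case True
      then obtain i :: int where i: "w [^] i \<in> C" "w [^] i \<notin> center G" by blast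
      obtain n where n: "n \<in> N" "n \<notin> centralizer G {w}" using outside_C[OF w(1,2)] by blast
      let ?m = "w [^] i \<otimes> n"
      have nC: "n \<in> C" using n N_C by blast
      have mC: "?m \<in> C" using subgroup.m_closed[OF C_sub i(1) nC] .
      have "?m \<notin> centralizer G {t0}"
        using pow_not_in_centralizer[OF na w(3) c(1) w(1) i(2)] mult_N_centralizer_iff[OF t0(1) Cc[OF i(1)] n(1)] by blast
      then have "t0 \<otimes> ?m \<noteq> ?m \<otimes> t0" using Cc[OF mC] by (auto simp: mem_centralizer1_iff)
      then have "adjacent G t0 ?m" using normal_proper_adjacent[OF C_normal C_proper t0(1) mC] by blast
      then show ?thesis using that(2)[OF mC _ w(2)] pow_mult_adjacent[OF w(1) n] by blast
    next
      case False
      let ?S = "{g \<otimes> t \<otimes> inv g |g. g \<in> carrier G}"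
      let ?E = "centralizer G ?S"
      have "t0 \<notin> ?E"
      proof
        assume "t0 \<in> ?E"
        have E: "?E \<lhd> G" using normal_centralizer_conjugates[OF c(2)] .
        have e: "cyclic_extension G (C \<inter> ?E) w = carrier G"
          using not_adjacent_cyclic_extension[OF na w(3) normal_subgroup_intersect[OF C_normal E] _ w(1)] t0(1) \<open>t0 \<in> ?E\<close> by blast
        have "C \<subseteq> centralizer G {t}"
        proof
          fix x assume x: "x \<in> C"
          have "x \<in> cyclic_extension G (C \<inter> ?E) w" using e Cc[OF x] by simp
          then obtain d i where d: "d \<in> C \<inter> ?E" "x = d \<otimes> w [^] (i::int)" by (rule cyclic_extensionE)
          have "d \<in> C" using d(1) by blast
          then have "w [^] i \<in> C" using subgroup_mult_cancel_left[OF C_sub, of "w [^] i" d] d(2) x w by simp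
          then have "w [^] i \<in> centralizer G {t}" using False center_subset_centralizer[of "{t}"] c by blast
          moreover have "d \<in> centralizer G {t}"
          proof -
            have "\<one> \<otimes> t \<otimes> inv \<one> \<in> ?S" by blast
            then have "t \<in> ?S" using c by simp
            moreover have "d \<in> ?E" using d(1) by blast
            ultimately have "d \<otimes> t = t \<otimes> d" unfolding mem_centralizer_iff by blast
            then show ?thesis using Cc[OF \<open>d \<in> C\<close>] by (simp add: mem_centralizer1_iff)
          qed
          ultimately show "x \<in> centralizer G {t}"
            unfolding d(2) using subgroup.m_closed[OF subgroup_centralizer1[OF c(2)]] by blast
        qed
        then show False using not_D[OF tu(2,3)] by blast
      qed
      then obtain s where s: "s \<in> ?S" "t0 \<otimes> s \<noteq> s \<otimes> t0" using c(1) unfolding mem_centralizer_iff by blast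
      then obtain g where g: "g \<in> carrier G" "s = g \<otimes> t \<otimes> inv g" by blast
      have sC: "s \<in> C" unfolding g(2) using normal_conj[OF C_normal g(1) tu(2)] .
      have "adjacent G s (g \<otimes> u \<otimes> inv g)" unfolding g(2) using adjacent_conjugate[OF tu(1) g(1)] .
      moreover have "g \<otimes> u \<otimes> inv g \<notin> C"
        using normal_conj[OF C_normal inv_closed[OF g(1)], of "g \<otimes> u \<otimes> inv g"] conj_inv_cancel[OF g(1) c(3)] tu(4) by auto
      moreover have "adjacent G t0 s" using normal_proper_adjacent[OF C_normal C_proper t0(1) sC s(2)] .
      ultimately show ?thesis using that(2)[OF sC] by blast
    qed
  qed
qed

text \<open>At most two steps lead from \<open>C - D\<close> out of \<open>C\<close>, and two more
  to any vertex not in \<open>C - D\<close>.\<close>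

lemma reach_4:
  assumes tu: "adjacent G t u" "t \<in> C" "t \<notin> D" "u \<notin> C"
    and x: "x \<in> carrier G" "x \<notin> center G" and y: "y \<in> carrier G" "y \<notin> center G"
  shows "reach (adjacent G) 4 x y"
proof -
  have up: "reach (adjacent G) 2 u v \<Longrightarrow> reach (adjacent G) 4 u v" for u v
    by (rule reach_mono) auto
  have TU: "reach (adjacent G) 4 t0 v" if t0: "t0 \<in> C" "t0 \<notin> D" and v: "v \<in> carrier G" "v \<notin> center G" "v \<notin> C - D" for t0 v
  proof (rule neighbour_with_edge[OF tu t0])
    fix w assume w: "w \<notin> C" "adjacent G t0 w"
    have "reach (adjacent G) 2 w v"
      using reach_2_U[OF _ _ _ v, of w] adjacent_carrier[OF w(2)] adjacent_not_center[OF w(2)] w(1) by blast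
    from reach_step[of "adjacent G" t0 w 2 v, OF w(2) this]
    show ?thesis by (rule reach_mono) simp
  next
    fix t1 w assume w: "t1 \<in> C" "adjacent G t0 t1" "w \<notin> C" "adjacent G t1 w"
    have "reach (adjacent G) 2 w v"
      using reach_2_U[OF _ _ _ v, of w] adjacent_carrier[OF w(4)] adjacent_not_center[OF w(4)] w(3) by blast
    from reach_step[of "adjacent G" t0 t1 _ v, OF w(2) reach_step[of "adjacent G" t1 w 2 v, OF w(4) this]]
    show ?thesis by (rule reach_mono) simp
  qed
  consider "x \<in> C - D" "y \<in> C - D" | "x \<in> C - D" "y \<notin> C - D" | "x \<notin> C - D" "y \<in> C - D" | "x \<notin> C - D" "y \<notin> C - D" by blast
  then show ?thesis
  proof cases
    case 1
    then show ?thesis using up reach_2_T by blast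
  next
    case 4
    then show ?thesis using up reach_2_U x y by blast
  qed (use TU x y reach_adjacent_sym in blast)+
qed

end

section \<open>Vertices outside of \<open>C\<close> without neighbours in
  \<open>C - D\<close>\<close>

context prime_nonabelian_centralizer
begin

context
  fixes w0
  assumes w0: "w0 \<in> carrier G" "w0 \<notin> C"
    and no_neighbour: "\<And>m. \<lbrakk>m \<in> C; m \<notin> D\<rbrakk> \<Longrightarrow> \<not> adjacent G m w0"
begin

text \<open>A noncentral power in \<open>D\<close> is excluded by \<open>D_no_commute\<close>; a
  power in \<open>C - D\<close>, multiplied by a suitable element of \<open>N\<close>, would be a
  forbidden neighbour.\<close>

lemma w0_pow: 
  assumes i: "w0 [^] (i::int) \<in> C"
  shows "w0 [^] i \<in> center G"
proof (rule ccontr)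
  assume z: "w0 [^] i \<notin> center G"
  show False
  proof (cases "w0 [^] i \<in> D")
    case True
    then show False using D_no_commute[OF True z w0] int_pow_commute_self[OF w0(1)] by blast
  next
    case False
    obtain n where n: "n \<in> N" "n \<notin> centralizer G {w0}" using outside_C[OF w0] by blast
    have "w0 [^] i \<otimes> n \<in> C" using subgroup.m_closed[OF C_sub i] n(1) N_C by blast
    moreover have "w0 [^] i \<otimes> n \<notin> D"
      using subgroup_mult_cancel_right[OF D_sub Cc[OF i]] n(1) N_D False by blast
    ultimately show False using no_neighbour pow_mult_adjacent[OF w0(1) n] by blast
  qed
qed

text \<open>If \<open>t\<close> commutes with \<open>w0\<close>, then \<open>t \<otimes> n\<close>
  does not, while both \<open>t \<otimes> n\<close> and \<open>w0\<close> lie in the proper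
  centralizer of \<open>t\<close>: a forbidden edge.\<close>

lemma T_no_commute:
  assumes t: "t \<in> C" "t \<notin> D"
  shows "t \<otimes> w0 \<noteq> w0 \<otimes> t"
proof
  assume com: "t \<otimes> w0 = w0 \<otimes> t"
  have tc: "t \<in> carrier G" using Cc t by blast
  obtain n where n: "n \<in> N" "n \<notin> centralizer G {w0}" using outside_C[OF w0] by blast
  have nD: "n \<in> D" and nC: "n \<in> C" using n N_D N_C by auto
  have tn: "t \<otimes> n \<in> C" "t \<otimes> n \<notin> D"
    using subgroup.m_closed[OF C_sub t(1) nC] subgroup_mult_cancel_right[OF D_sub tc nD] t by auto
  have t1: "t \<in> centralizer G {w0}" using com tc by (simp add: mem_centralizer1_iff)
  then have "t \<otimes> n \<notin> centralizer G {w0}"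
    using subgroup_mult_cancel_left[OF subgroup_centralizer1[OF w0(1)] Nc[OF n(1)]] n(2) by blast
  then have ne: "t \<otimes> n \<otimes> w0 \<noteq> w0 \<otimes> (t \<otimes> n)" using Cc[OF tn(1)] by (simp add: mem_centralizer1_iff)
  have "t \<otimes> n \<in> centralizer G {t}"
    using D_commute[OF nD t(1)] tc Nc[OF n(1)] by (simp add: mem_centralizer1_iff m_assoc)
  moreover have "w0 \<in> centralizer G {t}" using t1 centralizer1_sym tc w0 by blast
  ultimately have "centralizer G {t} = carrier G"
    using not_adjacentD[OF no_neighbour[OF tn] ne subgroup_centralizer1[OF tc]] by blast
  then show False using not_center_centralizer[OF tc] t Z_D by blast
qed

text \<open>\<open>t\<close> and \<open>w0\<close> generate \<open>G\<close>, so \<open>M\<close> is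
  normal, and \<open>M\<close> and \<open>w0\<close> generate \<open>G\<close>. Powers of
  \<open>w0\<close> in \<open>C\<close> are central, whence \<open>C = M Z\<close>: an invariant
  subgroup meeting \<open>C - D\<close> controls all of \<open>C\<close>.\<close>

lemma generated_by_invariant:
  assumes M: "subgroup M G" "M \<subseteq> C" and t: "t \<in> M" "t \<notin> D"
    and inv: "\<And>m. m \<in> M \<Longrightarrow> w0 \<otimes> m \<otimes> inv w0 \<in> M" "\<And>m. m \<in> M \<Longrightarrow> inv w0 \<otimes> m \<otimes> w0 \<in> M"
    and c: "c \<in> C"
  obtains m z where "m \<in> M" "z \<in> center G" "c = m \<otimes> z"
proof -
  have tC: "t \<in> C" using t M by blast
  have K: "K = carrier G" if "subgroup K G" "w0 \<in> K" "M \<subseteq> K" for K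
    using not_adjacentD[OF no_neighbour[OF tC t(2)] T_no_commute[OF tC t(2)] that(1)] that t by blast
  have nrm: "M \<lhd> G" by (rule normal_if_normalized_by_generators[OF M(1) K w0(1) inv])
  have "cyclic_extension G M w0 = carrier G"
    by (rule K[OF subgroup_cyclic_extension[OF nrm w0(1)] cyclic_extension_self[OF nrm w0(1)]])
      (use cyclic_extension_incl[OF nrm w0(1)] in blast)
  then have "c \<in> cyclic_extension G M w0" using Cc[OF c] by simp
  then obtain m i where m: "m \<in> M" "c = m \<otimes> w0 [^] (i::int)" by (rule cyclic_extensionE)
  have "w0 [^] i \<in> C" using subgroup_mult_cancel_left[OF C_sub, of "w0 [^] i" m] m M c w0 by auto
  then show ?thesis using that m w0_pow by blast
qed

text \<open>The commutator \<open>[k, w0]\<close>. Modulo \<open>D\<close> it is injective on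
  \<open>C\<close>, and for finite \<open>G\<close> surjective.\<close>

definition "twist k = k \<otimes> w0 \<otimes> inv k \<otimes> inv w0"

lemma twist_C:
  assumes "k \<in> C"
  shows "twist k \<in> C"
proof -
  have "w0 \<otimes> inv k \<otimes> inv w0 \<in> C" using normal_conj[OF C_normal w0(1) subgroup.m_inv_closed[OF C_sub assms]] .
  then have "k \<otimes> (w0 \<otimes> inv k \<otimes> inv w0) \<in> C" using subgroup.m_closed[OF C_sub assms] by blast
  then show ?thesis using Cc[OF assms] w0 by (simp add: twist_def m_assoc)
qed

text \<open>If \<open>[j, w0]\<close> lies in \<open>D\<close>, then \<open>w0\<close> conjugates
  \<open>j\<close> into the coset \<open>D j\<close>. As \<open>D\<close> centralizes
  \<open>C\<close>, the centralizer of \<open>j\<close> in \<open>C\<close> is invariant under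
  \<open>w0\<close>; for \<open>j\<close> outside of \<open>D\<close>,
  \<open>generated_by_invariant\<close> would make \<open>C\<close> centralize
  \<open>j\<close>.\<close>

lemma twist_in_D:
  assumes j: "j \<in> C" and f: "twist j \<in> D"
  shows "j \<in> D"
proof (rule ccontr)
  assume nD: "j \<notin> D"
  have jc: "j \<in> carrier G" using Cc j by blast
  let ?b = "w0 \<otimes> j \<otimes> inv w0 \<otimes> inv j"
  let ?a = "inv w0 \<otimes> j \<otimes> w0 \<otimes> inv j"
  have b: "?b \<in> D"
    using subgroup.m_inv_closed[OF D_sub f] jc w0 by (simp add: twist_def inv_mult_group m_assoc)
  have "inv w0 \<otimes> twist j \<otimes> inv (inv w0) \<in> D" by (rule normal_conj[OF D_normal inv_closed[OF w0(1)] f])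
  then have a: "?a \<in> D" using jc w0 by (simp add: twist_def m_assoc)
  have bj: "w0 \<otimes> j \<otimes> inv w0 = ?b \<otimes> j" and aj: "inv w0 \<otimes> j \<otimes> w0 = ?a \<otimes> j"
    using jc w0 by (simp_all add: m_assoc)
  let ?M = "C \<inter> centralizer G {j}"
  have M: "subgroup ?M G" using C_sub subgroup_centralizer1[OF jc] by (rule subgroups_Inter_pair)
  have com: "c \<otimes> (d \<otimes> j) = d \<otimes> j \<otimes> c" if "c \<in> ?M" "d \<in> D" for c d
  proof -
    have cc: "c \<in> carrier G" using that Cc by blast
    have "d \<in> centralizer G {c}" using D_commute[OF that(2), of c] that Cc D_C by (auto simp: mem_centralizer1_iff)
    moreover have "j \<in> centralizer G {c}" using that centralizer1_sym cc jc by blast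
    ultimately have "d \<otimes> j \<in> centralizer G {c}" using subgroup.m_closed[OF subgroup_centralizer1[OF cc]] by blast
    then show ?thesis by (simp add: mem_centralizer1_iff)
  qed
  have i1: "w0 \<otimes> m \<otimes> inv w0 \<in> ?M" if m: "m \<in> ?M" for m
  proof -
    have mC: "m \<in> C" and mc: "m \<in> carrier G" using m Cc by auto
    have "(w0 \<otimes> m \<otimes> inv w0) \<otimes> j = j \<otimes> (w0 \<otimes> m \<otimes> inv w0)"
      using conj_in_centralizer_iff[OF w0(1) mc jc] com[OF m a] aj by simp
    then show ?thesis using normal_conj[OF C_normal w0(1) mC] mc w0 by (simp add: mem_centralizer1_iff)
  qed
  have i2: "inv w0 \<otimes> m \<otimes> w0 \<in> ?M" if m: "m \<in> ?M" for m
  proof -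
    have mC: "m \<in> C" and mc: "m \<in> carrier G" using m Cc by auto
    have "(inv w0 \<otimes> m \<otimes> w0) \<otimes> j = j \<otimes> (inv w0 \<otimes> m \<otimes> w0)"
      using conj_in_centralizer_iff[OF inv_closed[OF w0(1)] mc jc] com[OF m b] bj w0 by simp
    then show ?thesis using normal_conj[OF C_normal inv_closed[OF w0(1)] mC] mc w0 by (simp add: mem_centralizer1_iff)
  qed
  have "C \<subseteq> centralizer G {j}"
  proof
    fix c assume c: "c \<in> C"
    have "j \<in> ?M" using j jc by (simp add: mem_centralizer1_iff)
    then obtain m z where "m \<in> ?M" "z \<in> center G" "c = m \<otimes> z"
      using generated_by_invariant[OF M _ _ nD i1 i2 c] by blast
    then show "c \<in> centralizer G {j}"
      using subgroup.m_closed[OF subgroup_centralizer1[OF jc]] center_subset_centralizer[of "{j}"] jc by blast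
  qed
  then show False using not_D[OF j nD] by blast
qed

text \<open>If \<open>[k', w0] = z [k, w0]\<close> with \<open>z \<in> D\<close>, then
  \<open>[k^-1 k', w0] = k^-1 z k = z\<close>, and \<open>twist_in_D\<close> applies to
  \<open>k^-1 k'\<close>.\<close>

lemma twist_coset_inj:
  assumes k: "k \<in> C" "k' \<in> C" and eq: "D #> twist k' = D #> twist k"
  shows "D #> k' = D #> k"
proof -
  have c: "k \<in> carrier G" "k' \<in> carrier G" using Cc k by auto
  have fc: "twist k \<in> carrier G" "twist k' \<in> carrier G" using Cc twist_C k by auto
  have "twist k' \<in> D #> twist k" using rcos_self[OF fc(2) D_sub] eq by simp
  then obtain z where z: "z \<in> D" "twist k' = z \<otimes> twist k" by (auto simp: r_coset_def)
  have zc: "z \<in> carrier G" using z Cc D_C by blast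
  let ?j = "inv k \<otimes> k'"
  have jC: "?j \<in> C" using subgroup.m_closed[OF C_sub] subgroup.m_inv_closed[OF C_sub] k by blast
  have "twist ?j = inv k \<otimes> (twist k') \<otimes> (w0 \<otimes> k \<otimes> inv w0)"
    using c w0 by (simp add: twist_def inv_mult_group m_assoc inv_mult_cancel)
  also have "\<dots> = inv k \<otimes> z \<otimes> k"
    unfolding z(2) using c w0 zc by (simp add: twist_def m_assoc inv_mult_cancel)
  also have "\<dots> = z" using D_commute[OF z(1) k(1)] c zc by (simp add: m_assoc inv_mult_cancel)
  finally have "?j \<in> D" using twist_in_D[OF jC] z(1) by simp
  then have "?j \<otimes> k \<in> D #> k" by (auto simp: r_coset_def)
  moreover have "?j \<otimes> k = k'" using D_commute[OF \<open>?j \<in> D\<close> k(1)] c by (simp add: inv_mult_cancel)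
  ultimately show ?thesis using repr_independence[OF _ c(1) D_sub] by simp
qed

lemma twist_surj:
  assumes fin: "finite (carrier G)" and c: "c \<in> C"
  obtains k z where "k \<in> C" "z \<in> D" "c = z \<otimes> twist k"
proof -
  have finC: "finite C" using fin Cc by (meson finite_subset subsetI)
  let ?q = "\<lambda>k. D #> k" and ?g = "\<lambda>k. D #> twist k"
  \<comment> \<open>A choice of preimages recovers each coset \<open>D #> k\<close> from
    \<open>D #> twist k\<close>; so \<open>twist\<close> meets at least as many cosets as there are
    in \<open>C\<close>, and finiteness makes it meet all.\<close>
  let ?h = "\<lambda>X. ?q (SOME k. k \<in> C \<and> ?g k = X)"
  have "?q k = ?h (?g k)" if k: "k \<in> C" for k
  proof -
    have "(SOME k'. k' \<in> C \<and> ?g k' = ?g k) \<in> C \<and> ?g (SOME k'. k' \<in> C \<and> ?g k' = ?g k) = ?g k"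
      by (rule someI[of _ k]) (use k in simp)
    then show ?thesis using twist_coset_inj[OF _ k, of "SOME k'. k' \<in> C \<and> ?g k' = ?g k"] by metis
  qed
  then have "?q ` C \<subseteq> ?h ` (?g ` C)" by (auto simp: image_image)
  then have "card (?q ` C) \<le> card (?g ` C)" using surj_card_le[of "?g ` C" "?q ` C" ?h] finC by simp
  moreover have "?g ` C \<subseteq> ?q ` C" using twist_C by blast
  ultimately have "?g ` C = ?q ` C" using finC by (meson card_seteq finite_imageI)
  then obtain k where k: "k \<in> C" "D #> twist k = D #> c" using c by (metis (no_types, lifting) image_iff)
  have "c \<in> D #> twist k" using rcos_self[OF Cc[OF c] D_sub] k(2) by simp
  then show ?thesis using that k(1) by (auto simp: r_coset_def)
qed

text \<open>The walk is \<open>t0\<close>, \<open>s\<close>, \<open>z' w0\<close>,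
  \<open>w0\<close>. A conjugate \<open>?H\<close> of the proper subgroup behind the edge from
  \<open>t\<close> to \<open>u\<close> is made to contain \<open>z' w0\<close> with
  \<open>z'\<close> in the centre of \<open>C\<close>, and \<open>s\<close> is taken from
  \<open>?H \<inter> C\<close>. That \<open>z'\<close> is noncentral in \<open>G\<close> keeps
  \<open>z' w0\<close> from commuting with \<open>w0\<close>.\<close>

lemma reach_3_no_neighbour:
  assumes fin: "finite (carrier G)" and tu: "adjacent G t u" "t \<in> C" "t \<notin> D" "u \<notin> C"
    and t0: "t0 \<in> C" "t0 \<notin> D"
  shows "reach (adjacent G) 3 t0 w0"
proof -
  have c: "t0 \<in> carrier G" "t \<in> carrier G" "u \<in> carrier G" using Cc t0 adjacent_carrier[OF tu(1)] by auto
  obtain H where H: "subgroup H G" "H \<noteq> carrier G" "t \<in> H" "u \<in> H" using tu(1) by (rule adjacentE)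
  have "w0 \<in> cyclic_extension G C u" using prime[OF c(3) tu(4)] w0 by simp
  then obtain a i where a: "a \<in> C" "w0 = a \<otimes> u [^] (i::int)" by (rule cyclic_extensionE)
  have ac: "a \<in> carrier G" using Cc a by blast
  \<comment> \<open>Surjectivity is applied to \<open>a^-1\<close> because
    \<open>a^-1 w0 = u^i\<close>; inserting \<open>a^-1 = z [k, w0]\<close> shows that
    \<open>u^i\<close> is the conjugate of \<open>z w0\<close> by \<open>k\<close>.\<close>
  obtain k z where k: "k \<in> C" and z: "z \<in> D" and kz: "inv a = z \<otimes> twist k"
    using twist_surj[OF fin subgroup.m_inv_closed[OF C_sub a(1)]] by blast
  have kc: "k \<in> carrier G" and zc: "z \<in> carrier G" using Cc D_C k z by auto
  have "u [^] i = inv a \<otimes> w0" unfolding a(2) using ac c by (simp add: inv_mult_cancel)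
  also have "\<dots> = z \<otimes> k \<otimes> w0 \<otimes> inv k" unfolding kz using kc zc w0 by (simp add: twist_def m_assoc)
  also have "\<dots> = k \<otimes> z \<otimes> w0 \<otimes> inv k" using D_commute[OF z k] by simp
  finally have ui: "u [^] i = k \<otimes> z \<otimes> w0 \<otimes> inv k" .
  let ?H = "(\<lambda>h. inv k \<otimes> h \<otimes> inv (inv k)) ` H"
  let ?t = "inv k \<otimes> t \<otimes> k"
  have H': "subgroup ?H G" "?H \<noteq> carrier G"
    using conj_subgroup[OF H(1), of "inv k"] conj_subgroup_eq_carrier[OF H(1), of "inv k"] H(2) kc by auto
  have tH: "?t \<in> ?H" using H(3) kc by auto
  have "inv k \<otimes> (u [^] i) \<otimes> inv (inv k) = z \<otimes> w0"
    unfolding ui using kc zc w0 by (simp add: m_assoc inv_mult_cancel)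
  moreover have "inv k \<otimes> (u [^] i) \<otimes> inv (inv k) \<in> ?H" using subgroup_int_pow[OF H(1,4)] by blast
  ultimately have zw: "z \<otimes> w0 \<in> ?H" by simp
  have tC: "?t \<in> C" using normal_conj[OF C_normal inv_closed[OF kc] tu(2)] kc by simp
  have tD: "?t \<notin> D"
  proof
    assume "?t \<in> D"
    then have "k \<otimes> ?t \<otimes> inv k \<in> D" using normal_conj[OF D_normal kc] by blast
    then show False using conj_inv_cancel2[OF kc c(2)] tu(3) by simp
  qed
  \<comment> \<open>As \<open>z\<close> centralizes \<open>C\<close>, conjugation by
    \<open>w0\<close> and by \<open>z w0\<close> agree on \<open>C\<close>, so \<open>?M\<close> is
    invariant under \<open>w0\<close>.\<close>
  let ?M = "?H \<inter> C"
  have M: "subgroup ?M G" using H'(1) C_sub by (rule subgroups_Inter_pair)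
  have i1: "w0 \<otimes> m \<otimes> inv w0 \<in> ?M" if m: "m \<in> ?M" for m
  proof -
    have mC: "m \<in> C" and mc: "m \<in> carrier G" using m Cc by auto
    have mC': "w0 \<otimes> m \<otimes> inv w0 \<in> C" using normal_conj[OF C_normal w0(1) mC] .
    have "(z \<otimes> w0) \<otimes> m \<otimes> inv (z \<otimes> w0) = z \<otimes> (w0 \<otimes> m \<otimes> inv w0) \<otimes> inv z"
      using conj_conj[OF zc w0(1) mc] by simp
    also have "\<dots> = w0 \<otimes> m \<otimes> inv w0" using conj_eq_self_iff[OF zc Cc[OF mC']] D_commute[OF z mC'] by blast
    finally have "w0 \<otimes> m \<otimes> inv w0 = (z \<otimes> w0) \<otimes> m \<otimes> inv (z \<otimes> w0)" by simp
    moreover have "(z \<otimes> w0) \<otimes> m \<otimes> inv (z \<otimes> w0) \<in> ?H"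
      by (intro subgroup.m_closed[OF H'(1)] subgroup.m_inv_closed[OF H'(1)] zw IntD1[OF m])
    ultimately show ?thesis using mC' by simp
  qed
  have i2: "inv w0 \<otimes> m \<otimes> w0 \<in> ?M" if m: "m \<in> ?M" for m
  proof -
    have mC: "m \<in> C" and mc: "m \<in> carrier G" using m Cc by auto
    have mC': "inv w0 \<otimes> m \<otimes> w0 \<in> C" using normal_conj[OF C_normal inv_closed[OF w0(1)] mC] w0 by simp
    have zm: "inv z \<otimes> m \<otimes> z = m"
      using D_commute[OF subgroup.m_inv_closed[OF D_sub z] mC] zc mc by (simp add: m_assoc)
    have "inv (z \<otimes> w0) \<otimes> m \<otimes> (z \<otimes> w0) = inv w0 \<otimes> (inv z \<otimes> m \<otimes> z) \<otimes> w0"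
      using zc w0 mc by (simp add: inv_mult_group m_assoc)
    then have "inv w0 \<otimes> m \<otimes> w0 = inv (z \<otimes> w0) \<otimes> m \<otimes> (z \<otimes> w0)" unfolding zm by simp
    moreover have "inv (z \<otimes> w0) \<otimes> m \<otimes> (z \<otimes> w0) \<in> ?H"
      by (intro subgroup.m_closed[OF H'(1)] subgroup.m_inv_closed[OF H'(1)] zw IntD1[OF m])
    ultimately show ?thesis using mC' by simp
  qed
  have tM: "?t \<in> ?M" using tH tC by blast
  \<comment> \<open>A central \<open>z\<close> has to be corrected: some \<open>n \<in> N\<close>
    does not commute with \<open>w0\<close>, and \<open>C = ?M Z\<close> supplies a central multiple
    \<open>m\<close> of \<open>n\<close> inside \<open>?H\<close>.\<close>
  have "\<exists>z'\<in>D. z' \<notin> center G \<and> z' \<otimes> w0 \<in> ?H"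
  proof (cases "z \<in> center G")
    case False
    then show ?thesis using z zw by blast
  next
    case True
    obtain n where n: "n \<in> N" "n \<notin> centralizer G {w0}" using outside_C[OF w0] by blast
    obtain m y where m: "m \<in> ?M" "y \<in> center G" "n = m \<otimes> y"
      using generated_by_invariant[OF M _ tM tD i1 i2, of n] n N_C by blast
    have mc: "m \<in> carrier G" using m Cc by blast
    have mD: "m \<in> D" using subgroup_mult_cancel_right[OF D_sub mc, of y] m n N_D Z_D by blast
    have nz: "n \<notin> center G" using n center_subset_centralizer[of "{w0}"] w0 by blast
    have mz: "m \<notin> center G" using nz m subgroup.m_closed[OF subgroup_center] by blast
    have "m \<otimes> z \<in> D" using subgroup.m_closed[OF D_sub mD z] .
    moreover have "m \<otimes> z \<notin> center G" using subgroup_mult_cancel_right[OF subgroup_center mc True] mz by blast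
    moreover have "m \<otimes> z \<otimes> w0 \<in> ?H"
      using subgroup.m_closed[OF H'(1) _ zw, of m] m(1) mc zc w0 by (simp add: m_assoc)
    ultimately show ?thesis by blast
  qed
  then obtain z' where z': "z' \<in> D" "z' \<notin> center G" "z' \<otimes> w0 \<in> ?H" by blast
  have z'c: "z' \<in> carrier G" using z' Cc D_C by blast
  \<comment> \<open>Otherwise the centralizer \<open>?L\<close> of \<open>?M\<close> in
    \<open>C\<close> is invariant under \<open>w0\<close> and contains \<open>t0\<close>; then
    \<open>C = ?L Z\<close> centralizes \<open>?t\<close>, which lies outside of
    \<open>D\<close>.\<close>
  have "\<exists>s\<in>?M. s \<otimes> t0 \<noteq> t0 \<otimes> s"
  proof (rule ccontr)
    assume "\<not> ?thesis"
    then have all: "t0 \<in> centralizer G ?M" using c unfolding mem_centralizer_iff by metis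
    have Mc: "?M \<subseteq> carrier G" using Cc by blast
    let ?L = "C \<inter> centralizer G ?M"
    have L: "subgroup ?L G" using C_sub subgroup_centralizer[OF Mc] by (rule subgroups_Inter_pair)
    have l1: "w0 \<otimes> m \<otimes> inv w0 \<in> ?L" if m: "m \<in> ?L" for m
    proof -
      have mC: "m \<in> C" and mc: "m \<in> carrier G" using m Cc by auto
      have "(w0 \<otimes> m \<otimes> inv w0) \<otimes> s = s \<otimes> (w0 \<otimes> m \<otimes> inv w0)" if s: "s \<in> ?M" for s
      proof -
        have "m \<otimes> (inv w0 \<otimes> s \<otimes> w0) = (inv w0 \<otimes> s \<otimes> w0) \<otimes> m"
          using i2[OF s] m unfolding Int_iff[of m] mem_centralizer_iff by blast
        then show ?thesis using conj_in_centralizer_iff[OF w0(1) mc, of s] s Mc by blast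
      qed
      then show ?thesis using normal_conj[OF C_normal w0(1) mC] Cc unfolding Int_iff[of "_ \<otimes> _"] mem_centralizer_iff by blast
    qed
    have l2: "inv w0 \<otimes> m \<otimes> w0 \<in> ?L" if m: "m \<in> ?L" for m
    proof -
      have mC: "m \<in> C" and mc: "m \<in> carrier G" using m Cc by auto
      have "(inv w0 \<otimes> m \<otimes> w0) \<otimes> s = s \<otimes> (inv w0 \<otimes> m \<otimes> w0)" if s: "s \<in> ?M" for s
      proof -
        have "m \<otimes> (w0 \<otimes> s \<otimes> inv w0) = (w0 \<otimes> s \<otimes> inv w0) \<otimes> m"
          using i1[OF s] m unfolding Int_iff[of m] mem_centralizer_iff by blast
        moreover have "s \<in> carrier G" using s Mc by blast
        ultimately show ?thesis using conj_in_centralizer_iff[OF inv_closed[OF w0(1)] mc, of s] w0 by simp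
      qed
      moreover have "inv w0 \<otimes> m \<otimes> w0 \<in> C" using normal_conj[OF C_normal inv_closed[OF w0(1)] mC] w0 by simp
      ultimately show ?thesis using Cc unfolding Int_iff[of "_ \<otimes> _"] mem_centralizer_iff by blast
    qed
    have "C \<subseteq> centralizer G {?t}"
    proof
      fix x assume x: "x \<in> C"
      have "t0 \<in> ?L" using all t0(1) by blast
      then obtain m y where m: "m \<in> ?L" "y \<in> center G" "x = m \<otimes> y"
        using generated_by_invariant[OF L _ _ t0(2) l1 l2 x] by blast
      have tc: "?t \<in> carrier G" using Cc tC by blast
      have "m \<in> centralizer G {?t}" using m(1) tM Cc by (auto simp: mem_centralizer_iff)
      then show "x \<in> centralizer G {?t}"
        using m subgroup.m_closed[OF subgroup_centralizer1[OF tc]] center_subset_centralizer[of "{?t}"] tc by blast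
    qed
    then show False using not_D[OF tC tD] by blast
  qed
  then obtain s where s: "s \<in> ?H" "s \<in> C" "s \<otimes> t0 \<noteq> t0 \<otimes> s" by blast
  have sD: "s \<notin> D" using not_D_if_noncommuting[OF s(2) t0(1) s(3)] .
  have sc: "s \<in> carrier G" using Cc s by blast
  have 1: "adjacent G t0 s" using normal_proper_adjacent[OF C_normal C_proper t0(1) s(2)] s(3) by metis
  have "z' \<in> centralizer G {s}" using D_commute[OF z'(1) s(2)] z'c by (simp add: mem_centralizer1_iff)
  then have "z' \<otimes> w0 \<notin> centralizer G {s}"
    using subgroup_mult_cancel_left[OF subgroup_centralizer1[OF sc] w0(1)] T_no_commute[OF s(2) sD]
    by (auto simp: mem_centralizer1_iff)
  then have 2: "adjacent G s (z' \<otimes> w0)"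
    using adjacentI[OF H' s(1) z'(3)] z'c w0 by (auto simp: mem_centralizer1_iff)
  obtain K where K: "subgroup K G" "K \<noteq> carrier G" "z' \<in> K" "w0 \<in> K"
    using adjacent_D_outside[OF z'(1,2) w0] by (rule adjacentE)
  have "z' \<otimes> w0 \<notin> centralizer G {w0}"
    using subgroup_mult_cancel_right[OF subgroup_centralizer1[OF w0(1)] z'c, of w0] D_no_commute[OF z'(1,2) w0] w0
    by (simp add: mem_centralizer1_iff)
  then have 3: "adjacent G (z' \<otimes> w0) w0"
    using adjacentI[OF K(1,2) subgroup.m_closed[OF K(1,3,4)] K(4)] z'c w0 by (simp add: mem_centralizer1_iff)
  show ?thesis using reach_3[of "adjacent G", OF 1 2 3] .
qed

end

lemma reach_3_finite:
  assumes fin: "finite (carrier G)" and tu: "adjacent G t u" "t \<in> C" "t \<notin> D" "u \<notin> C"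
    and x: "x \<in> carrier G" "x \<notin> center G" and y: "y \<in> carrier G" "y \<notin> center G"
  shows "reach (adjacent G) 3 x y"
proof -
  have up: "reach (adjacent G) 2 u v \<Longrightarrow> reach (adjacent G) 3 u v" for u v
    by (rule reach_mono) auto
  have TO: "reach (adjacent G) 3 t0 w" if t0: "t0 \<in> C" "t0 \<notin> D" and w: "w \<in> carrier G" "w \<notin> C" for t0 w
  proof (cases "\<exists>m. m \<in> C \<and> m \<notin> D \<and> adjacent G m w")
    case True
    then obtain m where m: "m \<in> C" "m \<notin> D" "adjacent G m w" by blast
    have "reach (adjacent G) (2 + 1) t0 w"
      by (rule reach_append[OF reach_2_T[OF t0 m(1,2)]]) (use m(3) in auto)
    then show ?thesis by simp
  next
    case False
    then show ?thesis using reach_3_no_neighbour[OF w _ fin tu t0] by blast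
  qed
  have TD: "reach (adjacent G) 3 t0 d" if t0: "t0 \<in> C" "t0 \<notin> D" and d: "d \<in> D" "d \<notin> center G" for t0 d
  proof (rule neighbour_with_edge[OF tu t0])
    fix w assume w: "w \<notin> C" "adjacent G t0 w"
    have "adjacent G w d" using adjacent_D_outside[OF d _ w(1)] adjacent_carrier[OF w(2)] adjacent_sym by blast
    then show ?thesis using reach_2[of "adjacent G" t0 w d] w up by blast
  next
    fix t1 w assume w: "t1 \<in> C" "adjacent G t0 t1" "w \<notin> C" "adjacent G t1 w"
    have "adjacent G w d" using adjacent_D_outside[OF d _ w(3)] adjacent_carrier[OF w(4)] adjacent_sym by blast
    then show ?thesis using reach_3[of "adjacent G" t0 t1 w d] w by blast
  qed
  have TU: "reach (adjacent G) 3 t0 v" if "t0 \<in> C - D" "v \<in> carrier G" "v \<notin> center G" "v \<notin> C - D" for t0 v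
    using TO TD that by blast
  consider "x \<in> C - D" "y \<in> C - D" | "x \<in> C - D" "y \<notin> C - D" | "x \<notin> C - D" "y \<in> C - D" | "x \<notin> C - D" "y \<notin> C - D" by blast
  then show ?thesis
  proof cases
    case 1
    then show ?thesis using up reach_2_T by blast
  next
    case 4
    then show ?thesis using up reach_2_U x y by blast
  qed (use TU x y reach_adjacent_sym in blast)+
qed

end

context noncyclic_quotient
begin

text \<open>The second alternative compares only vertices with a neighbour, since isolated ones can
  occur there; it arises for abelian \<open>C\<close> of prime index, hence the solvability.\<close>

theorem distance_cases:
  shows "(\<forall>x\<in>carrier G - center G. \<forall>y\<in>carrier G - center G. reach (adjacent G) 3 x y)
    \<or> ((\<forall>x x' y y'. adjacent G x x' \<longrightarrow> adjacent G y y' \<longrightarrow> reach (adjacent G) 2 x y) \<and> solvable G)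
    \<or> ((\<forall>x\<in>carrier G - center G. \<forall>y\<in>carrier G - center G. reach (adjacent G) 4 x y) \<and> infinite (carrier G))
    \<or> (\<exists>T U. T \<union> U = carrier G - center G \<and> T \<inter> U = {}
        \<and> (\<exists>x\<in>T. \<exists>y\<in>T. adjacent G x y) \<and> (\<exists>x\<in>U. \<exists>y\<in>U. adjacent G x y)
        \<and> (\<forall>x\<in>T. \<forall>y\<in>U. \<not> adjacent G x y)
        \<and> (\<forall>x\<in>T. \<forall>y\<in>T. reach (adjacent G) 2 x y) \<and> (\<forall>x\<in>U. \<forall>y\<in>U. reach (adjacent G) 2 x y))"
    (is "?A \<or> ?B \<or> ?E \<or> ?F")
proof (cases "cyclic_mod G C")
  case False
  have ?A using reach_3_if_C_noncyclic[OF False] by blast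
  then show ?thesis by (rule disjI1)
next
  case True
  interpret cyclic_centralizer G N by unfold_locales (rule True)
  show ?thesis
  proof (cases "\<forall>x\<in>C. \<forall>y\<in>C. x \<otimes> y = y \<otimes> x")
    case ab: True
    show ?thesis
    proof (cases "\<forall>w\<in>carrier G - C. cyclic_extension G C w = carrier G")
      case p: True
      interpret A: abelian_frobenius_like G C using abelian_frobenius_like_if_prime p ab by blast
      have "solvable G" using solvable_if_C_abelian ab by blast
      then have ?B using A.reach_2_not_isolated by blast
      then show ?thesis by (intro disjI2 disjI1)
    next
      case False
      then obtain w where w: "w \<in> carrier G" "w \<notin> C" "cyclic_extension G C w \<noteq> carrier G" by blast
      have ?A using reach_3_abelian_nonprime[OF w] ab by blast
      then show ?thesis by (rule disjI1)
    qed
  next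
    case nonab: False
    interpret nonabelian_centralizer G N by unfold_locales (use nonab in blast)
    show ?thesis
    proof (cases "\<forall>w\<in>carrier G - C. cyclic_extension G C w = carrier G")
      case False
      then obtain w where w: "w \<in> carrier G" "w \<notin> C" "cyclic_extension G C w \<noteq> carrier G" by blast
      have ?A using reach_3_nonabelian_nonprime[OF w] by blast
      then show ?thesis by (rule disjI1)
    next
      case p: True
      interpret prime_nonabelian_centralizer G N by unfold_locales (use p in blast)
      show ?thesis
      proof (cases "\<exists>t u. adjacent G t u \<and> t \<in> C \<and> t \<notin> D \<and> u \<notin> C")
        case True
        then obtain t u where tu: "adjacent G t u" "t \<in> C" "t \<notin> D" "u \<notin> C" by blast
        show ?thesis
        proof (cases "finite (carrier G)")
          case fin: True
          have ?A using reach_3_finite[OF fin tu] by blast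
          then show ?thesis by (rule disjI1)
        next
          case False
          then have ?E using reach_4[OF tu] by blast
          then show ?thesis by (intro disjI2 disjI1)
        qed
      next
        case False
        let ?T = "C - D" and ?U = "carrier G - center G - (C - D)"
        have "?T \<union> ?U = carrier G - center G" using Cc Z_D by blast
        moreover have "\<exists>x\<in>?T. \<exists>y\<in>?T. adjacent G x y"
        proof -
          obtain x y where xy: "x \<in> C" "y \<in> C" "x \<otimes> y \<noteq> y \<otimes> x" using nonabelian by blast
          then have "x \<notin> D" "y \<notin> D" using D_commute[of x y] D_commute[of y x] by auto
          then show ?thesis using normal_proper_adjacent[OF C_normal C_proper xy] xy by blast
        qed
        moreover have "\<exists>x\<in>?U. \<exists>y\<in>?U. adjacent G x y"
        proof -
          obtain y where y: "y \<in> D" "y \<notin> center G" using N_D N(2) by blast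
          obtain w where w: "w \<in> carrier G" "w \<notin> C" using C_proper Cc by blast
          have a: "adjacent G y w" using adjacent_D_outside[OF y w] .
          then show ?thesis using adjacent_carrier[OF a] adjacent_not_center[OF a] y w by blast
        qed
        moreover have "\<forall>x\<in>?T. \<forall>y\<in>?U. \<not> adjacent G x y" using False edge_from_T by blast
        moreover have "\<forall>x\<in>?T. \<forall>y\<in>?T. reach (adjacent G) 2 x y" using reach_2_T by blast
        moreover have "\<forall>x\<in>?U. \<forall>y\<in>?U. reach (adjacent G) 2 x y" using reach_2_U by blast
        moreover have "?T \<inter> ?U = {}" by blast
        ultimately have ?F by (intro exI[of _ ?T] exI[of _ ?U] conjI)
        then show ?thesis by (intro disjI2)
      qed
    qed
  qed
qed

end

section \<open>Complex matrices\<close>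

definition mat_trace :: "complex mat \<Rightarrow> complex" where
  "mat_trace A = (\<Sum>i<dim_row A. A $$ (i, i))"

lemma mult_mat_entry:
  assumes "A \<in> carrier_mat n m" "B \<in> carrier_mat m p" "i < n" "j < p"
  shows "(A * B) $$ (i, j) = (\<Sum>k<m. A $$ (i, k) * B $$ (k, j))"
  using assms by (auto simp: scalar_prod_def lessThan_atLeast0 intro!: sum.cong)

lemma mat_trace_carrier: "A \<in> carrier_mat n n \<Longrightarrow> mat_trace A = (\<Sum>i<n. A $$ (i, i))"
  by (auto simp: mat_trace_def)

lemma mat_trace_comm:
  assumes A: "A \<in> carrier_mat n m" and B: "B \<in> carrier_mat m n"
  shows "mat_trace (A * B) = mat_trace (B * A)"
proof -
  have "mat_trace (A * B) = (\<Sum>i<n. \<Sum>k<m. A $$ (i, k) * B $$ (k, i))"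
    using mat_trace_carrier[of "A * B" n] mult_mat_entry[OF A B] A B by simp
  also have "\<dots> = (\<Sum>k<m. \<Sum>i<n. B $$ (k, i) * A $$ (i, k))"
    by (subst sum.swap) (simp add: mult.commute)
  also have "\<dots> = mat_trace (B * A)"
    using mat_trace_carrier[of "B * A" m] mult_mat_entry[OF B A] A B by simp
  finally show ?thesis .
qed

lemma mat_trace_similar:
  assumes "similar_mat_wit A B P Q" "A \<in> carrier_mat n n"
  shows "mat_trace A = mat_trace B"
proof -
  note D = similar_mat_witD2[OF assms(2,1)]
  have "mat_trace A = mat_trace ((P * B) * Q)" using D by simp
  also have "\<dots> = mat_trace (Q * (P * B))" using D by (intro mat_trace_comm[of _ n n]) auto
  also have "Q * (P * B) = (Q * P) * B" using D by (intro assoc_mult_mat[symmetric]) auto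
  also have "\<dots> = B" using D by simp
  finally show ?thesis .
qed

lemma upper_triangular_mult:
  assumes A: "A \<in> carrier_mat n n" "upper_triangular A" and B: "B \<in> carrier_mat n n" "upper_triangular B"
  shows "upper_triangular (A * B)" "\<And>i. i < n \<Longrightarrow> (A * B) $$ (i, i) = A $$ (i, i) * B $$ (i, i)"
proof -
  have 0: "A $$ (i, k) * B $$ (k, j) = 0" if "i < n" "k < n" "k < i \<or> j < k" for i j k
    using upper_triangularD[OF A(2), of k i] upper_triangularD[OF B(2), of j k] that A B by auto
  show "upper_triangular (A * B)"
  proof (rule upper_triangularI)
    fix i j assume "j < i" "i < dim_row (A * B)"
    then have ij: "j < i" "i < n" using A by auto
    have "(\<Sum>k<n. A $$ (i, k) * B $$ (k, j)) = 0"
    proof (rule sum.neutral, rule ballI)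
      fix k assume "k \<in> {..<n}"
      moreover have "k < i \<or> j < k" using ij by linarith
      ultimately show "A $$ (i, k) * B $$ (k, j) = 0" using 0[OF ij(2), of k j] by simp
    qed
    then show "(A * B) $$ (i, j) = 0" using mult_mat_entry[OF A(1) B(1) ij(2), of j] ij by simp
  qed
  fix i assume i: "i < n"
  have "(\<Sum>k<n. A $$ (i, k) * B $$ (k, i)) = (\<Sum>k\<in>{i}. A $$ (i, k) * B $$ (k, i))"
    by (rule sum.mono_neutral_right) (use i 0[OF i] in \<open>auto simp: neq_iff\<close>)
  then show "(A * B) $$ (i, i) = A $$ (i, i) * B $$ (i, i)"
    using mult_mat_entry[OF A(1) B(1) i i] by simp
qed

lemma upper_triangular_pow:
  assumes B: "B \<in> carrier_mat n n" "upper_triangular B"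
  shows "upper_triangular (B ^\<^sub>m k) \<and> (\<forall>i<n. (B ^\<^sub>m k) $$ (i, i) = (B $$ (i, i)) ^ k)"
proof (induction k)
  case 0
  then show ?case using B by (auto simp: upper_triangular_def)
next
  case (Suc k)
  have "B ^\<^sub>m k \<in> carrier_mat n n" using B by simp
  then show ?case using upper_triangular_mult[OF _ conjunct1[OF Suc] B] Suc by (simp add: power_commutes)
qed

lemma exists_triangular:
  fixes A :: "complex mat"
  assumes A: "A \<in> carrier_mat n n"
  obtains B P Q where "B \<in> carrier_mat n n" "upper_triangular B" "similar_mat_wit A B P Q"
proof -
  obtain as where "char_poly A = (\<Prod>a\<leftarrow>as. [:- a, 1:])" using char_poly_factorized[OF A] by blast
  then show ?thesis using schur_decomposition_exists[OF A] that unfolding similar_mat_def by blast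
qed

lemma similar_pow:
  assumes "similar_mat_wit A B P Q" "A \<in> carrier_mat n n"
  shows "similar_mat_wit (A ^\<^sub>m k) (B ^\<^sub>m k) P Q"
  using assms similar_mat_wit_pow by blast

text \<open>The eigenvalues, visible on the diagonal of a triangular form, are roots of unity, whose
  inverses are their conjugates; and \<open>A^s\<close> is the inverse of \<open>A\<close>.\<close>

lemma trace_power_cnj:
  fixes A :: "complex mat"
  assumes A: "A \<in> carrier_mat n n" and s: "A ^\<^sub>m (Suc s) = 1\<^sub>m n"
  shows "mat_trace (A ^\<^sub>m s) = cnj (mat_trace A)"
proof -
  obtain B P Q where B: "B \<in> carrier_mat n n" "upper_triangular B" "similar_mat_wit A B P Q"
    using exists_triangular[OF A] .
  note ut = upper_triangular_pow[OF B(1,2)]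
  have Ak: "A ^\<^sub>m k \<in> carrier_mat n n" "B ^\<^sub>m k \<in> carrier_mat n n" for k using A B by auto
  note D = similar_mat_witD2[OF Ak(1)[of "Suc s"] similar_pow[OF B(3) A]]
  have "B ^\<^sub>m (Suc s) = Q * (A ^\<^sub>m (Suc s)) * P"
    using similar_mat_witD2(3)[OF Ak(2)[of "Suc s"] similar_mat_wit_sym[OF similar_pow[OF B(3) A]]] by simp
  then have "B ^\<^sub>m (Suc s) = 1\<^sub>m n" unfolding s using D(2,6,7) by simp
  then have e1: "(B $$ (i, i)) ^ Suc s = 1" if "i < n" for i
    using ut[of "Suc s"] that by (metis index_one_mat(1))
  have e: "(B $$ (i, i)) ^ s = cnj (B $$ (i, i))" if "i < n" for i
  proof -
    let ?e = "B $$ (i, i)"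
    have "norm ?e ^ Suc s = 1" using e1[OF that] by (metis norm_one norm_power)
    then have "norm ?e = 1" using power_eq_imp_eq_base[of "norm ?e" "Suc s" 1] by simp
    then have "cnj ?e * ?e = 1" using complex_norm_square[of ?e] by (simp add: mult.commute)
    moreover have "?e ^ s * ?e = 1" using e1[OF that] by (simp add: mult.commute)
    moreover have "?e \<noteq> 0" using \<open>norm ?e = 1\<close> by auto
    ultimately show ?thesis by (metis mult_right_cancel)
  qed
  have "mat_trace (A ^\<^sub>m s) = mat_trace (B ^\<^sub>m s)"
    using mat_trace_similar[OF similar_pow[OF B(3) A] Ak(1)] .
  also have "\<dots> = (\<Sum>i<n. cnj (B $$ (i, i)))"
    using mat_trace_carrier[OF Ak(2)] ut e by simp
  also have "\<dots> = cnj (mat_trace B)" using mat_trace_carrier[OF B(1)] by simp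
  also have "\<dots> = cnj (mat_trace A)" using mat_trace_similar[OF B(3) A] by simp
  finally show ?thesis .
qed

text \<open>The diagonal entries of a triangular form are \<open>0\<close> or \<open>1\<close>, and
  the trace counts the ones. If there are none, a nonzero column of \<open>A\<close> would be an
  eigenvector for the eigenvalue \<open>1\<close>.\<close>

lemma idempotent_trace:
  fixes A :: "complex mat"
  assumes A: "A \<in> carrier_mat n n" and idem: "A * A = A"
  shows "mat_trace A \<in> \<nat>" "mat_trace A = 0 \<Longrightarrow> A = 0\<^sub>m n n"
proof -
  obtain B P Q where B: "B \<in> carrier_mat n n" "upper_triangular B" "similar_mat_wit A B P Q"
    using exists_triangular[OF A] .
  have A2: "A ^\<^sub>m 2 = A" using A idem by (simp add: numeral_2_eq_2)
  have "B ^\<^sub>m 2 = Q * (A ^\<^sub>m 2) * P"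
    using similar_mat_witD2(3)[OF pow_carrier_mat[OF B(1), of 2] similar_mat_wit_sym[OF similar_pow[OF B(3) A]]] by simp
  also have "\<dots> = B" using similar_mat_witD2(3)[OF B(1) similar_mat_wit_sym[OF B(3)]] A2 by simp
  finally have "B ^\<^sub>m 2 = B" .
  then have e2: "(B $$ (i, i)) ^ 2 = B $$ (i, i)" if "i < n" for i
    using upper_triangular_pow[OF B(1,2), of 2] that by metis
  have e: "B $$ (i, i) = 0 \<or> B $$ (i, i) = 1" if "i < n" for i
    using e2[OF that] by (simp add: power2_eq_square)
  have tr: "mat_trace A = (\<Sum>i<n. B $$ (i, i))"
    using mat_trace_similar[OF B(3) A] mat_trace_carrier[OF B(1)] by simp
  also have "\<dots> = (\<Sum>i<n. if B $$ (i, i) = 1 then 1 else 0)"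
    by (rule sum.cong) (use e in auto)
  also have "\<dots> = of_nat (card {i \<in> {..<n}. B $$ (i, i) = 1})"
    by (simp flip: sum.inter_filter)
  finally have tc: "mat_trace A = of_nat (card {i \<in> {..<n}. B $$ (i, i) = 1})" .
  then show "mat_trace A \<in> \<nat>" by simp
  assume "mat_trace A = 0"
  then have "card {i \<in> {..<n}. B $$ (i, i) = 1} = 0" using tc by (metis of_nat_eq_0_iff)
  then have no1: "B $$ (i, i) \<noteq> 1" if "i < n" for i using that by auto
  show "A = 0\<^sub>m n n"
  proof (rule ccontr)
    assume "A \<noteq> 0\<^sub>m n n"
    then obtain i j where ij: "i < n" "j < n" "A $$ (i, j) \<noteq> 0" using A by (auto simp: mat_eq_iff)
    let ?v = "col A j"
    have "A *\<^sub>v ?v = col (A * A) j" using A ij by (intro eq_vecI) auto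
    then have "A *\<^sub>v ?v = 1 \<cdot>\<^sub>v ?v" using idem A by auto
    moreover have "?v \<noteq> 0\<^sub>v n" using ij A by (auto simp: vec_eq_iff)
    moreover have "?v \<in> carrier_vec n" using A ij by auto
    ultimately have "eigenvalue A 1" unfolding eigenvalue_def eigenvector_def using A by (intro exI[of _ ?v]) simp
    then have "poly (char_poly A) 1 = 0" using eigenvalue_root_char_poly[OF A] by simp
    moreover have "char_poly A = (\<Prod>a\<leftarrow>diag_mat B. [:- a, 1:])"
      using char_poly_similar[of A B] B char_poly_upper_triangular[OF B(1,2)] unfolding similar_mat_def by auto
    ultimately have "1 \<in> set (diag_mat B)"
      by (auto simp: poly_prod_list prod_list_zero_iff)
    then show False using no1 B(1) by (auto simp: diag_mat_def)
  qed
qed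

text \<open>The complementary projection has trace \<open>0\<close>, so it vanishes.\<close>

lemma idempotent_full_trace:
  fixes A :: "complex mat"
  assumes A: "A \<in> carrier_mat n n" and idem: "A * A = A" and tr: "mat_trace A = of_nat n"
  shows "A = 1\<^sub>m n"
proof -
  let ?B = "1\<^sub>m n - A"
  have B: "?B \<in> carrier_mat n n" by (rule minus_carrier_mat[OF A])
  have "?B * ?B = 1\<^sub>m n * ?B - A * ?B" by (rule minus_mult_distrib_mat[OF one_carrier_mat A B])
  also have "A * ?B = A * 1\<^sub>m n - A * A" by (rule mult_minus_distrib_mat[OF A one_carrier_mat A])
  also have "1\<^sub>m n * ?B - (A * 1\<^sub>m n - A * A) = ?B" using A B idem by (intro eq_matI) auto
  finally have "?B * ?B = ?B" .
  moreover have "mat_trace ?B = 0"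
    using mat_trace_carrier[OF B] mat_trace_carrier[OF A] tr A by (simp add: sum_subtractf)
  ultimately have "?B = 0\<^sub>m n n" using idempotent_trace(2)[OF B] by blast
  then have "?B $$ (i, j) = 0" if "i < n" "j < n" for i j using that by simp
  then show ?thesis using A by (intro eq_matI) force+
qed

text \<open>If \<open>B\<close> intertwines a representation with itself, conjugating with \<open>P\<close> makes the representation
  block triangular: its rows from \<open>r\<close> on act on the left kernel of \<open>B\<close>, which the columns \<open>f i\<close> detect.\<close>

lemma singular_row_echelon:
  fixes B :: "complex mat"
  assumes B: "B \<in> carrier_mat n n" and ne: "B \<noteq> 0\<^sub>m n n" and sing: "det B = 0"
  obtains P Q f r where "P \<in> carrier_mat n n" "Q \<in> carrier_mat n n" "P * Q = 1\<^sub>m n" "Q * P = 1\<^sub>m n"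
    "0 < r" "r < n" "\<And>i j. \<lbrakk>r \<le> i; i < n; j < n\<rbrakk> \<Longrightarrow> (P * B) $$ (i, j) = 0"
    "\<And>i. i < r \<Longrightarrow> f i < n" "\<And>i k. \<lbrakk>i < r; k < n\<rbrakk> \<Longrightarrow> (P * B) $$ (k, f i) = (if k = i then 1 else 0)"
proof -
  obtain C E where gj: "gauss_jordan B (1\<^sub>m n) = (C, E)" by (cases "gauss_jordan B (1\<^sub>m n)")
  obtain P where PU: "P \<in> Units (ring_mat TYPE(complex) n undefined)" and C: "C = P * B"
    using gauss_jordan_transform[OF B _ gj, of n undefined] by auto
  interpret m: ring "ring_mat TYPE(complex) n undefined" by (rule ring_mat)
  obtain Q where P: "P \<in> carrier_mat n n" "Q \<in> carrier_mat n n" "P * Q = 1\<^sub>m n" "Q * P = 1\<^sub>m n"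
    using PU unfolding Units_def by (auto simp: ring_mat_def)
  have Cc: "C \<in> carrier_mat n n" using C P B by simp
  have ech: "row_echelon_form C" by (rule gauss_jordan_row_echelon[OF B gj])
  then obtain f where f: "pivot_fun C f n" using Cc unfolding row_echelon_form_def by auto
  note pf = pivot_funD[OF carrier_matD(1)[OF Cc] f]
  have "C \<noteq> 1\<^sub>m n"
  proof
    assume "C = 1\<^sub>m n"
    then have "det P * det B = 1" using det_mult[OF P(1) B] C by simp
    then show False using sing by simp
  qed
  then have n: "n > 0" "row C (n - 1) = 0\<^sub>v n" using row_echelon_form_imp_1_or_0_row[OF Cc ech] by auto
  then have fl: "f (n - 1) = n" using pivot_fun_zero_row_iff[OF f Cc] by simp
  \<comment> \<open>The value \<open>n\<close> of the pivot function marks a zero row, so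
    \<open>r\<close> is the rank: below \<open>n\<close> by singularity, positive because
    \<open>B\<close> is nonzero.\<close>
  define r where "r = (LEAST i. f i = n)"
  have fr: "f r = n" unfolding r_def using fl by (rule LeastI)
  have rn: "r < n" unfolding r_def using Least_le[of "\<lambda>i. f i = n" "n - 1"] fl n by simp
  have small: "f i < n" if "i < r" for i
    using not_less_Least[of i "\<lambda>i. f i = n"] that pf(1)[of i] rn unfolding r_def by (metis le_neq_implies_less order.strict_trans r_def)
  have big: "f i = n" if "r \<le> i" "i < n" for i
    using that
  proof (induction rule: dec_induct)
    case (step i)
    then show ?case using pf(3)[of i] pf(1)[of "Suc i"] by auto
  qed (rule fr)
  have zero: "C $$ (i, j) = 0" if "r \<le> i" "i < n" "j < n" for i j
    using pf(2)[OF that(2)] big[OF that(1,2)] that(3) by simp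
  have "r > 0"
  proof (rule ccontr)
    assume "\<not> r > 0"
    then have "C = 0\<^sub>m n n" using zero Cc by (intro eq_matI) auto
    then have "Q * C = 0\<^sub>m n n" using P by simp
    moreover have "Q * C = (Q * P) * B" unfolding C using P B by (intro assoc_mult_mat[symmetric]) auto
    ultimately show False using ne P B by simp
  qed
  then show ?thesis
  proof (rule that[OF P _ rn, of f])
    show "(P * B) $$ (i, j) = 0" if "r \<le> i" "i < n" "j < n" for i j using zero[OF that] C by simp
    show "f i < n" if "i < r" for i using small[OF that] .
    show "(P * B) $$ (k, f i) = (if k = i then 1 else 0)" if "i < r" "k < n" for i k
      using pf(4)[of i] pf(5)[of i k] small[OF that(1)] that rn C by simp
  qed
qed

section \<open>Representations and characters\<close>

definition representation :: "('a, 'b) monoid_scheme \<Rightarrow> nat \<Rightarrow> ('a \<Rightarrow> complex mat) \<Rightarrow> bool" where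
  "representation G n \<rho> \<longleftrightarrow> (\<forall>g\<in>carrier G. \<rho> g \<in> carrier_mat n n) \<and> \<rho> \<one>\<^bsub>G\<^esub> = 1\<^sub>m n \<and>
     (\<forall>g\<in>carrier G. \<forall>h\<in>carrier G. \<rho> (g \<otimes>\<^bsub>G\<^esub> h) = \<rho> g * \<rho> h)"

definition character :: "('a \<Rightarrow> complex mat) \<Rightarrow> 'a \<Rightarrow> complex" where
  "character \<rho> g = mat_trace (\<rho> g)"

text \<open>Stands in for irreducibility, in the form given by Schur's lemma: it yields the norm of
  the character, and its failure splits the character.\<close>

definition scalar_commutant :: "('a, 'b) monoid_scheme \<Rightarrow> nat \<Rightarrow> ('a \<Rightarrow> complex mat) \<Rightarrow> bool" where
  "scalar_commutant G n \<rho> \<longleftrightarrow> (\<forall>A\<in>carrier_mat n n. (\<forall>g\<in>carrier G. A * \<rho> g = \<rho> g * A) \<longrightarrow>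
     (\<exists>c. A = c \<cdot>\<^sub>m 1\<^sub>m n))"

lemma representationD:
  assumes "representation G n \<rho>"
  shows "g \<in> carrier G \<Longrightarrow> \<rho> g \<in> carrier_mat n n" "\<rho> \<one>\<^bsub>G\<^esub> = 1\<^sub>m n"
    "\<lbrakk>g \<in> carrier G; h \<in> carrier G\<rbrakk> \<Longrightarrow> \<rho> (g \<otimes>\<^bsub>G\<^esub> h) = \<rho> g * \<rho> h"
  using assms by (auto simp: representation_def)

lemma sum_div_mod:
  fixes f :: "nat \<Rightarrow> nat \<Rightarrow> complex"
  shows "(\<Sum>k<m * n. f (k div n) (k mod n)) = (\<Sum>a<m. \<Sum>b<n. f a b)"
proof (cases "n = 0")
  case False
  have lt: "a * n + b < m * n" if "a < m" "b < n" for a b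
  proof -
    have "a * n + b < Suc a * n" using that by simp
    also have "\<dots> \<le> m * n" using that by (intro mult_right_mono) auto
    finally show ?thesis .
  qed
  have "(\<Sum>k<m * n. f (k div n) (k mod n)) = (\<Sum>(a, b)\<in>{..<m} \<times> {..<n}. f a b)"
    by (rule sum.reindex_bij_witness[of _ "\<lambda>(a, b). a * n + b" "\<lambda>k. (k div n, k mod n)"])
      (use False lt in \<open>auto simp: less_mult_imp_div_less\<close>)
  then show ?thesis by (simp add: sum.cartesian_product)
qed simp

definition kronecker :: "nat \<Rightarrow> nat \<Rightarrow> complex mat \<Rightarrow> complex mat \<Rightarrow> complex mat" where
  "kronecker m n A B = mat (m * n) (m * n) (\<lambda>(i, j). A $$ (i div n, j div n) * B $$ (i mod n, j mod n))"

lemma div_mod_less: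
  fixes i m n :: nat
  assumes "i < m * n"
  shows "i div n < m" "i mod n < n"
proof -
  show "i div n < m" using assms by (simp add: less_mult_imp_div_less)
  have "n \<noteq> 0" using assms by (cases n) auto
  then show "i mod n < n" by simp
qed

lemma kronecker_mult:
  assumes "A \<in> carrier_mat m m" "A' \<in> carrier_mat m m" "B \<in> carrier_mat n n" "B' \<in> carrier_mat n n"
  shows "kronecker m n (A * A') (B * B') = kronecker m n A B * kronecker m n A' B'"
proof (rule eq_matI)
  fix i j assume ij': "i < dim_row (kronecker m n A B * kronecker m n A' B')" "j < dim_col (kronecker m n A B * kronecker m n A' B')"
  then have ij: "i < m * n" "j < m * n" by (simp_all add: kronecker_def)
  have "kronecker m n (A * A') (B * B') $$ (i, j) = (A * A') $$ (i div n, j div n) * (B * B') $$ (i mod n, j mod n)"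
    using ij by (simp add: kronecker_def)
  also have "\<dots> = (\<Sum>a<m. A $$ (i div n, a) * A' $$ (a, j div n)) * (\<Sum>b<n. B $$ (i mod n, b) * B' $$ (b, j mod n))"
    using mult_mat_entry[OF assms(1,2) div_mod_less(1)[OF ij(1)] div_mod_less(1)[OF ij(2)]]
      mult_mat_entry[OF assms(3,4) div_mod_less(2)[OF ij(1)] div_mod_less(2)[OF ij(2)]] by simp
  also have "\<dots> = (\<Sum>a<m. \<Sum>b<n. (A $$ (i div n, a) * B $$ (i mod n, b)) * (A' $$ (a, j div n) * B' $$ (b, j mod n)))"
    by (simp add: sum_product mult_ac)
  also have "\<dots> = (\<Sum>k<m * n. (A $$ (i div n, k div n) * B $$ (i mod n, k mod n)) * (A' $$ (k div n, j div n) * B' $$ (k mod n, j mod n)))"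
    by (rule sum_div_mod[symmetric])
  also have "\<dots> = (\<Sum>k<m * n. kronecker m n A B $$ (i, k) * kronecker m n A' B' $$ (k, j))"
    using ij by (intro sum.cong) (auto simp: kronecker_def)
  also have "\<dots> = (kronecker m n A B * kronecker m n A' B') $$ (i, j)"
    using mult_mat_entry[of "kronecker m n A B" "m * n" "m * n" "kronecker m n A' B'" "m * n" i j] ij
    by (simp add: kronecker_def)
  finally show "kronecker m n (A * A') (B * B') $$ (i, j) = (kronecker m n A B * kronecker m n A' B') $$ (i, j)" .
qed (simp_all add: kronecker_def)

lemma kronecker_one: "kronecker m n (1\<^sub>m m) (1\<^sub>m n) = 1\<^sub>m (m * n)"
proof (rule eq_matI)
  fix i j assume "i < dim_row (1\<^sub>m (m * n))" "j < dim_col (1\<^sub>m (m * n))"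
  then have ij: "i < m * n" "j < m * n" by simp_all
  have "i = j \<longleftrightarrow> i div n = j div n \<and> i mod n = j mod n" by (metis div_mult_mod_eq)
  then show "kronecker m n (1\<^sub>m m) (1\<^sub>m n) $$ (i, j) = 1\<^sub>m (m * n) $$ (i, j)"
    using ij div_mod_less[OF ij(1)] div_mod_less[OF ij(2)] by (auto simp: kronecker_def)
qed (simp_all add: kronecker_def)

lemma kronecker_trace:
  assumes "A \<in> carrier_mat m m" "B \<in> carrier_mat n n"
  shows "mat_trace (kronecker m n A B) = mat_trace A * mat_trace B"
proof -
  have "mat_trace (kronecker m n A B) = (\<Sum>k<m * n. A $$ (k div n, k div n) * B $$ (k mod n, k mod n))"
    by (simp add: mat_trace_def kronecker_def)
  also have "\<dots> = (\<Sum>a<m. \<Sum>b<n. A $$ (a, a) * B $$ (b, b))" by (rule sum_div_mod)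
  also have "\<dots> = mat_trace A * mat_trace B"
    using mat_trace_carrier[OF assms(1)] mat_trace_carrier[OF assms(2)] by (simp add: sum_product)
  finally show ?thesis .
qed

context group
begin

lemma representation_kronecker:
  assumes "representation G m \<sigma>" "representation G n \<rho>"
  shows "representation G (m * n) (\<lambda>g. kronecker m n (\<sigma> g) (\<rho> g))"
  unfolding representation_def
  using representationD[OF assms(1)] representationD[OF assms(2)] kronecker_one kronecker_mult
  by (auto simp: kronecker_def[of m n "\<sigma> _"])

lemma representation_dual:
  assumes "representation G n \<rho>"
  shows "representation G n (\<lambda>g. transpose_mat (\<rho> (inv g)))"
  unfolding representation_def
proof (intro conjI ballI)
  note D = representationD[OF assms]
  show "transpose_mat (\<rho> (inv g)) \<in> carrier_mat n n" if "g \<in> carrier G" for g using D(1)[of "inv g"] that by simp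
  show "transpose_mat (\<rho> (inv \<one>)) = 1\<^sub>m n" using D(2) by simp
  fix g h assume g: "g \<in> carrier G" and h: "h \<in> carrier G"
  have "\<rho> (inv (g \<otimes> h)) = \<rho> (inv h) * \<rho> (inv g)" using D(3) g h by (simp add: inv_mult_group)
  then show "transpose_mat (\<rho> (inv (g \<otimes> h))) = transpose_mat (\<rho> (inv g)) * transpose_mat (\<rho> (inv h))"
    using transpose_mult[OF D(1) D(1), of "inv h" "inv g"] g h by simp
qed

lemma representation_pow:
  assumes "representation G n \<rho>" "g \<in> carrier G"
  shows "\<rho> (g [^] (k::nat)) = (\<rho> g) ^\<^sub>m k"
proof (induction k)
  case 0
  then show ?case using representationD[OF assms(1)] assms(2) by fastforce
next
  case (Suc k)
  then show ?case using representationD(3)[OF assms(1), of "g [^] k" g] assms(2) by simp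
qed

text \<open>With \<open>s + 1\<close> the order of the group, \<open>inv g = g^s\<close>, so
  \<open>trace_power_cnj\<close> applies.\<close>

lemma character_inv:
  assumes fin: "finite (carrier G)" and r: "representation G n \<rho>" and g: "g \<in> carrier G"
  shows "character \<rho> (inv g) = cnj (character \<rho> g)"
proof -
  have "card (carrier G) > 0" using fin card_gt_0_iff by auto
  then obtain s where s: "card (carrier G) = Suc s" using gr0_implies_Suc by blast
  have "g [^] Suc s = \<one>" using pow_order_eq_1[OF g] s by (simp add: Coset.order_def)
  then have "g [^] s \<otimes> g = \<one>" by simp
  then have i: "inv g = g [^] s" using g by (metis inv_equality nat_pow_closed)
  have "(\<rho> g) ^\<^sub>m Suc s = 1\<^sub>m n"
    using representation_pow[OF r g, of "Suc s"] \<open>g [^] Suc s = \<one>\<close> representationD(2)[OF r] by simp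
  then have "mat_trace ((\<rho> g) ^\<^sub>m s) = cnj (mat_trace (\<rho> g))"
    by (rule trace_power_cnj[OF representationD(1)[OF r g]])
  then show ?thesis unfolding character_def i representation_pow[OF r g] .
qed

lemma character_one: "representation G n \<rho> \<Longrightarrow> character \<rho> \<one> = of_nat n"
  by (simp add: character_def representationD(2) mat_trace_def)

lemma character_conj:
  assumes r: "representation G n \<rho>" and g: "g \<in> carrier G" and h: "h \<in> carrier G"
  shows "character \<rho> (h \<otimes> g \<otimes> inv h) = character \<rho> g"
proof -
  note D = representationD[OF r]
  have "character \<rho> (h \<otimes> g \<otimes> inv h) = mat_trace ((\<rho> h * \<rho> g) * \<rho> (inv h))"
    using D(3) g h by (simp add: character_def)
  also have "\<dots> = mat_trace (\<rho> (inv h) * (\<rho> h * \<rho> g))"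
    by (rule mat_trace_comm[OF mult_carrier_mat[OF D(1)[OF h] D(1)[OF g]] D(1)]) (use h in simp)
  also have "\<rho> (inv h) * (\<rho> h * \<rho> g) = \<rho> (inv h \<otimes> (h \<otimes> g))" using D(3) g h by simp
  also have "inv h \<otimes> (h \<otimes> g) = g" using g h by (simp flip: m_assoc)
  finally show ?thesis by (simp add: character_def)
qed

lemma sum_translate:
  assumes "h \<in> carrier G"
  shows "(\<Sum>g\<in>carrier G. f (h \<otimes> g)) = (\<Sum>g\<in>carrier G. f g)"
  by (rule sum.reindex_bij_witness[of _ "\<lambda>g. inv h \<otimes> g" "\<lambda>g. h \<otimes> g"])
    (use assms in \<open>auto simp flip: m_assoc\<close>)

text \<open>The average of \<open>\<rho>\<close> over the group is idempotent, so its trace is a natural number.\<close>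

lemma character_average:
  assumes fin: "finite (carrier G)" and r: "representation G n \<rho>"
  shows "(\<Sum>g\<in>carrier G. character \<rho> g) / of_nat (card (carrier G)) \<in> \<nat>"
    and "(\<Sum>g\<in>carrier G. character \<rho> g) = of_nat (card (carrier G) * n) \<Longrightarrow> g \<in> carrier G \<Longrightarrow> \<rho> g = 1\<^sub>m n"
proof -
  note D = representationD[OF r]
  have o: "(of_nat (card (carrier G)) :: complex) \<noteq> 0" using fin card_gt_0_iff by auto
  define P where "P = mat n n (\<lambda>(i, j). (\<Sum>g\<in>carrier G. \<rho> g $$ (i, j)) / of_nat (card (carrier G)))"
  have P: "P \<in> carrier_mat n n" by (simp add: P_def)
  have left: "\<rho> h * P = P" if h: "h \<in> carrier G" for h
  proof (rule eq_matI)
    fix i j assume "i < dim_row P" "j < dim_col P"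
    then have ij: "i < n" "j < n" using P by auto
    have "(\<rho> h * P) $$ (i, j) = (\<Sum>k<n. \<rho> h $$ (i, k) * ((\<Sum>g\<in>carrier G. \<rho> g $$ (k, j)) / of_nat (card (carrier G))))"
      using mult_mat_entry[OF D(1)[OF h] P ij] ij by (simp add: P_def)
    also have "\<dots> = (\<Sum>g\<in>carrier G. \<Sum>k<n. \<rho> h $$ (i, k) * \<rho> g $$ (k, j)) / of_nat (card (carrier G))"
      by (subst sum.swap) (simp add: sum_distrib_left sum_divide_distrib)
    also have "\<dots> = (\<Sum>g\<in>carrier G. \<rho> (h \<otimes> g) $$ (i, j)) / of_nat (card (carrier G))"
      using mult_mat_entry[OF D(1)[OF h] D(1) ij] D(3)[OF h] by simp
    also have "\<dots> = (\<Sum>g\<in>carrier G. \<rho> g $$ (i, j)) / of_nat (card (carrier G))"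
      using sum_translate[OF h, of "\<lambda>g. \<rho> g $$ (i, j)"] by simp
    finally show "(\<rho> h * P) $$ (i, j) = P $$ (i, j)" using ij by (simp add: P_def)
  qed (use D(1)[OF h] P in auto)
  have "P * P = P"
  proof (rule eq_matI)
    fix i j assume "i < dim_row P" "j < dim_col P"
    then have ij: "i < n" "j < n" using P by auto
    have "(P * P) $$ (i, j) = (\<Sum>k<n. (\<Sum>g\<in>carrier G. \<rho> g $$ (i, k)) / of_nat (card (carrier G)) * P $$ (k, j))"
      using mult_mat_entry[OF P P ij] ij by (simp add: P_def)
    also have "\<dots> = (\<Sum>g\<in>carrier G. \<Sum>k<n. \<rho> g $$ (i, k) * P $$ (k, j)) / of_nat (card (carrier G))"
      by (subst sum.swap) (simp add: sum_distrib_right sum_divide_distrib)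
    also have "\<dots> = (\<Sum>g\<in>carrier G. (\<rho> g * P) $$ (i, j)) / of_nat (card (carrier G))"
      using mult_mat_entry[OF D(1) P ij] by simp
    also have "\<dots> = P $$ (i, j)" using left o by simp
    finally show "(P * P) $$ (i, j) = P $$ (i, j)" .
  qed (use P in auto)
  note idem = idempotent_trace(1)[OF P this] idempotent_full_trace[OF P this]
  have "mat_trace P = (\<Sum>i<n. (\<Sum>g\<in>carrier G. \<rho> g $$ (i, i)) / of_nat (card (carrier G)))"
    using mat_trace_carrier[OF P] by (simp add: P_def)
  also have "\<dots> = (\<Sum>g\<in>carrier G. \<Sum>i<n. \<rho> g $$ (i, i)) / of_nat (card (carrier G))"
    by (subst sum.swap) (simp add: sum_divide_distrib)
  also have "\<dots> = (\<Sum>g\<in>carrier G. character \<rho> g) / of_nat (card (carrier G))"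
    using mat_trace_carrier[OF D(1)] by (simp add: character_def)
  finally have tr: "mat_trace P = (\<Sum>g\<in>carrier G. character \<rho> g) / of_nat (card (carrier G))" .
  then show "(\<Sum>g\<in>carrier G. character \<rho> g) / of_nat (card (carrier G)) \<in> \<nat>" using idem(1) by simp
  \<comment> \<open>Full trace makes the averaging projection \<open>P\<close> the identity, and
    \<open>\<rho> g * P = P\<close> then makes \<open>\<rho>\<close> trivial.\<close>
  assume "(\<Sum>g\<in>carrier G. character \<rho> g) = of_nat (card (carrier G) * n)" and g: "g \<in> carrier G"
  then have "mat_trace P = of_nat n" using tr o by simp
  then have "P = 1\<^sub>m n" by (rule idem(2))
  then show "\<rho> g = 1\<^sub>m n" using left[OF g] D(1)[OF g] by simp
qed

text \<open>The summand is the character of the dual of \<open>\<sigma>\<close> tensored with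
  \<open>\<rho>\<close>, so \<open>character_average\<close> applies.\<close>

lemma character_inner_product_Nats:
  assumes fin: "finite (carrier G)" and s: "representation G m \<sigma>" and r: "representation G n \<rho>"
  shows "(\<Sum>g\<in>carrier G. cnj (character \<sigma> g) * character \<rho> g) / of_nat (card (carrier G)) \<in> \<nat>"
proof -
  have "character (\<lambda>g. kronecker m n (transpose_mat (\<sigma> (inv g))) (\<rho> g)) g = cnj (character \<sigma> g) * character \<rho> g"
    if g: "g \<in> carrier G" for g
  proof -
    have "mat_trace (transpose_mat (\<sigma> (inv g))) = mat_trace (\<sigma> (inv g))"
      using representationD(1)[OF s, of "inv g"] g by (simp add: mat_trace_def)
    then show ?thesis
      using kronecker_trace[OF representationD(1)[OF representation_dual[OF s] g] representationD(1)[OF r g]]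
        character_inv[OF fin s g] by (simp add: character_def)
  qed
  then show ?thesis
    using character_average(1)[OF fin representation_kronecker[OF representation_dual[OF s] r]] by simp
qed

text \<open>Schur orthogonality: \<open>A j k\<close> sums the conjugates of the matrix unit at
  \<open>(j, k)\<close>, so it commutes with the representation and is scalar. Its trace shows that
  the scalar is the group order divided by \<open>n\<close> if \<open>j = k\<close>, and
  \<open>0\<close> otherwise.\<close>

lemma scalar_commutant_norm:
  assumes fin: "finite (carrier G)" and r: "representation G n \<rho>" and n: "n > 0" and sc: "scalar_commutant G n \<rho>"
  shows "(\<Sum>g\<in>carrier G. cnj (character \<rho> g) * character \<rho> g) = of_nat (card (carrier G))"
proof -
  note D = representationD[OF r]
  define A where "A j k = mat n n (\<lambda>(i, l). \<Sum>g\<in>carrier G. \<rho> g $$ (i, j) * \<rho> (inv g) $$ (k, l))" for j k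
  have Ac: "A j k \<in> carrier_mat n n" for j k by (simp add: A_def)
  have entry: "A j k $$ (i, l) = (if i = l \<and> j = k then of_nat (card (carrier G)) / of_nat n else 0)"
    if jk: "j < n" "k < n" and il: "i < n" "l < n" for i j k l
  proof -
    have "A j k * \<rho> h = \<rho> h * A j k" if h: "h \<in> carrier G" for h
    proof (rule eq_matI)
      fix a b assume "a < dim_row (\<rho> h * A j k)" "b < dim_col (\<rho> h * A j k)"
      then have ab: "a < n" "b < n" using D(1)[OF h] Ac[of j k] by auto
      have "(\<rho> h * A j k) $$ (a, b) = (\<Sum>p<n. \<rho> h $$ (a, p) * (\<Sum>g\<in>carrier G. \<rho> g $$ (p, j) * \<rho> (inv g) $$ (k, b)))"
        using mult_mat_entry[OF D(1)[OF h] Ac ab] ab by (simp add: A_def)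
      also have "\<dots> = (\<Sum>g\<in>carrier G. (\<Sum>p<n. \<rho> h $$ (a, p) * \<rho> g $$ (p, j)) * \<rho> (inv g) $$ (k, b))"
        unfolding sum_distrib_left sum_distrib_right by (subst sum.swap) (simp add: mult.assoc)
      also have "\<dots> = (\<Sum>g\<in>carrier G. \<rho> (h \<otimes> g) $$ (a, j) * \<rho> (inv (h \<otimes> g) \<otimes> h) $$ (k, b))"
        using mult_mat_entry[OF D(1)[OF h] D(1) ab(1) jk(1)] D(3)[OF h] h
        by (intro sum.cong) (simp_all add: inv_mult_group m_assoc)
      also have "\<dots> = (\<Sum>g\<in>carrier G. \<rho> g $$ (a, j) * \<rho> (inv g \<otimes> h) $$ (k, b))"
        by (rule sum_translate[OF h, of "\<lambda>g. \<rho> g $$ (a, j) * \<rho> (inv g \<otimes> h) $$ (k, b)"])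
      also have "\<dots> = (\<Sum>g\<in>carrier G. \<rho> g $$ (a, j) * (\<Sum>p<n. \<rho> (inv g) $$ (k, p) * \<rho> h $$ (p, b)))"
        using mult_mat_entry[OF D(1) D(1)[OF h] jk(2) ab(2)] D(3) h by (intro sum.cong) simp_all
      also have "\<dots> = (\<Sum>p<n. (\<Sum>g\<in>carrier G. \<rho> g $$ (a, j) * \<rho> (inv g) $$ (k, p)) * \<rho> h $$ (p, b))"
        unfolding sum_distrib_left sum_distrib_right by (subst sum.swap) (simp add: mult.assoc)
      also have "\<dots> = (A j k * \<rho> h) $$ (a, b)"
        using mult_mat_entry[OF Ac D(1)[OF h] ab] ab by (simp add: A_def)
      finally show "(A j k * \<rho> h) $$ (a, b) = (\<rho> h * A j k) $$ (a, b)" by simp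
    qed (use D(1)[OF h] Ac[of j k] in auto)
    then obtain c where c: "A j k = c \<cdot>\<^sub>m 1\<^sub>m n" using sc Ac unfolding scalar_commutant_def by blast
    have "of_nat n * c = mat_trace (A j k)" unfolding c by (simp add: mat_trace_def)
    also have "\<dots> = (\<Sum>i<n. \<Sum>g\<in>carrier G. \<rho> g $$ (i, j) * \<rho> (inv g) $$ (k, i))"
      using mat_trace_carrier[OF Ac] by (simp add: A_def)
    also have "\<dots> = (\<Sum>g\<in>carrier G. \<Sum>i<n. \<rho> (inv g) $$ (k, i) * \<rho> g $$ (i, j))"
      by (subst sum.swap) (simp add: mult.commute)
    also have "\<dots> = (\<Sum>g\<in>carrier G. (\<rho> (inv g \<otimes> g)) $$ (k, j))"
    proof (rule sum.cong)
      fix g assume g: "g \<in> carrier G"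
      have "\<rho> (inv g \<otimes> g) = \<rho> (inv g) * \<rho> g" by (rule D(3)[OF inv_closed[OF g] g])
      then show "(\<Sum>i<n. \<rho> (inv g) $$ (k, i) * \<rho> g $$ (i, j)) = \<rho> (inv g \<otimes> g) $$ (k, j)"
        using mult_mat_entry[OF D(1)[OF inv_closed[OF g]] D(1)[OF g] jk(2,1)] by simp
    qed simp
    also have "\<dots> = (\<Sum>g\<in>carrier G. if j = k then 1 else 0)"
      using D(2) jk by (intro sum.cong) auto
    finally have "of_nat n * c = (if j = k then of_nat (card (carrier G)) else 0)" by simp
    then have "c = (if j = k then of_nat (card (carrier G)) / of_nat n else 0)" using n by (auto simp: field_simps split: if_splits)
    then show ?thesis using il by (simp add: c)
  qed
  have "(\<Sum>g\<in>carrier G. cnj (character \<rho> g) * character \<rho> g) =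
      (\<Sum>g\<in>carrier G. \<Sum>i<n. \<Sum>k<n. \<rho> g $$ (i, i) * \<rho> (inv g) $$ (k, k))"
  proof (rule sum.cong)
    fix g assume g: "g \<in> carrier G"
    have "cnj (character \<rho> g) * character \<rho> g = character \<rho> g * character \<rho> (inv g)"
      using character_inv[OF fin r g] by (simp add: mult.commute)
    also have "\<dots> = (\<Sum>i<n. \<rho> g $$ (i, i)) * (\<Sum>k<n. \<rho> (inv g) $$ (k, k))"
      using mat_trace_carrier[OF D(1)] g by (simp add: character_def)
    finally show "cnj (character \<rho> g) * character \<rho> g = (\<Sum>i<n. \<Sum>k<n. \<rho> g $$ (i, i) * \<rho> (inv g) $$ (k, k))"
      by (simp add: sum_product)
  qed simp
  also have "\<dots> = (\<Sum>i<n. \<Sum>k<n. A i k $$ (i, k))"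
    by (subst sum.swap, rule sum.cong, simp, subst sum.swap, rule sum.cong) (simp_all add: A_def)
  also have "\<dots> = (\<Sum>i<n. \<Sum>k<n. if i = k then of_nat (card (carrier G)) / of_nat n else 0)"
    using entry by (intro sum.cong) auto
  also have "\<dots> = of_nat (card (carrier G))" using n by (simp add: sum.delta)
  finally show ?thesis .
qed

text \<open>A nonscalar matrix commuting with \<open>\<rho>\<close>, minus one of its eigenvalues,
  is singular and nonzero. The base change to its echelon form makes all \<open>\<rho> g\<close>
  block triangular; the diagonal blocks are representations, and the trace sees only them.\<close>

lemma split_representation:
  assumes r: "representation G n \<rho>" and n: "n > 0" and nsc: "\<not> scalar_commutant G n \<rho>"
  obtains n1 n2 \<rho>1 \<rho>2 where "n1 < n" "n2 < n" "n1 > 0" "n2 > 0" "representation G n1 \<rho>1" "representation G n2 \<rho>2"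
    "\<And>g. g \<in> carrier G \<Longrightarrow> character \<rho> g = character \<rho>1 g + character \<rho>2 g"
proof -
  note D = representationD[OF r]
  obtain A where A: "A \<in> carrier_mat n n" and com: "\<And>g. g \<in> carrier G \<Longrightarrow> A * \<rho> g = \<rho> g * A"
    and ns: "\<And>c. A \<noteq> c \<cdot>\<^sub>m 1\<^sub>m n" using nsc unfolding scalar_commutant_def by blast
  obtain c where "eigenvalue A c" using spectrum_non_empty[OF A n] unfolding spectrum_def by blast
  then have sing: "det (char_matrix A c) = 0" using eigenvalue_det[OF A] by simp
  define B where "B = char_matrix A c"
  have B: "B \<in> carrier_mat n n" unfolding B_def using A by simp
  have Be: "B = A + ((- c) \<cdot>\<^sub>m 1\<^sub>m n)" unfolding B_def char_matrix_def using A by simp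
  have "B \<noteq> 0\<^sub>m n n"
  proof
    assume 0: "B = 0\<^sub>m n n"
    have "A $$ (i, j) = (c \<cdot>\<^sub>m 1\<^sub>m n) $$ (i, j)" if "i < n" "j < n" for i j
      using arg_cong[OF 0, of "\<lambda>M. M $$ (i, j)"] that A unfolding Be by auto
    then have "A = c \<cdot>\<^sub>m 1\<^sub>m n" using A by (intro eq_matI) auto
    then show False using ns by blast
  qed
  have Bcom: "B * \<rho> g = \<rho> g * B" if g: "g \<in> carrier G" for g
  proof -
    have s: "(- c) \<cdot>\<^sub>m 1\<^sub>m n \<in> carrier_mat n n" by simp
    have "B * \<rho> g = A * \<rho> g + ((- c) \<cdot>\<^sub>m 1\<^sub>m n) * \<rho> g"
      unfolding Be by (rule add_mult_distrib_mat[OF A s D(1)[OF g]])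
    also have "((- c) \<cdot>\<^sub>m 1\<^sub>m n) * \<rho> g = (- c) \<cdot>\<^sub>m \<rho> g" using mult_smult_assoc_mat[of "1\<^sub>m n" n n "\<rho> g" n "- c"] D(1)[OF g] by simp
    also have "\<dots> = \<rho> g * ((- c) \<cdot>\<^sub>m 1\<^sub>m n)" using mult_smult_distrib[of "\<rho> g" n n "1\<^sub>m n" n "- c"] D(1)[OF g] by simp
    also have "A * \<rho> g + \<rho> g * ((- c) \<cdot>\<^sub>m 1\<^sub>m n) = \<rho> g * B"
      unfolding com[OF g] Be by (rule mult_add_distrib_mat[OF D(1)[OF g] A s, symmetric])
    finally show ?thesis .
  qed
  obtain P Q f m where PQ: "P \<in> carrier_mat n n" "Q \<in> carrier_mat n n" "P * Q = 1\<^sub>m n" "Q * P = 1\<^sub>m n"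
    and m: "0 < m" "m < n" and zero: "\<And>i j. \<lbrakk>m \<le> i; i < n; j < n\<rbrakk> \<Longrightarrow> (P * B) $$ (i, j) = 0"
    and f: "\<And>i. i < m \<Longrightarrow> f i < n" and piv: "\<And>i k. \<lbrakk>i < m; k < n\<rbrakk> \<Longrightarrow> (P * B) $$ (k, f i) = (if k = i then 1 else 0)"
    by (rule singular_row_echelon[OF B \<open>B \<noteq> 0\<^sub>m n n\<close> sing[folded B_def]]) blast
  define \<tau> where "\<tau> g = P * \<rho> g * Q" for g
  have \<tau>c: "\<tau> g \<in> carrier_mat n n" if "g \<in> carrier G" for g using PQ D(1)[OF that] by (simp add: \<tau>_def)
  have \<tau>m: "\<tau> (g \<otimes> h) = \<tau> g * \<tau> h" if g: "g \<in> carrier G" and h: "h \<in> carrier G" for g h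
  proof -
    have "\<tau> g * \<tau> h = P * \<rho> g * (Q * (P * \<rho> h * Q))"
      unfolding \<tau>_def using PQ D(1)[OF g] D(1)[OF h] by (intro assoc_mult_mat[of _ n n _ n _ n]) auto
    also have "Q * (P * \<rho> h * Q) = Q * P * \<rho> h * Q"
      using PQ(1,2) D(1)[OF h] by (simp add: assoc_mult_mat[of _ n n _ n _ n])
    also have "\<dots> = \<rho> h * Q" using PQ D(1)[OF h] by simp
    also have "P * \<rho> g * (\<rho> h * Q) = P * (\<rho> g * \<rho> h) * Q"
      using PQ(1,2) D(1)[OF g] D(1)[OF h] by (simp add: assoc_mult_mat[of _ n n _ n _ n])
    finally show ?thesis unfolding \<tau>_def using D(3)[OF g h] by simp
  qed
  have \<tau>1: "\<tau> \<one> = 1\<^sub>m n" unfolding \<tau>_def using D(2) PQ by simp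
  \<comment> \<open>Compare the entries at \<open>(a, f i)\<close> in
    \<open>\<tau> g * (P * B) = P * B * \<rho> g\<close>. On the right, row \<open>a\<close> of
    \<open>P * B\<close> vanishes; on the left, column \<open>f i\<close> of \<open>P * B\<close> is
    a unit vector and picks out \<open>\<tau> g $$ (a, i)\<close>.\<close>
  have block: "\<tau> g $$ (a, i) = 0" if g: "g \<in> carrier G" and a: "m \<le> a" "a < n" and i: "i < m" for g a i
  proof -
    have PB: "P * B \<in> carrier_mat n n" using PQ B by simp
    have "\<tau> g * (P * B) = P * \<rho> g * (Q * (P * B))"
      unfolding \<tau>_def using PQ D(1)[OF g] B by (intro assoc_mult_mat[of _ n n _ n _ n]) auto
    also have "Q * (P * B) = Q * P * B" using PQ B by (intro assoc_mult_mat[symmetric, of _ n n _ n _ n]) auto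
    also have "\<dots> = B" using PQ B by simp
    also have "P * \<rho> g * B = P * (\<rho> g * B)" using PQ B D(1)[OF g] by (intro assoc_mult_mat[of _ n n _ n _ n]) auto
    also have "\<dots> = P * B * \<rho> g" unfolding Bcom[OF g, symmetric]
      using PQ B D(1)[OF g] by (intro assoc_mult_mat[symmetric, of _ n n _ n _ n]) auto
    finally have e: "\<tau> g * (P * B) = P * B * \<rho> g" .
    have "(P * B * \<rho> g) $$ (a, f i) = 0"
      using mult_mat_entry[OF PB D(1)[OF g] a(2) f[OF i]] zero[OF a] by simp
    moreover have "(\<tau> g * (P * B)) $$ (a, f i) = (\<Sum>k<n. \<tau> g $$ (a, k) * (if k = i then 1 else 0))"
      using mult_mat_entry[OF \<tau>c[OF g] PB a(2) f[OF i]] piv[OF i] by simp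
    moreover have "(\<Sum>k<n. \<tau> g $$ (a, k) * (if k = i then 1 else 0)) = \<tau> g $$ (a, i)"
      using i m by (simp add: if_distrib[of "\<lambda>x. _ * x"] sum.delta cong: if_cong)
    ultimately show ?thesis unfolding e by simp
  qed
  define \<rho>1 where "\<rho>1 g = mat m m (\<lambda>(i, j). \<tau> g $$ (i, j))" for g
  define \<rho>2 where "\<rho>2 g = mat (n - m) (n - m) (\<lambda>(i, j). \<tau> g $$ (i + m, j + m))" for g
  have split: "(\<Sum>k<n. F k) = (\<Sum>k<m. F k) + (\<Sum>k<n - m. F (k + m))" for F :: "nat \<Rightarrow> complex"
  proof -
    have "(\<Sum>k<n. F k) = (\<Sum>k<m. F k) + (\<Sum>k\<in>{m..<n}. F k)"
      using m by (simp add: lessThan_atLeast0 sum.atLeastLessThan_concat)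
    also have "(\<Sum>k\<in>{m..<n}. F k) = (\<Sum>k<n - m. F (k + m))"
      using sum.shift_bounds_nat_ivl[of F 0 m "n - m"] m by (simp add: lessThan_atLeast0)
    finally show ?thesis .
  qed
  have r1: "representation G m \<rho>1"
    unfolding representation_def
  proof (intro conjI ballI)
    show "\<rho>1 \<one> = 1\<^sub>m m" using \<tau>1 m by (intro eq_matI) (auto simp: \<rho>1_def)
    fix g h assume g: "g \<in> carrier G" and h: "h \<in> carrier G"
    show "\<rho>1 (g \<otimes> h) = \<rho>1 g * \<rho>1 h"
    proof (rule eq_matI)
      fix i j assume "i < dim_row (\<rho>1 g * \<rho>1 h)" "j < dim_col (\<rho>1 g * \<rho>1 h)"
      then have ij: "i < m" "j < m" by (auto simp: \<rho>1_def)
      have "(\<tau> g * \<tau> h) $$ (i, j) = (\<Sum>k<m. \<tau> g $$ (i, k) * \<tau> h $$ (k, j))"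
        using mult_mat_entry[OF \<tau>c[OF g] \<tau>c[OF h], of i j] ij m split block[OF h _ _ ij(2)] by simp
      then show "\<rho>1 (g \<otimes> h) $$ (i, j) = (\<rho>1 g * \<rho>1 h) $$ (i, j)"
        using mult_mat_entry[of "\<rho>1 g" m m "\<rho>1 h" m i j] ij \<tau>m[OF g h] by (simp add: \<rho>1_def)
    qed (auto simp: \<rho>1_def)
  qed (auto simp: \<rho>1_def)
  have r2: "representation G (n - m) \<rho>2"
    unfolding representation_def
  proof (intro conjI ballI)
    show "\<rho>2 \<one> = 1\<^sub>m (n - m)" using \<tau>1 m by (intro eq_matI) (auto simp: \<rho>2_def)
    fix g h assume g: "g \<in> carrier G" and h: "h \<in> carrier G"
    show "\<rho>2 (g \<otimes> h) = \<rho>2 g * \<rho>2 h"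
    proof (rule eq_matI)
      fix i j assume "i < dim_row (\<rho>2 g * \<rho>2 h)" "j < dim_col (\<rho>2 g * \<rho>2 h)"
      then have ij: "i < n - m" "j < n - m" by (auto simp: \<rho>2_def)
      have "(\<tau> g * \<tau> h) $$ (i + m, j + m) = (\<Sum>k<n - m. \<tau> g $$ (i + m, k + m) * \<tau> h $$ (k + m, j + m))"
        using mult_mat_entry[OF \<tau>c[OF g] \<tau>c[OF h], of "i + m" "j + m"] ij m split block[OF g, of "i + m"] by simp
      then show "\<rho>2 (g \<otimes> h) $$ (i, j) = (\<rho>2 g * \<rho>2 h) $$ (i, j)"
        using mult_mat_entry[of "\<rho>2 g" "n - m" "n - m" "\<rho>2 h" "n - m" i j] ij \<tau>m[OF g h] by (simp add: \<rho>2_def)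
    qed (auto simp: \<rho>2_def)
  qed (auto simp: \<rho>2_def)
  have "character \<rho> g = character \<rho>1 g + character \<rho>2 g" if g: "g \<in> carrier G" for g
  proof -
    have "character \<rho> g = mat_trace (\<rho> g * (Q * P))" using PQ D(1)[OF g] by (simp add: character_def)
    also have "\<rho> g * (Q * P) = \<rho> g * Q * P" using PQ D(1)[OF g] by (intro assoc_mult_mat[symmetric, of _ n n _ n _ n]) auto
    also have "mat_trace (\<rho> g * Q * P) = mat_trace (P * (\<rho> g * Q))"
      by (rule mat_trace_comm[of _ n n]) (use PQ D(1)[OF g] in auto)
    also have "P * (\<rho> g * Q) = \<tau> g" unfolding \<tau>_def using PQ D(1)[OF g] by (intro assoc_mult_mat[symmetric, of _ n n _ n _ n]) auto
    also have "mat_trace (\<tau> g) = character \<rho>1 g + character \<rho>2 g"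
      using mat_trace_carrier[OF \<tau>c[OF g]] split[of "\<lambda>k. \<tau> g $$ (k, k)"]
      by (simp add: character_def mat_trace_def \<rho>1_def \<rho>2_def)
    finally show ?thesis .
  qed
  then show ?thesis using that[of m "n - m" \<rho>1 \<rho>2] m r1 r2 by simp
qed

text \<open>Induction on the degree: a linear functional that does not vanish on a sum of two
  characters does not vanish on one of them.\<close>

lemma exists_irreducible:
  assumes "representation G n \<rho>" "(\<Sum>g\<in>carrier G. \<alpha> g * character \<rho> g) \<noteq> 0"
  shows "\<exists>m \<sigma>. representation G m \<sigma> \<and> m > 0 \<and> scalar_commutant G m \<sigma> \<and>
    (\<Sum>g\<in>carrier G. \<alpha> g * character \<sigma> g) \<noteq> 0"
  using assms
proof (induction n arbitrary: \<rho> rule: less_induct)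
  case (less n)
  have n: "n > 0"
  proof (rule ccontr)
    assume "\<not> n > 0"
    then have "character \<rho> g = 0" if "g \<in> carrier G" for g
      using mat_trace_carrier[OF representationD(1)[OF less.prems(1) that]] by (simp add: character_def)
    then show False using less.prems(2) by simp
  qed
  show ?case
  proof (cases "scalar_commutant G n \<rho>")
    case True
    then show ?thesis using less.prems n by blast
  next
    case False
    obtain n1 n2 \<rho>1 \<rho>2 where s: "n1 < n" "n2 < n" "representation G n1 \<rho>1" "representation G n2 \<rho>2"
      "\<And>g. g \<in> carrier G \<Longrightarrow> character \<rho> g = character \<rho>1 g + character \<rho>2 g"
      using split_representation[OF less.prems(1) n False] by metis
    have "(\<Sum>g\<in>carrier G. \<alpha> g * character \<rho> g) =
        (\<Sum>g\<in>carrier G. \<alpha> g * character \<rho>1 g) + (\<Sum>g\<in>carrier G. \<alpha> g * character \<rho>2 g)"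
      using s(5) by (simp add: distrib_left sum.distrib)
    then have "(\<Sum>g\<in>carrier G. \<alpha> g * character \<rho>1 g) \<noteq> 0 \<or> (\<Sum>g\<in>carrier G. \<alpha> g * character \<rho>2 g) \<noteq> 0"
      using less.prems(2) by auto
    then show ?thesis using less.IH[OF s(1,3)] less.IH[OF s(2,4)] by blast
  qed
qed

text \<open>Permutation matrices of left translation; a nontrivial translation fixes no
  element.\<close>

lemma regular_representation:
  assumes fin: "finite (carrier G)"
  obtains \<rho> where "representation G (card (carrier G)) \<rho>" "\<And>g. g \<in> carrier G \<Longrightarrow> g \<noteq> \<one> \<Longrightarrow> character \<rho> g = 0"
proof -
  obtain e where e: "bij_betw e {0..<card (carrier G)} (carrier G)" using ex_bij_betw_nat_finite[OF fin] by blast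
  let ?n = "card (carrier G)"
  have n: "?n = card (carrier G)" by simp
  have ec: "e i \<in> carrier G" if "i < ?n" for i using bij_betwE[OF e] that n by simp
  have einj: "e i = e j \<longleftrightarrow> i = j" if "i < ?n" "j < ?n" for i j
    using bij_betw_imp_inj_on[OF e] that n by (auto simp: inj_on_def)
  have esurj: "\<exists>i<?n. e i = g" if "g \<in> carrier G" for g
    using bij_betw_imp_surj_on[OF e] that n by (metis atLeastLessThan_iff imageE)
  define \<rho> where "\<rho> g = mat ?n ?n (\<lambda>(i, j). if e i = g \<otimes> e j then 1 else 0 :: complex)" for g
  have \<rho>c: "\<rho> g \<in> carrier_mat ?n ?n" for g by (simp add: \<rho>_def)
  have "representation G ?n \<rho>"
    unfolding representation_def
  proof (intro conjI ballI)
    show "\<rho> \<one> = 1\<^sub>m ?n" using ec einj by (intro eq_matI) (auto simp: \<rho>_def)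
    fix g h assume g: "g \<in> carrier G" and h: "h \<in> carrier G"
    show "\<rho> (g \<otimes> h) = \<rho> g * \<rho> h"
    proof (rule eq_matI)
      fix i j assume "i < dim_row (\<rho> g * \<rho> h)" "j < dim_col (\<rho> g * \<rho> h)"
      then have ij: "i < ?n" "j < ?n" by (auto simp: \<rho>_def)
      obtain k0 where k0: "k0 < ?n" "e k0 = h \<otimes> e j" using esurj[of "h \<otimes> e j"] h ec ij by auto
      have "(\<rho> g * \<rho> h) $$ (i, j) = (\<Sum>k<?n. \<rho> g $$ (i, k) * \<rho> h $$ (k, j))"
        by (rule mult_mat_entry[OF \<rho>c \<rho>c ij])
      also have "\<dots> = (\<Sum>k<?n. \<rho> g $$ (i, k) * (if k = k0 then 1 else 0))"
        using ij k0 einj[OF _ k0(1)] by (intro sum.cong) (auto simp: \<rho>_def)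
      also have "\<dots> = \<rho> g $$ (i, k0)" using k0 by (simp add: if_distrib[of "\<lambda>x. _ * x"] sum.delta cong: if_cong)
      also have "\<dots> = \<rho> (g \<otimes> h) $$ (i, j)" using ij k0 g h ec by (simp add: \<rho>_def m_assoc)
      finally show "\<rho> (g \<otimes> h) $$ (i, j) = (\<rho> g * \<rho> h) $$ (i, j)" by simp
    qed (auto simp: \<rho>_def)
  qed (auto simp: \<rho>_def)
  moreover have "character \<rho> g = 0" if g: "g \<in> carrier G" "g \<noteq> \<one>" for g
  proof -
    have "e i \<noteq> g \<otimes> e i" if "i < ?n" for i
    proof
      assume "e i = g \<otimes> e i"
      then have "g = \<one>" using g(1) ec[OF that] by (metis l_one one_closed right_cancel)
      then show False using g by simp
    qed
    then show ?thesis by (auto simp: character_def mat_trace_def \<rho>_def)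
  qed
  ultimately show ?thesis using that by blast
qed

end

section \<open>Frobenius complements\<close>

lemma representation_restrict:
  assumes "representation G n \<rho>" "H \<subseteq> carrier G"
  shows "representation (G\<lparr>carrier := H\<rparr>) n \<rho>"
  using assms by (auto simp: representation_def subset_iff)

context group
begin

lemma normal_representation_kernel:
  assumes r: "representation G n \<rho>"
  shows "{g \<in> carrier G. \<rho> g = 1\<^sub>m n} \<lhd> G" (is "?L \<lhd> G")
  unfolding normal_inv_iff
proof (intro conjI ballI)
  note D = representationD[OF r]
  have inv1: "\<rho> (inv g) = 1\<^sub>m n" if "g \<in> carrier G" "\<rho> g = 1\<^sub>m n" for g
  proof -
    have "\<rho> (inv g) * \<rho> g = \<rho> (inv g \<otimes> g)" using D(3)[of "inv g" g] that by simp
    then show ?thesis using that D(1)[of "inv g"] D(2) by simp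
  qed
  show "subgroup ?L G"
  proof (rule subgroupI)
    show "?L \<noteq> {}" using D(2) by (auto intro!: exI[of _ \<one>])
  qed (use D inv1 in auto)
  fix g x assume g: "g \<in> carrier G" and x: "x \<in> ?L"
  have "\<rho> (g \<otimes> x \<otimes> inv g) = \<rho> g * \<rho> x * \<rho> (inv g)" using D(3) g x by simp
  also have "\<dots> = \<rho> (g \<otimes> inv g)" using x D(1)[OF g] D(3)[of g "inv g"] g by simp
  also have "\<dots> = 1\<^sub>m n" using g D(2) by simp
  finally show "g \<otimes> x \<otimes> inv g \<in> ?L" using g x by simp
qed

end

locale frobenius_complement = group +
  fixes M
  assumes fin: "finite (carrier G)" and M: "subgroup M G" and M_proper: "M \<noteq> carrier G"
    and trivial_intersection: "\<And>g m. \<lbrakk>g \<in> carrier G; g \<notin> M; m \<in> M; g \<otimes> m \<otimes> inv g \<in> M\<rbrakk> \<Longrightarrow> m = \<one>"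
begin

lemma Mc: "m \<in> M \<Longrightarrow> m \<in> carrier G"
  using subgroup.mem_carrier[OF M] .

lemma finM: "finite M"
  using finite_subset[OF subgroup.subset[OF M] fin] .

text \<open>The nontrivial elements of the conjugates of \<open>M\<close>. The complement in
  \<open>G\<close> is the prospective Frobenius kernel.\<close>

definition "X = {h \<otimes> m \<otimes> inv h |h m. h \<in> carrier G \<and> m \<in> M \<and> m \<noteq> \<one>}"

lemma X_carrier: "X \<subseteq> carrier G"
  using Mc by (auto simp: X_def)

lemma conj_shift:
  assumes "h \<in> carrier G" "h' \<in> carrier G" "m \<in> carrier G" "h \<otimes> m \<otimes> inv h = x"
  shows "inv h' \<otimes> x \<otimes> h' = (inv h' \<otimes> h) \<otimes> m \<otimes> inv (inv h' \<otimes> h)"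
  using assms by (auto simp: inv_mult_group m_assoc)

lemma one_not_X: "\<one> \<notin> X"
proof
  assume "\<one> \<in> X"
  then obtain h m where "h \<in> carrier G" "m \<in> M" "m \<noteq> \<one>" "h \<otimes> m \<otimes> inv h = \<one>" by (auto simp: X_def)
  then show False using Mc conj_shift[of h h m \<one>] by simp
qed

text \<open>By the trivial intersections, elements of \<open>M\<close> conjugate in \<open>G\<close>
  are already conjugate in \<open>M\<close>. This makes the extension of class functions from
  \<open>M\<close> well defined.\<close>

lemma same_conjugate:
  assumes h: "h \<in> carrier G" "h' \<in> carrier G" and m: "m \<in> M" "m \<noteq> \<one>" "m' \<in> M"
    and eq: "h \<otimes> m \<otimes> inv h = h' \<otimes> m' \<otimes> inv h'"
  shows "inv h' \<otimes> h \<in> M" "m' = (inv h' \<otimes> h) \<otimes> m \<otimes> inv (inv h' \<otimes> h)"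
proof -
  have "m' = inv h' \<otimes> (h' \<otimes> m' \<otimes> inv h') \<otimes> h'"
    using conj_shift[of h' h' m'] h Mc m by simp
  also have "\<dots> = (inv h' \<otimes> h) \<otimes> m \<otimes> inv (inv h' \<otimes> h)" using conj_shift[OF h _ eq] Mc m by simp
  finally show e: "m' = (inv h' \<otimes> h) \<otimes> m \<otimes> inv (inv h' \<otimes> h)" .
  show "inv h' \<otimes> h \<in> M" using trivial_intersection[of "inv h' \<otimes> h" m] h m e by auto
qed

text \<open>Both sides sum over pairs \<open>(h, m)\<close>: an element \<open>h0 m0 h0^-1\<close>
  of \<open>X\<close> arises exactly from the pairs \<open>(h0 j^-1, j m0 j^-1)\<close> with
  \<open>j \<in> M\<close>, hence \<open>card M\<close> times.\<close>

lemma sum_X: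
  fixes F F' :: "'a \<Rightarrow> complex"
  assumes F: "\<And>h m. \<lbrakk>h \<in> carrier G; m \<in> M; m \<noteq> \<one>\<rbrakk> \<Longrightarrow> F (h \<otimes> m \<otimes> inv h) = F' m"
  shows "of_nat (card M) * (\<Sum>g\<in>X. F g) = of_nat (card (carrier G)) * (\<Sum>m\<in>M - {\<one>}. F' m)"
proof -
  let ?S = "carrier G \<times> (M - {\<one>})" and ?c = "\<lambda>p. fst p \<otimes> snd p \<otimes> inv (fst p)"
  have card: "card {p \<in> ?S. ?c p = g} = card M" if gX: "g \<in> X" for g
  proof -
    obtain h0 m0 where g: "h0 \<in> carrier G" "m0 \<in> M" "m0 \<noteq> \<one>" "g = h0 \<otimes> m0 \<otimes> inv h0"
      using gX by (auto simp: X_def)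
    have m0c: "m0 \<in> carrier G" using g Mc by blast
    have "bij_betw (\<lambda>j. (h0 \<otimes> inv j, j \<otimes> m0 \<otimes> inv j)) M {p \<in> ?S. ?c p = g}"
    proof (rule bij_betw_byWitness[where f' = "\<lambda>p. inv (fst p) \<otimes> h0"])
      show "\<forall>j\<in>M. inv (fst (h0 \<otimes> inv j, j \<otimes> m0 \<otimes> inv j)) \<otimes> h0 = j"
        using Mc g by (simp add: inv_mult_group m_assoc)
      show "\<forall>p\<in>{p \<in> ?S. ?c p = g}. (h0 \<otimes> inv (inv (fst p) \<otimes> h0), inv (fst p) \<otimes> h0 \<otimes> m0 \<otimes> inv (inv (fst p) \<otimes> h0)) = p"
      proof
        fix p assume p: "p \<in> {p \<in> ?S. ?c p = g}"
        obtain h m where hm: "p = (h, m)" by (cases p)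
        then have hm': "h \<in> carrier G" "m \<in> M" "h \<otimes> m \<otimes> inv h = g" using p by auto
        have "m = (inv h \<otimes> h0) \<otimes> m0 \<otimes> inv (inv h \<otimes> h0)"
          using same_conjugate(2)[OF g(1) hm'(1) g(2,3) hm'(2)] hm' g by simp
        moreover have "h0 \<otimes> inv (inv h \<otimes> h0) = h" using hm' g by (simp add: inv_mult_group flip: m_assoc)
        ultimately show "(h0 \<otimes> inv (inv (fst p) \<otimes> h0), inv (fst p) \<otimes> h0 \<otimes> m0 \<otimes> inv (inv (fst p) \<otimes> h0)) = p"
          using hm by simp
      qed
      show "(\<lambda>j. (h0 \<otimes> inv j, j \<otimes> m0 \<otimes> inv j)) ` M \<subseteq> {p \<in> ?S. ?c p = g}"
      proof
        fix p assume "p \<in> (\<lambda>j. (h0 \<otimes> inv j, j \<otimes> m0 \<otimes> inv j)) ` M"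
        then obtain j where j: "j \<in> M" "p = (h0 \<otimes> inv j, j \<otimes> m0 \<otimes> inv j)" by blast
        have jc: "j \<in> carrier G" using Mc j by blast
        have "j \<otimes> m0 \<otimes> inv j \<in> M" using j g subgroup.m_closed[OF M] subgroup.m_inv_closed[OF M] by blast
        moreover have "j \<otimes> m0 \<otimes> inv j \<noteq> \<one>"
        proof
          assume "j \<otimes> m0 \<otimes> inv j = \<one>"
          then show False using conj_shift[of j j m0 \<one>] jc m0c g(3) by simp
        qed
        moreover have cancel: "inv j \<otimes> (j \<otimes> y) = y" if "y \<in> carrier G" for y using jc that by (simp flip: m_assoc)
        moreover have "h0 \<otimes> inv j \<otimes> (j \<otimes> m0 \<otimes> inv j) \<otimes> inv (h0 \<otimes> inv j) = g"
          using jc m0c g by (simp add: inv_mult_group m_assoc cancel)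
        ultimately show "p \<in> {p \<in> ?S. ?c p = g}" using j jc g(1) m0c by simp
      qed
      show "(\<lambda>p. inv (fst p) \<otimes> h0) ` {p \<in> ?S. ?c p = g} \<subseteq> M"
      proof
        fix x assume "x \<in> (\<lambda>p. inv (fst p) \<otimes> h0) ` {p \<in> ?S. ?c p = g}"
        then obtain p where p: "p \<in> {p \<in> ?S. ?c p = g}" "x = inv (fst p) \<otimes> h0" by blast
        then have "fst p \<in> carrier G" "snd p \<in> M" "h0 \<otimes> m0 \<otimes> inv h0 = ?c p" using g(4) by auto
        then show "x \<in> M" using same_conjugate(1)[OF g(1) _ g(2,3)] p(2) by simp
      qed
    qed
    then show ?thesis by (rule bij_betw_same_card[symmetric])
  qed
  have finX: "finite X" using finite_subset[OF X_carrier fin] .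
  have "(\<Sum>p\<in>?S. F (?c p)) = (\<Sum>g\<in>X. \<Sum>p\<in>{p \<in> ?S. ?c p = g}. F (?c p))"
  proof (rule sum.group[symmetric])
    show "?c ` ?S \<subseteq> X" unfolding X_def by auto
  qed (use fin finM finX in simp_all)
  also have "\<dots> = (\<Sum>g\<in>X. of_nat (card M) * F g)"
    using card by (intro sum.cong) auto
  finally have "of_nat (card M) * (\<Sum>g\<in>X. F g) = (\<Sum>p\<in>?S. F (?c p))" by (simp add: sum_distrib_left)
  also have "\<dots> = (\<Sum>h\<in>carrier G. \<Sum>m\<in>M - {\<one>}. F (h \<otimes> m \<otimes> inv h))"
    by (simp add: sum.cartesian_product case_prod_unfold)
  also have "\<dots> = (\<Sum>h\<in>carrier G. \<Sum>m\<in>M - {\<one>}. F' m)"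
    using F by (intro sum.cong) auto
  finally show ?thesis by simp
qed

lemma card_complement: "card M * card (carrier G - X) = card (carrier G)"
proof -
  have finX: "finite X" using finite_subset[OF X_carrier fin] .
  have "of_nat (card M) * (\<Sum>g\<in>X. 1) = of_nat (card (carrier G)) * (\<Sum>m\<in>M - {\<one>}. 1 :: complex)"
    by (rule sum_X) simp
  then have "(of_nat (card M * card X) :: complex) = of_nat (card (carrier G) * (card M - 1))"
    using subgroup.one_closed[OF M] finM by (simp add: card_Diff_singleton)
  then have 1: "card M * card X = card (carrier G) * (card M - 1)" by (metis of_nat_eq_iff)
  have "card M > 0" using subgroup.one_closed[OF M] finM card_gt_0_iff by blast
  moreover have "card (carrier G - X) = card (carrier G) - card X" by (rule card_Diff_subset[OF finX X_carrier])
  ultimately show ?thesis using 1 by (cases "card M") (auto simp: diff_mult_distrib2 algebra_simps)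
qed

text \<open>An element commuting with a nontrivial element of a conjugate of \<open>M\<close> lies
  in that conjugate, and \<open>k\<close> commutes with its power \<open>x\<close>.\<close>

lemma powers_not_X:
  assumes k: "k \<in> carrier G" "k \<notin> X" and x: "x \<in> generate G {k}"
  shows "x \<notin> X"
proof
  assume "x \<in> X"
  then obtain h m where hm: "h \<in> carrier G" "m \<in> M" "m \<noteq> \<one>" "x = h \<otimes> m \<otimes> inv h" by (auto simp: X_def)
  obtain i :: int where i: "x = k [^] i" using x generate_pow[OF k(1)] by blast
  have mc: "m \<in> carrier G" using hm Mc by blast
  have "k \<otimes> x = x \<otimes> k" unfolding i using int_pow_mult[OF k(1), of 1 i] int_pow_mult[OF k(1), of i 1] k(1)
    by (simp add: add.commute)
  then have "k \<otimes> x \<otimes> inv k = x" using k hm mc by (metis inv_closed inv_solve_right' m_closed)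
  then have "(k \<otimes> h) \<otimes> m \<otimes> inv (k \<otimes> h) = h \<otimes> m \<otimes> inv h"
    using hm mc k by (simp add: inv_mult_group m_assoc)
  then have "inv h \<otimes> (k \<otimes> h) \<in> M" using same_conjugate(1)[of "k \<otimes> h" h m m] hm k by simp
  then have kM: "inv h \<otimes> k \<otimes> h \<in> M" using hm k by (simp add: m_assoc)
  have "h \<otimes> (inv h \<otimes> k) = k" using hm k by (simp flip: m_assoc)
  then have kk: "k = h \<otimes> (inv h \<otimes> k \<otimes> h) \<otimes> inv h" using hm k by (simp add: m_assoc)
  have "k \<noteq> \<one>" using i \<open>x \<in> X\<close> one_not_X by auto
  then have "inv h \<otimes> k \<otimes> h \<noteq> \<one>" using kk hm by auto
  then have "k \<in> X" unfolding X_def using kk kM hm by blast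
  then show False using k by blast
qed

text \<open>Frobenius's argument for a single character. Let \<open>\<phi>\<close> be irreducible on
  \<open>M\<close> of degree \<open>f\<close> with different values at \<open>d0\<close> and
  \<open>\<one>\<close>, and let \<open>\<theta>\<close> extend it by \<open>f\<close> outside of
  \<open>X\<close>. Then \<open>\<theta>\<close> has norm \<open>1\<close> and an integral nonzero
  inner product \<open>c\<close> with some irreducible character of \<open>G\<close>; this forces
  \<open>c = 1\<close> and equality. The kernel contains everything outside of \<open>X\<close>, but
  not \<open>d0\<close>.\<close>

theorem exists_normal_avoiding:
  assumes d0: "d0 \<in> M" "d0 \<noteq> \<one>"
  obtains L where "L \<lhd> G" "L \<noteq> {\<one>}" "d0 \<notin> L"
proof -
  let ?GM = "G\<lparr>carrier := M\<rparr>"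
  let ?N = "of_nat (card (carrier G)) :: complex" and ?\<mu> = "of_nat (card M) :: complex"
  interpret GM: group ?GM by (rule subgroup.subgroup_is_group[OF M is_group])
  have finGM: "finite (carrier ?GM)" using finM by simp
  have N0: "?N \<noteq> 0" using fin card_gt_0_iff by auto
  have \<mu>0: "?\<mu> \<noteq> 0" using finM subgroup.one_closed[OF M] by auto
  obtain \<phi>0 where \<phi>0: "representation ?GM (card M) \<phi>0" "\<And>m. m \<in> M \<Longrightarrow> m \<noteq> \<one> \<Longrightarrow> character \<phi>0 m = 0"
    using GM.regular_representation[OF finGM] by auto
  \<comment> \<open>This functional is the difference of the values at \<open>d0\<close> and
    \<open>\<one>\<close>. It does not vanish on the regular character of \<open>M\<close>, hence
    not on some irreducible one.\<close>
  define \<alpha> :: "'a \<Rightarrow> complex" where "\<alpha> m = (if m = d0 then 1 else 0) - (if m = \<one> then 1 else 0)" for m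
  have \<alpha>: "(\<Sum>m\<in>carrier ?GM. \<alpha> m * c m) = c d0 - c \<one>" for c :: "'a \<Rightarrow> complex"
    using d0 finM subgroup.one_closed[OF M]
    by (simp add: \<alpha>_def left_diff_distrib sum_subtractf if_distrib[of "\<lambda>x. x * _"] sum.delta' cong: if_cong)
  have "character \<phi>0 \<one> = ?\<mu>" using GM.character_one[OF \<phi>0(1)] by simp
  then have \<alpha>0: "(\<Sum>m\<in>carrier ?GM. \<alpha> m * character \<phi>0 m) \<noteq> 0" unfolding \<alpha> using \<phi>0(2)[OF d0] \<mu>0 by simp
  obtain f \<phi> where \<phi>: "representation ?GM f \<phi>" "f > 0" "scalar_commutant ?GM f \<phi>"
    and "(\<Sum>m\<in>carrier ?GM. \<alpha> m * character \<phi> m) \<noteq> 0"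
    using GM.exists_irreducible[OF \<phi>0(1) \<alpha>0] by blast
  then have \<phi>d0: "character \<phi> d0 \<noteq> character \<phi> \<one>" unfolding \<alpha> by simp
  have \<phi>1: "character \<phi> \<one> = of_nat f" using GM.character_one[OF \<phi>(1)] by simp
  have \<phi>norm: "(\<Sum>m\<in>M. cnj (character \<phi> m) * character \<phi> m) = ?\<mu>"
    using GM.scalar_commutant_norm[OF finGM \<phi>] by simp
  have \<phi>conj: "character \<phi> (j \<otimes> m \<otimes> inv j) = character \<phi> m" if "j \<in> M" "m \<in> M" for j m
    using GM.character_conj[OF \<phi>(1), of m j] that m_inv_consistent[OF M] by simp
  define \<theta> where "\<theta> g = (if g \<in> X then character \<phi> (SOME m. m \<in> M \<and> m \<noteq> \<one> \<and> (\<exists>h\<in>carrier G. g = h \<otimes> m \<otimes> inv h)) else of_nat f)" for g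
  have \<theta>X: "\<theta> (h \<otimes> m \<otimes> inv h) = character \<phi> m" if h: "h \<in> carrier G" and m: "m \<in> M" "m \<noteq> \<one>" for h m
  proof -
    let ?P = "\<lambda>m'. m' \<in> M \<and> m' \<noteq> \<one> \<and> (\<exists>h'\<in>carrier G. h \<otimes> m \<otimes> inv h = h' \<otimes> m' \<otimes> inv h')"
    have "?P (SOME m'. ?P m')" by (rule someI[of ?P m]) (use h m in blast)
    then obtain h' where h': "h' \<in> carrier G" "(SOME m'. ?P m') \<in> M"
      "h \<otimes> m \<otimes> inv h = h' \<otimes> (SOME m'. ?P m') \<otimes> inv h'" by blast
    have "character \<phi> (SOME m'. ?P m') = character \<phi> m"
      using same_conjugate[OF h h'(1) m h'(2,3)] \<phi>conj m(1) by metis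
    moreover have "h \<otimes> m \<otimes> inv h \<in> X" using h m by (auto simp: X_def)
    ultimately show ?thesis by (simp add: \<theta>_def)
  qed
  have \<theta>K: "\<theta> g = of_nat f" if "g \<notin> X" for g using that by (simp add: \<theta>_def)
  have split: "(\<Sum>g\<in>carrier G. F g) = (\<Sum>g\<in>carrier G - X. F g) + (\<Sum>g\<in>X. F g)" for F :: "'a \<Rightarrow> complex"
    using sum.subset_diff[OF X_carrier fin] by blast
  have remove1: "(\<Sum>m\<in>M. F m) = F \<one> + (\<Sum>m\<in>M - {\<one>}. F m)" for F :: "'a \<Rightarrow> complex"
    using sum.remove[OF finM subgroup.one_closed[OF M]] by blast
  have \<theta>norm: "(\<Sum>g\<in>carrier G. cnj (\<theta> g) * \<theta> g) = ?N"
  proof -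
    have "?\<mu> * (\<Sum>g\<in>X. cnj (\<theta> g) * \<theta> g) = ?N * (\<Sum>m\<in>M - {\<one>}. cnj (character \<phi> m) * character \<phi> m)"
      by (rule sum_X) (use \<theta>X in simp)
    also have "(\<Sum>m\<in>M - {\<one>}. cnj (character \<phi> m) * character \<phi> m) = ?\<mu> - of_nat f * of_nat f"
      using remove1[of "\<lambda>m. cnj (character \<phi> m) * character \<phi> m"] \<phi>norm \<phi>1 by (simp add: algebra_simps)
    finally have 1: "?\<mu> * (\<Sum>g\<in>X. cnj (\<theta> g) * \<theta> g) = ?N * (?\<mu> - of_nat f * of_nat f)" .
    have "?\<mu> * (\<Sum>g\<in>carrier G - X. cnj (\<theta> g) * \<theta> g) = of_nat (card M * card (carrier G - X)) * (of_nat f * of_nat f)"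
      using \<theta>K by simp
    then have 2: "?\<mu> * (\<Sum>g\<in>carrier G - X. cnj (\<theta> g) * \<theta> g) = ?N * (of_nat f * of_nat f)"
      unfolding card_complement .
    have "?\<mu> * (\<Sum>g\<in>carrier G. cnj (\<theta> g) * \<theta> g) = ?\<mu> * ?N"
      unfolding split distrib_left 1 2 by (simp add: algebra_simps)
    then show ?thesis using \<mu>0 by simp
  qed
  obtain \<rho>0 where \<rho>0: "representation G (card (carrier G)) \<rho>0" "\<And>g. g \<in> carrier G \<Longrightarrow> g \<noteq> \<one> \<Longrightarrow> character \<rho>0 g = 0"
    using regular_representation[OF fin] by blast
  have "(\<Sum>g\<in>carrier G. cnj (\<theta> g) * character \<rho>0 g) = (\<Sum>g\<in>{\<one>}. cnj (\<theta> g) * character \<rho>0 g)"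
    by (rule sum.mono_neutral_right) (use fin \<rho>0(2) in auto)
  also have "\<dots> = of_nat f * ?N" using \<theta>K[OF one_not_X] character_one[OF \<rho>0(1)] by simp
  finally have "(\<Sum>g\<in>carrier G. cnj (\<theta> g) * character \<rho>0 g) \<noteq> 0" using \<phi>(2) N0 by simp
  then obtain n \<rho> where \<rho>: "representation G n \<rho>" "n > 0" "scalar_commutant G n \<rho>"
    and ne: "(\<Sum>g\<in>carrier G. cnj (\<theta> g) * character \<rho> g) \<noteq> 0"
    using exists_irreducible[OF \<rho>0(1), of "\<lambda>g. cnj (\<theta> g)"] by blast
  let ?\<chi> = "character \<rho>"
  have \<chi>norm: "(\<Sum>g\<in>carrier G. cnj (?\<chi> g) * ?\<chi> g) = ?N" using scalar_commutant_norm[OF fin \<rho>] .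
  have rM: "representation ?GM n \<rho>" using representation_restrict[OF \<rho>(1) subgroup.subset[OF M]] .
  obtain a where a: "(\<Sum>g\<in>carrier G. ?\<chi> g) = ?N * of_nat a"
    using character_average(1)[OF fin \<rho>(1)] N0 by (auto simp: Nats_def field_simps)
  obtain b where b: "(\<Sum>m\<in>M. cnj (character \<phi> m) * ?\<chi> m) = ?\<mu> * of_nat b"
    using GM.character_inner_product_Nats[OF finGM \<phi>(1) rM] \<mu>0 by (auto simp: Nats_def field_simps)
  obtain e where e: "(\<Sum>m\<in>M. ?\<chi> m) = ?\<mu> * of_nat e"
    using GM.character_average(1)[OF finGM rM] \<mu>0 by (auto simp: Nats_def field_simps)
  \<comment> \<open>As \<open>\<theta> - f\<close> vanishes outside of \<open>X\<close>, its inner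
    product with \<open>?\<chi>\<close> can be computed on \<open>M\<close>. Here \<open>a\<close>
    and \<open>e\<close> are the multiplicities of the trivial character in \<open>?\<chi>\<close>
    on \<open>G\<close> and on \<open>M\<close>, and \<open>b\<close> is that of
    \<open>\<phi>\<close> on \<open>M\<close>.\<close>
  define c :: int where "c = int f * int a + int b - int f * int e"
  have S: "(\<Sum>g\<in>carrier G. cnj (\<theta> g) * ?\<chi> g) = ?N * of_int c"
  proof -
    have "(\<Sum>g\<in>carrier G. cnj (\<theta> g) * ?\<chi> g) = (\<Sum>g\<in>carrier G. of_nat f * ?\<chi> g) + (\<Sum>g\<in>carrier G. (cnj (\<theta> g) - of_nat f) * ?\<chi> g)"
      by (simp add: algebra_simps flip: sum.distrib)
    also have "(\<Sum>g\<in>carrier G. (cnj (\<theta> g) - of_nat f) * ?\<chi> g) = (\<Sum>g\<in>X. (cnj (\<theta> g) - of_nat f) * ?\<chi> g)"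
      unfolding split using \<theta>K by simp
    finally have 1: "(\<Sum>g\<in>carrier G. cnj (\<theta> g) * ?\<chi> g) = of_nat f * (?N * of_nat a) + (\<Sum>g\<in>X. (cnj (\<theta> g) - of_nat f) * ?\<chi> g)"
      using a by (simp flip: sum_distrib_left)
    have "?\<mu> * (\<Sum>g\<in>X. (cnj (\<theta> g) - of_nat f) * ?\<chi> g) = ?N * (\<Sum>m\<in>M - {\<one>}. (cnj (character \<phi> m) - of_nat f) * ?\<chi> m)"
      by (rule sum_X) (use \<theta>X character_conj[OF \<rho>(1)] Mc in simp)
    also have "(\<Sum>m\<in>M - {\<one>}. (cnj (character \<phi> m) - of_nat f) * ?\<chi> m) = (\<Sum>m\<in>M. (cnj (character \<phi> m) - of_nat f) * ?\<chi> m)"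
      unfolding remove1[of "\<lambda>m. (cnj (character \<phi> m) - of_nat f) * ?\<chi> m"] using \<phi>1 by simp
    also have "\<dots> = ?\<mu> * of_nat b - of_nat f * (?\<mu> * of_nat e)"
      using b e by (simp add: left_diff_distrib sum_subtractf flip: sum_distrib_left)
    finally have "?\<mu> * (\<Sum>g\<in>X. (cnj (\<theta> g) - of_nat f) * ?\<chi> g) = ?\<mu> * (?N * (of_nat b - of_nat f * of_nat e))"
      by (simp add: algebra_simps)
    then have "(\<Sum>g\<in>X. (cnj (\<theta> g) - of_nat f) * ?\<chi> g) = ?N * (of_nat b - of_nat f * of_nat e)" using \<mu>0 by simp
    then show ?thesis unfolding 1 c_def by (simp add: algebra_simps)
  qed
  have c0: "c \<noteq> 0" using ne S by auto
  \<comment> \<open>Summed over \<open>G\<close>, these squares give the group order times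
    \<open>1 - c^2\<close>. So the nonzero integer \<open>c\<close> is \<open>1\<close> or
    \<open>-1\<close> and all squares vanish; the degrees exclude \<open>-1\<close>.\<close>
  have expand: "(cmod (z - of_int c * w))\<^sup>2 = Re (cnj z * z) - 2 * of_int c * Re (cnj z * w) + (of_int c)\<^sup>2 * Re (cnj w * w)"
    for z w :: complex unfolding cmod_power2 by (simp add: power2_eq_square algebra_simps)
  have "(\<Sum>g\<in>carrier G. (cmod (\<theta> g - of_int c * ?\<chi> g))\<^sup>2) =
      (\<Sum>g\<in>carrier G. Re (cnj (\<theta> g) * \<theta> g) - 2 * of_int c * Re (cnj (\<theta> g) * ?\<chi> g) + (of_int c)\<^sup>2 * Re (cnj (?\<chi> g) * ?\<chi> g))"
    unfolding expand by (rule refl)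
  also have "\<dots> = Re (\<Sum>g\<in>carrier G. cnj (\<theta> g) * \<theta> g) - 2 * of_int c * Re (\<Sum>g\<in>carrier G. cnj (\<theta> g) * ?\<chi> g)
      + (of_int c)\<^sup>2 * Re (\<Sum>g\<in>carrier G. cnj (?\<chi> g) * ?\<chi> g)"
    by (simp only: Re_sum sum_subtractf sum.distrib sum_distrib_left)
  also have "\<dots> = real (card (carrier G)) * (1 - (of_int c)\<^sup>2)"
    unfolding \<theta>norm \<chi>norm S by (simp add: power2_eq_square algebra_simps)
  finally have sq: "(\<Sum>g\<in>carrier G. (cmod (\<theta> g - of_int c * ?\<chi> g))\<^sup>2) = real (card (carrier G)) * (1 - (of_int c)\<^sup>2)" .
  have "0 \<le> real (card (carrier G)) * (1 - (of_int c)\<^sup>2)" unfolding sq[symmetric] by (simp add: sum_nonneg)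
  moreover have "card (carrier G) > 0" using fin card_gt_0_iff by auto
  ultimately have "(of_int c :: real)\<^sup>2 \<le> 1" by (simp add: zero_le_mult_iff)
  then have "c\<^sup>2 \<le> 1" by (metis of_int_1 of_int_le_iff of_int_power)
  then have "c\<^sup>2 = 1" using c0 by (smt (verit) zero_less_power2)
  then have "(\<Sum>g\<in>carrier G. (cmod (\<theta> g - of_int c * ?\<chi> g))\<^sup>2) = 0"
    unfolding sq by (metis of_int_1 of_int_power diff_self mult_zero_right)
  then have eq: "\<theta> g = of_int c * ?\<chi> g" if "g \<in> carrier G" for g
    using that fin by (simp add: sum_nonneg_eq_0_iff)
  have "of_nat f = of_int c * (of_nat n :: complex)"
    using eq[OF one_closed] \<theta>K[OF one_not_X] character_one[OF \<rho>(1)] by simp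
  then have "int f = c * int n" by (metis of_int_eq_iff of_int_mult of_int_of_nat_eq)
  moreover have "c = 1 \<or> c = -1" using \<open>c\<^sup>2 = 1\<close> by (simp add: power2_eq_1_iff)
  ultimately have c1: "c = 1" using \<phi>(2) by auto
  then have fn: "f = n" using \<open>int f = c * int n\<close> by simp
  have \<theta>\<chi>: "\<theta> g = ?\<chi> g" if "g \<in> carrier G" for g using eq[OF that] c1 by simp
  let ?L = "{g \<in> carrier G. \<rho> g = 1\<^sub>m n}"
  \<comment> \<open>All powers of \<open>k\<close> avoid \<open>X\<close>, so the character is
    constantly \<open>n\<close> on the subgroup generated by \<open>k\<close>, and
    \<open>character_average\<close> makes the representation trivial there.\<close>
  have K: "k \<in> ?L" if k: "k \<in> carrier G" "k \<notin> X" for k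
  proof -
    have sub: "subgroup (generate G {k}) G" using generate_is_subgroup[of "{k}"] k by simp
    let ?C = "G\<lparr>carrier := generate G {k}\<rparr>"
    interpret C: group ?C by (rule subgroup.subgroup_is_group[OF sub is_group])
    have rC: "representation ?C n \<rho>" using representation_restrict[OF \<rho>(1) subgroup.subset[OF sub]] .
    have finC: "finite (carrier ?C)" using finite_subset[OF subgroup.subset[OF sub] fin] by simp
    have "?\<chi> x = of_nat n" if "x \<in> generate G {k}" for x
      using powers_not_X[OF k that] \<theta>K \<theta>\<chi>[of x] subgroup.mem_carrier[OF sub that] fn by simp
    then have "(\<Sum>x\<in>carrier ?C. ?\<chi> x) = of_nat (card (carrier ?C) * n)" by simp
    then have "\<rho> k = 1\<^sub>m n"
      by (rule C.character_average(2)[OF finC rC]) (simp add: generate.incl)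
    then show ?thesis using k by simp
  qed
  \<comment> \<open>A trivial kernel would leave only \<open>\<one>\<close> outside of
    \<open>X\<close>, and \<open>card_complement\<close> would give
    \<open>M = carrier G\<close>.\<close>
  have "?L \<noteq> {\<one>}"
  proof
    assume L1: "?L = {\<one>}"
    then have "carrier G - X \<subseteq> {\<one>}" using K by blast
    then have "card (carrier G - X) \<le> 1" using card_mono[of "{\<one>}"] by simp
    then have "card (carrier G) \<le> card M" using card_complement by (metis mult.right_neutral mult_le_mono2)
    then have "M = carrier G" using card_seteq[OF fin subgroup.subset[OF M]] by blast
    then show False using M_proper by blast
  qed
  moreover have "d0 \<notin> ?L"
  proof
    assume "d0 \<in> ?L"
    then have "?\<chi> d0 = of_nat n" by (simp add: character_def mat_trace_def)
    moreover have "?\<chi> d0 = character \<phi> d0" using \<theta>\<chi>[OF Mc[OF d0(1)]] \<theta>X[OF one_closed d0] Mc[OF d0(1)] by simp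
    ultimately show False using \<phi>d0 \<phi>1 fn by simp
  qed
  ultimately show ?thesis using that normal_representation_kernel[OF \<rho>(1)] by blast
qed

end

section \<open>Isolated vertices in finite groups\<close>

context group
begin

text \<open>Orbit sizes divide \<open>r^a\<close>; without fixed points each would be divisible by
  \<open>r\<close>, and so would \<open>card X\<close>.\<close>

lemma exists_fixed_point:
  assumes card: "card (carrier G) = r ^ a" and r: "prime (r::nat)" and finX: "finite X"
    and ndvd: "\<not> r dvd card X"
    and act: "\<And>g x. \<lbrakk>g \<in> carrier G; x \<in> X\<rbrakk> \<Longrightarrow> f g x \<in> X"
    and one: "\<And>x. x \<in> X \<Longrightarrow> f \<one> x = x"
    and mult: "\<And>g h x. \<lbrakk>g \<in> carrier G; h \<in> carrier G; x \<in> X\<rbrakk> \<Longrightarrow> f (g \<otimes> h) x = f g (f h x)"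
  shows "\<exists>x\<in>X. \<forall>g\<in>carrier G. f g x = x"
proof (rule ccontr)
  assume nofix: "\<not> ?thesis"
  have fin: "finite (carrier G)" using card r by (metis card.infinite not_prime_0 power_eq_0_iff)
  let ?O = "\<lambda>x. (\<lambda>g. f g x) ` carrier G"
  have inv1: "f (inv g) (f g x) = x" if "g \<in> carrier G" "x \<in> X" for g x
    using mult[of "inv g" g x] one that by simp
  have sub: "?O y \<subseteq> ?O x" if "x \<in> X" "y \<in> ?O x" for x y
    using that mult[OF _ _ that(1)] by (auto simp: image_iff) (metis m_closed)
  have self: "x \<in> ?O x" if "x \<in> X" for x using one[OF that] by (metis imageI one_closed)
  have sym: "x \<in> ?O y" if "x \<in> X" "y \<in> ?O x" for x y
    using that inv1[OF _ that(1)] by (auto simp: image_iff) (metis inv_closed)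
  have eq: "?O y = ?O x" if "x \<in> X" "y \<in> ?O x" for x y
  proof -
    have "y \<in> X" using that act by auto
    then show ?thesis using sub[OF that] sub[OF _ sym[OF that]] by blast
  qed
  have dvd: "r dvd card (?O x)" if x: "x \<in> X" for x
  proof -
    let ?St = "{g \<in> carrier G. f g x = x}"
    have fiber: "card {g \<in> carrier G. f g x = y} = card ?St" if y: "y \<in> ?O x" for y
    proof -
      obtain g0 where g0: "g0 \<in> carrier G" "y = f g0 x" using y by auto
      have "bij_betw (\<lambda>s. g0 \<otimes> s) ?St {g \<in> carrier G. f g x = y}"
      proof (rule bij_betw_byWitness[where f' = "\<lambda>g. inv g0 \<otimes> g"])
        show "(\<lambda>s. g0 \<otimes> s) ` ?St \<subseteq> {g \<in> carrier G. f g x = y}" using g0 mult x by auto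
        show "(\<lambda>g. inv g0 \<otimes> g) ` {g \<in> carrier G. f g x = y} \<subseteq> ?St"
          using g0 mult x inv1[OF g0(1) x] by auto
      qed (use g0 in \<open>auto simp: inv_mult_cancel\<close>)
      then show ?thesis by (rule bij_betw_same_card[symmetric])
    qed
    have "card (carrier G) = (\<Sum>g\<in>carrier G. 1)" by simp
    also have "\<dots> = (\<Sum>y\<in>?O x. \<Sum>g\<in>{g \<in> carrier G. f g x = y}. 1)"
      by (rule sum.group[symmetric]) (use fin in simp_all)
    also have "\<dots> = card (?O x) * card ?St" using fiber by simp
    finally have "card (?O x) dvd r ^ a" using card by (metis dvd_triv_left)
    then obtain i where i: "card (?O x) = r ^ i" using divides_primepow_nat[OF r] by blast
    have "i \<noteq> 0"
    proof
      assume "i = 0"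
      then have "card (?O x) = 1" using i by simp
      then have "?O x = {x}" using self[OF x] by (metis card_1_singletonE singletonD)
      then show False using nofix x by blast
    qed
    then show ?thesis using i by simp
  qed
  have "r dvd card (\<Union>(?O ` X))"
  proof (rule dvd_partition)
    show "finite (\<Union>(?O ` X))" using finite_subset[OF _ finX, of "\<Union>(?O ` X)"] act by blast
    show "\<forall>c\<in>?O ` X. r dvd card c" using dvd by blast
    show "\<forall>c1\<in>?O ` X. \<forall>c2\<in>?O ` X. c1 \<noteq> c2 \<longrightarrow> c1 \<inter> c2 = {}"
    proof (intro ballI impI, rule ccontr)
      fix c1 c2 assume c: "c1 \<in> ?O ` X" "c2 \<in> ?O ` X" "c1 \<noteq> c2" "c1 \<inter> c2 \<noteq> {}"
      obtain x where x: "x \<in> X" "c1 = ?O x" using c(1) by blast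
      obtain y where y: "y \<in> X" "c2 = ?O y" using c(2) by blast
      obtain z where "z \<in> ?O x" "z \<in> ?O y" using c(4) x y by blast
      then show False using eq[OF x(1)] eq[OF y(1)] c(3) x y by metis
    qed
  qed
  moreover have "\<Union>(?O ` X) = X"
  proof (intro equalityI subsetI)
    fix y assume "y \<in> \<Union>(?O ` X)"
    then show "y \<in> X" using act by (elim UN_E imageE) simp
  next
    fix y assume "y \<in> X"
    then show "y \<in> \<Union>(?O ` X)" by (rule UN_I) (rule self[OF \<open>y \<in> X\<close>])
  qed
  ultimately show False using ndvd by simp
qed

text \<open>\<open>T\<close> acts on the \<open>m\<close> right cosets of \<open>R\<close> by
  multiplication with inverses, and \<open>r\<close> does not divide \<open>m\<close>. A fixed coset
  \<open>R #> g\<close> means that \<open>g\<close> conjugates \<open>T\<close> into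
  \<open>R\<close>, and the orders agree.\<close>

lemma sylow_conjugate:
  assumes fin: "finite (carrier G)" and R: "subgroup R G" and T: "subgroup T G"
    and r: "prime (r::nat)" and card: "card R = r ^ a" "card T = r ^ a"
    and index: "card (carrier G) = r ^ a * m" "\<not> r dvd m"
  shows "\<exists>g\<in>carrier G. (\<lambda>t. g \<otimes> t \<otimes> inv g) ` T = R"
proof -
  let ?T = "G\<lparr>carrier := T\<rparr>"
  interpret T: group ?T by (rule subgroup.subgroup_is_group[OF T is_group])
  have Rc: "R \<subseteq> carrier G" and Tc: "T \<subseteq> carrier G" using subgroup.subset R T by auto
  have "card (rcosets R) * card R = card (carrier G)" using lagrange[OF R] by (simp add: Coset.order_def)
  then have "card (rcosets R) = m" using card index(1) r by (auto simp: prime_gt_0_nat)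
  then have nd: "\<not> r dvd card (rcosets R)" using index by simp
  have finq: "finite (rcosets R)" using finite_subset[OF rcosets_subset_PowG[OF R]] fin by simp
  have "\<exists>X\<in>rcosets R. \<forall>t\<in>carrier ?T. X #> inv t = X"
  proof (rule T.exists_fixed_point[OF _ r finq nd])
    show "card (carrier ?T) = r ^ a" using card by simp
    show "X #> inv t \<in> rcosets R" if "t \<in> carrier ?T" "X \<in> rcosets R" for t X
    proof -
      obtain g where "g \<in> carrier G" "X = R #> g" using \<open>X \<in> rcosets R\<close> by (auto simp: RCOSETS_def)
      then show ?thesis using that(1) Tc Rc
        by (auto simp: coset_mult_assoc RCOSETS_def intro!: bexI[of _ "g \<otimes> inv t"])
    qed
    show "X #> inv \<one>\<^bsub>?T\<^esub> = X" if "X \<in> rcosets R" for X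
      using subgroup.rcosets_carrier[OF R is_group that] by simp
    show "X #> inv (t \<otimes>\<^bsub>?T\<^esub> u) = X #> inv u #> inv t" if "t \<in> carrier ?T" "u \<in> carrier ?T" "X \<in> rcosets R" for t u X
      using that Tc subgroup.rcosets_carrier[OF R is_group that(3)] by (simp add: inv_mult_group coset_mult_assoc subset_iff)
  qed
  then obtain g where g: "g \<in> carrier G" "\<And>t. t \<in> T \<Longrightarrow> (R #> g) #> inv t = R #> g"
    by (auto simp: RCOSETS_def)
  have "g \<otimes> t \<otimes> inv g \<in> R" if t: "t \<in> T" for t
  proof -
    have tc: "t \<in> carrier G" using t Tc by blast
    have "R #> (g \<otimes> t) = R #> g"
      using g(2)[OF subgroup.m_inv_closed[OF T t]] g(1) tc Rc by (simp add: coset_mult_assoc)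
    then have "g \<otimes> t \<in> R #> g" using rcos_self[OF _ R, of "g \<otimes> t"] g tc by simp
    then obtain s where "s \<in> R" "g \<otimes> t = s \<otimes> g" by (auto simp: r_coset_def)
    then show ?thesis using g(1) Rc tc by (simp add: m_assoc subset_iff)
  qed
  then have sub: "(\<lambda>t. g \<otimes> t \<otimes> inv g) ` T \<subseteq> R" by blast
  have "inj_on (\<lambda>t. g \<otimes> t \<otimes> inv g) T"
    using g(1) Tc by (intro inj_onI) (metis conj_inv_cancel subsetD)
  then have "card ((\<lambda>t. g \<otimes> t \<otimes> inv g) ` T) = card R" using card by (simp add: card_image)
  then have "(\<lambda>t. g \<otimes> t \<otimes> inv g) ` T = R" using card_subset_eq[OF finite_subset[OF Rc fin] sub] by simp
  then show ?thesis using g(1) by blast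
qed

text \<open>Conjugation acts on the \<open>r^a - 1\<close> nonidentity elements, and a fixed point
  is central.\<close>

lemma primepow_card_center:
  assumes r: "prime (r::nat)" and card: "card (carrier G) = r ^ a" and nt: "carrier G \<noteq> {\<one>}"
  shows "\<exists>z\<in>carrier G. z \<noteq> \<one> \<and> (\<forall>g\<in>carrier G. z \<otimes> g = g \<otimes> z)"
proof -
  have fin: "finite (carrier G)" using card r by (metis card.infinite not_prime_0 power_eq_0_iff)
  have "a \<noteq> 0"
  proof
    assume "a = 0"
    then show False using card nt one_closed by (metis card_1_singletonE power_0 singletonD)
  qed
  have "\<not> r dvd card (carrier G - {\<one>})"
  proof
    assume d: "r dvd card (carrier G - {\<one>})"
    have "card (carrier G) = card (carrier G - {\<one>}) + 1"
      using card_Suc_Diff1[OF fin one_closed] by simp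
    moreover have "r dvd card (carrier G)" using card \<open>a \<noteq> 0\<close> by simp
    ultimately have "r dvd 1" using d by (metis dvd_add_right_iff)
    then show False using r by simp
  qed
  have conj1: "g \<otimes> x \<otimes> inv g \<noteq> \<one>" if "g \<in> carrier G" "x \<in> carrier G - {\<one>}" for g x
  proof
    assume "g \<otimes> x \<otimes> inv g = \<one>"
    then show False using conj_inv_cancel[of g x] that by simp
  qed
  have "\<exists>x\<in>carrier G - {\<one>}. \<forall>g\<in>carrier G. g \<otimes> x \<otimes> inv g = x"
  proof (rule exists_fixed_point[OF card r _ \<open>\<not> r dvd card (carrier G - {\<one>})\<close>])
    show "g \<otimes> h \<otimes> x \<otimes> inv (g \<otimes> h) = g \<otimes> (h \<otimes> x \<otimes> inv h) \<otimes> inv g"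
      if "g \<in> carrier G" "h \<in> carrier G" "x \<in> carrier G - {\<one>}" for g h x
      using conj_conj[of g h x] that by simp
  qed (use fin conj1 in auto)
  then obtain x where x: "x \<in> carrier G" "x \<noteq> \<one>" "\<And>g. g \<in> carrier G \<Longrightarrow> g \<otimes> x \<otimes> inv g = x" by auto
  then have "x \<otimes> g = g \<otimes> x" if "g \<in> carrier G" for g
    using conj_eq_self_iff[OF that x(1)] that by simp
  then show ?thesis using x by blast
qed

lemma subgroup_normalizer:
  assumes D: "D \<subseteq> carrier G"
  shows "subgroup {g \<in> carrier G. \<forall>d\<in>D. g \<otimes> d \<otimes> inv g \<in> D \<and> inv g \<otimes> d \<otimes> g \<in> D} G" (is "subgroup ?N G")
proof (rule subgroupI)
  show "?N \<noteq> {}" using D by (force intro!: exI[of _ \<one>])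
  fix a assume a: "a \<in> ?N"
  then show "inv a \<in> ?N" by auto
  fix b assume b: "b \<in> ?N"
  have "a \<otimes> b \<otimes> d \<otimes> inv (a \<otimes> b) \<in> D \<and> inv (a \<otimes> b) \<otimes> d \<otimes> (a \<otimes> b) \<in> D" if d: "d \<in> D" for d
  proof -
    have c: "a \<in> carrier G" "b \<in> carrier G" "d \<in> carrier G" using a b d D by auto
    have "a \<otimes> b \<otimes> d \<otimes> inv (a \<otimes> b) = a \<otimes> (b \<otimes> d \<otimes> inv b) \<otimes> inv a" using conj_conj c by simp
    moreover have "inv (a \<otimes> b) \<otimes> d \<otimes> (a \<otimes> b) = inv b \<otimes> (inv a \<otimes> d \<otimes> a) \<otimes> b"
      using c by (simp add: inv_mult_group m_assoc)
    ultimately show ?thesis using a b d by auto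
  qed
  then show "a \<otimes> b \<in> ?N" using a b by auto
qed auto

end

section \<open>Isolated vertices when nontrivial normal subgroups have trivial centralizers\<close>

locale isolated_vertex = group +
  fixes x
  assumes cent: "\<And>K. \<lbrakk>K \<lhd> G; K \<noteq> {\<one>}\<rbrakk> \<Longrightarrow> centralizer G K = {\<one>}"
    and x: "x \<in> carrier G" "x \<noteq> \<one>" and isolated: "\<And>y. \<not> adjacent G x y"
begin

definition "M = centralizer G {x}"

lemma M_sub: "subgroup M G"
  unfolding M_def by (rule subgroup_centralizer1[OF x(1)])

lemma Mc: "m \<in> M \<Longrightarrow> m \<in> carrier G"
  by (simp add: M_def mem_centralizer1_iff)

lemma M_iff: "m \<in> M \<longleftrightarrow> m \<in> carrier G \<and> m \<otimes> x = x \<otimes> m"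
  by (simp add: M_def mem_centralizer1_iff)

lemma center_trivial: "center G = {\<one>}"
  unfolding center_eq_centralizer using cent[OF normal_self] x by blast

lemma subset_M: "\<lbrakk>subgroup K G; K \<noteq> carrier G; x \<in> K\<rbrakk> \<Longrightarrow> K \<subseteq> M"
  using not_adjacentD[OF isolated, of _ K] mem_subgroup[of K] by (metis M_iff subsetI)

lemma M_proper: "M \<noteq> carrier G"
  unfolding M_def using centralizer_eq_carrier_iff[OF x(1)] center_trivial x(2) by blast

lemma x_M: "x \<in> M"
  using x by (simp add: M_iff)

lemma M_maximal: "maximal_subgroup M G"
  unfolding maximal_subgroup_def using M_sub M_proper subset_M x_M by (metis subset_antisym subsetD)

lemma M_core_free: "core_free M G"
  unfolding core_free_def
proof (intro allI impI, rule ccontr)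
  fix K assume K: "K \<lhd> G \<and> K \<subseteq> M" "K \<noteq> {\<one>}"
  then have "x \<in> centralizer G K" using x by (auto simp: mem_centralizer_iff M_iff)
  then show False using cent K x by blast
qed

lemma conjugate_isolated:
  assumes "g \<in> carrier G"
  shows "\<not> adjacent G (g \<otimes> x \<otimes> inv g) y"
proof
  assume a: "adjacent G (g \<otimes> x \<otimes> inv g) y"
  have "adjacent G (inv g \<otimes> (g \<otimes> x \<otimes> inv g) \<otimes> inv (inv g)) (inv g \<otimes> y \<otimes> inv (inv g))"
    by (rule adjacent_conjugate[OF a inv_closed[OF assms]])
  then show False using conj_inv_cancel[OF assms x(1)] isolated by simp
qed

text \<open>If \<open>u \<noteq> 1\<close> lies in two conjugates of \<open>M\<close>, then the maximal subgroup \<open>C(u)\<close> contains the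
  corresponding conjugates of \<open>x\<close>, which therefore commute; so the two conjugates coincide.\<close>

lemma M_trivial_intersection:
  assumes g: "g \<in> carrier G" "g \<notin> M" and m: "m \<in> M" "g \<otimes> m \<otimes> inv g \<in> M"
  shows "m = \<one>"
proof (rule ccontr)
  assume m1: "m \<noteq> \<one>"
  let ?x = "g \<otimes> x \<otimes> inv g" and ?u = "g \<otimes> m \<otimes> inv g"
  have mc: "m \<in> carrier G" using Mc m by blast
  have xc: "?x \<in> carrier G" and uc: "?u \<in> carrier G" using g x mc by auto
  have x1: "?x \<noteq> \<one>" and u1: "?u \<noteq> \<one>"
    using conj_inv_cancel[OF g(1) x(1)] conj_inv_cancel[OF g(1) mc] x(2) m1 g by auto
  have xu: "?x \<otimes> ?u = ?u \<otimes> ?x" using conj_commute_iff[OF g(1) x(1) mc] m(1) by (auto simp: M_iff)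
  have "centralizer G {?u} \<noteq> carrier G" using centralizer_eq_carrier_iff[OF uc] center_trivial u1 by blast
  moreover have "x \<in> centralizer G {?u}" using m(2) x by (auto simp: M_iff mem_centralizer1_iff)
  ultimately have "centralizer G {?u} \<subseteq> M" using subset_M[OF subgroup_centralizer1[OF uc]] by blast
  then have xM: "?x \<in> M" using xu xc by (auto simp: mem_centralizer1_iff)
  have ne: "centralizer G {?x} \<noteq> carrier G" using centralizer_eq_carrier_iff[OF xc] center_trivial x1 by blast
  have sub: "M \<subseteq> centralizer G {?x}"
  proof
    fix k assume k: "k \<in> M"
    then show "k \<in> centralizer G {?x}"
      using not_adjacentD[OF conjugate_isolated[OF g(1)], of k M] M_sub M_proper xM Mc
      by (metis mem_centralizer1_iff)
  qed
  have "centralizer G {?x} \<subseteq> M"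
    using subset_M[OF subgroup_centralizer1[OF xc] ne] sub x_M by blast
  then have MM: "centralizer G {?x} = M" using sub by blast
  have conjM: "k \<in> M \<longleftrightarrow> g \<otimes> k \<otimes> inv g \<in> M" if k: "k \<in> carrier G" for k
  proof -
    have "g \<otimes> k \<otimes> inv g \<in> M \<longleftrightarrow> g \<otimes> k \<otimes> inv g \<in> centralizer G {?x}" by (simp only: MM)
    then show ?thesis
      using conj_commute_iff[OF g(1) k x(1)] k g(1) x(1) by (simp only: M_iff mem_centralizer1_iff m_closed inv_closed simp_thms)
  qed
  \<comment> \<open>The normalizer of \<open>M\<close> contains \<open>x\<close>, but also
    \<open>g\<close>, which lies outside of \<open>M\<close>; so it is all of \<open>G\<close>, and
    a normal \<open>M\<close> contradicts core-freeness.\<close>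
  let ?N = "{h \<in> carrier G. \<forall>d\<in>M. h \<otimes> d \<otimes> inv h \<in> M \<and> inv h \<otimes> d \<otimes> h \<in> M}"
  have N: "subgroup ?N G" by (rule subgroup_normalizer) (use Mc in blast)
  have "inv g \<otimes> d \<otimes> g \<in> M" if d: "d \<in> M" for d
    using conjM[of "inv g \<otimes> d \<otimes> g"] conj_inv_cancel2[OF g(1) Mc[OF d]] d g(1) Mc[OF d] by simp
  then have "g \<in> ?N" using conjM Mc g(1) by blast
  moreover have "x \<in> ?N"
  proof -
    have "x \<otimes> d \<otimes> inv x \<in> M \<and> inv x \<otimes> d \<otimes> x \<in> M" if d: "d \<in> M" for d
      using subgroup.m_closed[OF M_sub] subgroup.m_inv_closed[OF M_sub] x_M d by blast
    then show ?thesis using x by blast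
  qed
  ultimately have "?N = carrier G" using subset_M[OF N] g(2) by blast
  then have "M \<lhd> G" unfolding normal_inv_iff using M_sub by blast
  then have "M = {\<one>}" using M_core_free unfolding core_free_def by blast
  then show False using x_M x by blast
qed

theorem not_finite: "infinite (carrier G)"
proof
  assume fin: "finite (carrier G)"
  interpret frobenius_complement G M
    by (intro frobenius_complement.intro frobenius_complement_axioms.intro is_group
        fin M_sub M_proper M_trivial_intersection)
  have "\<exists>S. (S \<lhd> G \<and> S \<noteq> {\<one>}) \<and> (\<forall>T. T \<lhd> G \<and> T \<noteq> {\<one>} \<longrightarrow> card S \<le> card T)"
    by (rule ex_has_least_nat[of _ "carrier G"]) (use normal_self x in blast)
  then obtain S where S: "S \<lhd> G" "S \<noteq> {\<one>}" and minimal: "\<And>T. \<lbrakk>T \<lhd> G; T \<noteq> {\<one>}\<rbrakk> \<Longrightarrow> card S \<le> card T" by blast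
  have Ssub: "subgroup S G" using S normal_imp_subgroup by blast
  have Sc: "s \<in> carrier G" if "s \<in> S" for s using mem_subgroup[OF Ssub that] .
  have finS: "finite S" using finite_subset[OF subgroup.subset[OF Ssub] fin] .
  have min_eq: "T = S" if "T \<lhd> G" "T \<noteq> {\<one>}" "T \<subseteq> S" for T
    using card_seteq[OF finS that(3) minimal[OF that(1,2)]] .
  have MS: "d = \<one>" if d: "d \<in> M" "d \<in> S" for d
  proof (rule ccontr)
    assume d1: "d \<noteq> \<one>"
    \<comment> \<open>\<open>L \<inter> S\<close> omits \<open>d\<close>, so by minimality of
      \<open>S\<close> it is trivial. All commutators \<open>[l, s]\<close> then vanish and
      \<open>L\<close> centralizes \<open>S\<close>, against \<open>cent\<close>.\<close>
    obtain L where L: "L \<lhd> G" "L \<noteq> {\<one>}" "d \<notin> L" using exists_normal_avoiding[OF d(1) d1] by blast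
    have "L \<inter> S = {\<one>}"
      using min_eq[OF normal_subgroup_intersect[OF L(1) S(1)]] L(3) d(2) by blast
    moreover have "l \<otimes> s \<otimes> inv l \<otimes> inv s \<in> L \<inter> S" if l: "l \<in> L" and s: "s \<in> S" for l s
    proof -
      have lc: "l \<in> carrier G" and sc: "s \<in> carrier G" using mem_normal[OF L(1) l] Sc[OF s] by auto
      have "l \<otimes> s \<otimes> inv l \<in> S" using normal_conj[OF S(1) lc s] .
      then have 1: "l \<otimes> s \<otimes> inv l \<otimes> inv s \<in> S" using subgroup.m_closed[OF Ssub] subgroup.m_inv_closed[OF Ssub s] by blast
      have Lsub: "subgroup L G" using L normal_imp_subgroup by blast
      have "s \<otimes> inv l \<otimes> inv s \<in> L" using normal_conj[OF L(1) sc subgroup.m_inv_closed[OF Lsub l]] .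
      then have "l \<otimes> (s \<otimes> inv l \<otimes> inv s) \<in> L" using subgroup.m_closed[OF Lsub l] by blast
      then show ?thesis using 1 lc sc by (simp add: m_assoc)
    qed
    ultimately have com: "l \<otimes> s \<otimes> inv l \<otimes> inv s = \<one>" if "l \<in> L" "s \<in> S" for l s using that by blast
    have "L \<subseteq> centralizer G S"
    proof
      fix l assume l: "l \<in> L"
      have lc: "l \<in> carrier G" using mem_normal[OF L(1) l] .
      have "l \<otimes> s = s \<otimes> l" if s: "s \<in> S" for s
        using commutator_eq_one_iff[OF lc Sc[OF s]] com[OF l s] by (simp add: commutator_def)
      then show "l \<in> centralizer G S" using lc by (simp add: mem_centralizer_iff)
    qed
    then have "L \<subseteq> {\<one>}" using cent[OF S] by blast
    then show False using L(1,2) subgroup.one_closed[OF normal_imp_subgroup[OF L(1)]] by blast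
  qed
  let ?S = "G\<lparr>carrier := S\<rparr>"
  interpret S: group ?S by (rule subgroup.subgroup_is_group[OF Ssub is_group])
  let ?t = "\<lambda>k. k \<otimes> x \<otimes> inv k \<otimes> inv x"
  have tS: "?t k \<in> S" if k: "k \<in> S" for k
  proof -
    have "x \<otimes> inv k \<otimes> inv x \<in> S" using normal_conj[OF S(1) x(1) subgroup.m_inv_closed[OF Ssub k]] .
    then have "k \<otimes> (x \<otimes> inv k \<otimes> inv x) \<in> S" using subgroup.m_closed[OF Ssub k] by blast
    then show ?thesis using Sc[OF k] x by (simp add: m_assoc)
  qed
  \<comment> \<open>\<open>[k, x] = [l, x]\<close> means that \<open>l^-1 k\<close> centralizes
    \<open>x\<close>, so it lies in \<open>M\<close> and in \<open>S\<close>.\<close>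
  have inj: "inj_on ?t S"
  proof (rule inj_onI)
    fix k l assume k: "k \<in> S" and l: "l \<in> S" and e: "?t k = ?t l"
    have c: "k \<in> carrier G" "l \<in> carrier G" using Sc k l by auto
    have "k \<otimes> x \<otimes> inv k = l \<otimes> x \<otimes> inv l" using e c x by (simp add: right_cancel)
    then have "inv l \<otimes> (k \<otimes> x \<otimes> inv k) \<otimes> inv (inv l) = x" using conj_inv_cancel[OF c(2) x(1)] by simp
    then have "(inv l \<otimes> k) \<otimes> x \<otimes> inv (inv l \<otimes> k) = x" using conj_conj[of "inv l" k x] c x by simp
    then have "inv l \<otimes> k \<in> M" using conj_eq_self_iff[of "inv l \<otimes> k" x] c x by (simp add: M_iff)
    moreover have "inv l \<otimes> k \<in> S" using subgroup.m_closed[OF Ssub] subgroup.m_inv_closed[OF Ssub] k l by blast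
    ultimately have "inv l \<otimes> k = \<one>" using MS by blast
    then show "k = l" using c by (metis inv_closed inv_inv inv_equality)
  qed
  have surj: "?t ` S = S" by (rule endo_inj_surj[OF finS _ inj]) (rule image_subsetI, rule tS)
  have "card S \<noteq> 1" using S(2) subgroup.one_closed[OF Ssub] by (metis card_1_singletonE singletonD)
  then obtain r where r: "prime r" "r dvd card S" using prime_factor_nat by blast
  have S0: "card S \<noteq> 0" using finS subgroup.one_closed[OF Ssub] by auto
  define a where "a = multiplicity r (card S)"
  obtain m where m: "card S = r ^ a * m" "\<not> r dvd m"
    using multiplicity_decompose'[of "card S" r] S0 r unfolding a_def by (metis not_prime_unit)
  have a0: "a \<noteq> 0" using m r(2) by (metis mult_1 power_0)
  have "\<exists>R. subgroup R ?S \<and> card R = r ^ a"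
    by (rule sylow_thm[OF r(1) S.is_group, of a m]) (use m(1) finS in \<open>auto simp: Coset.order_def\<close>)
  then obtain R where R: "subgroup R ?S" "card R = r ^ a" by blast
  have RG: "subgroup R G" using incl_subgroup[OF Ssub R(1)] .
  have RS: "R \<subseteq> S" using subgroup.subset[OF R(1)] by simp
  \<comment> \<open>\<open>R\<close> and its conjugate by \<open>x\<close> are Sylow subgroups of
    \<open>S\<close>, so \<open>s x\<close> normalizes \<open>R\<close> for some
    \<open>s \<in> S\<close>. Writing \<open>s = [k, x]\<close> gives \<open>s x = k x k^-1\<close>;
    hence \<open>x\<close> normalizes \<open>k^-1 R k\<close>, called \<open>?R\<close>
    below.\<close>
  let ?T = "(\<lambda>h. x \<otimes> h \<otimes> inv x) ` R"
  have TG: "subgroup ?T G" using conj_subgroup[OF RG x(1)] .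
  have TS: "?T \<subseteq> S" using normal_conj[OF S(1) x(1)] RS by blast
  have T: "subgroup ?T ?S" using subgroup_incl[OF TG Ssub TS] .
  have conj_inj: "inj_on (\<lambda>h. g \<otimes> h \<otimes> inv g) H" if "g \<in> carrier G" "H \<subseteq> carrier G" for g H
    using that by (intro inj_onI) (metis conj_inv_cancel subsetD)
  have Tcard: "card ?T = r ^ a"
    using card_image[OF conj_inj[OF x(1), of R]] R(2) RS Sc by auto
  obtain s where s: "s \<in> S" "(\<lambda>t. s \<otimes> t \<otimes> inv s) ` ?T = R"
    using S.sylow_conjugate[OF _ R(1) T r(1) R(2) Tcard, of m] finS m m_inv_consistent[OF Ssub] by auto
  obtain k where k: "k \<in> S" "s = ?t k" using surj s(1) by blast
  have c: "s \<in> carrier G" "k \<in> carrier G" using s k Sc by auto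
  have sx: "s \<otimes> x = k \<otimes> x \<otimes> inv k" using k c x by (simp add: m_assoc)
  have norm: "(\<lambda>h. (s \<otimes> x) \<otimes> h \<otimes> inv (s \<otimes> x)) ` R = R"
  proof -
    have "(\<lambda>h. (s \<otimes> x) \<otimes> h \<otimes> inv (s \<otimes> x)) ` R = (\<lambda>t. s \<otimes> t \<otimes> inv s) ` ?T"
      unfolding image_image using conj_conj[OF c(1) x(1)] RS Sc by (intro image_cong) auto
    then show ?thesis using s(2) by simp
  qed
  let ?R = "(\<lambda>h. inv k \<otimes> h \<otimes> inv (inv k)) ` R"
  have R': "subgroup ?R G" using conj_subgroup[OF RG inv_closed[OF c(2)]] .
  have R'S: "?R \<subseteq> S" using normal_conj[OF S(1) inv_closed[OF c(2)]] RS by blast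
  have R'c: "?R \<subseteq> carrier G" using R'S Sc by blast
  have R'card: "card ?R = r ^ a" using card_image[OF conj_inj[OF inv_closed[OF c(2)], of R]] R(2) RS Sc by auto
  have R'1: "?R \<noteq> {\<one>}" using R'card a0 r(1) by (metis card_1_singleton_iff nat_power_eq_Suc_0_iff One_nat_def not_prime_1)
  have xR: "x \<otimes> d \<otimes> inv x \<in> ?R" if d: "d \<in> ?R" for d
  proof -
    obtain h where h: "h \<in> R" "d = inv k \<otimes> h \<otimes> k" using d c by auto
    have hc: "h \<in> carrier G" using h RS Sc by blast
    have "(s \<otimes> x) \<otimes> h \<otimes> inv (s \<otimes> x) \<in> R" using norm h by blast
    then have "inv k \<otimes> ((s \<otimes> x) \<otimes> h \<otimes> inv (s \<otimes> x)) \<otimes> inv (inv k) \<in> ?R" by blast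
    moreover have "inv k \<otimes> ((s \<otimes> x) \<otimes> h \<otimes> inv (s \<otimes> x)) \<otimes> inv (inv k) = x \<otimes> d \<otimes> inv x"
      unfolding sx h(2) using c x hc by (simp add: inv_mult_group m_assoc inv_mult_cancel)
    ultimately show ?thesis by simp
  qed
  have finR: "finite ?R" using finite_subset[OF R'S finS] .
  have xR_eq: "(\<lambda>d. x \<otimes> d \<otimes> inv x) ` ?R = ?R"
    using endo_inj_surj[OF finR _ conj_inj[OF x(1) R'c]] xR by blast
  have xR': "inv x \<otimes> d \<otimes> x \<in> ?R" if d: "d \<in> ?R" for d
  proof -
    obtain h where h: "h \<in> ?R" "d = x \<otimes> h \<otimes> inv x" using d xR_eq by blast
    have "inv x \<otimes> d \<otimes> inv (inv x) = h" unfolding h(2) using conj_inv_cancel[OF x(1)] h(1) R'c by blast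
    then show ?thesis using h(1) x by simp
  qed
  let ?N = "{g \<in> carrier G. \<forall>d\<in>?R. g \<otimes> d \<otimes> inv g \<in> ?R \<and> inv g \<otimes> d \<otimes> g \<in> ?R}"
  have N: "subgroup ?N G" by (rule subgroup_normalizer[OF R'c])
  have xN: "x \<in> ?N" using x xR xR' by blast
  have RN: "?R \<subseteq> ?N"
  proof
    fix g assume g: "g \<in> ?R"
    have "g \<otimes> d \<otimes> inv g \<in> ?R \<and> inv g \<otimes> d \<otimes> g \<in> ?R" if d: "d \<in> ?R" for d
      by (intro conjI subgroup.m_closed[OF R'] subgroup.m_inv_closed[OF R'] g d)
    then show "g \<in> ?N" using g R'c by blast
  qed
  \<comment> \<open>If the normalizer is \<open>G\<close>, minimality makes \<open>S\<close> the
    group \<open>?R\<close> of prime power order, whose centre contradicts \<open>cent\<close>.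
    Otherwise it is a proper subgroup containing \<open>x\<close>, so
    \<open>?R \<subseteq> M\<close>, against \<open>MS\<close>.\<close>
  show False
  proof (cases "?N = carrier G")
    case True
    then have "?R \<lhd> G" unfolding normal_inv_iff using R' by blast
    then have RS': "?R = S" using min_eq R'1 R'S by blast
    have "\<exists>z\<in>carrier ?S. z \<noteq> \<one>\<^bsub>?S\<^esub> \<and> (\<forall>g\<in>carrier ?S. z \<otimes>\<^bsub>?S\<^esub> g = g \<otimes>\<^bsub>?S\<^esub> z)"
      by (rule S.primepow_card_center[OF r(1), of a]) (use R'card RS' S(2) in auto)
    then obtain z where z: "z \<in> S" "z \<noteq> \<one>" "\<And>g. g \<in> S \<Longrightarrow> z \<otimes> g = g \<otimes> z" by auto
    then have "z \<in> centralizer G S" using Sc by (simp add: mem_centralizer_iff)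
    then show False using cent[OF S] z by blast
  next
    case False
    then have "?R \<subseteq> M" using subset_M[OF N _ xN] RN by blast
    then have "?R \<subseteq> {\<one>}" using MS R'S by blast
    then show False using R'1 subgroup.one_closed[OF R'] by blast
  qed
qed

end

section \<open>Distances and components in digraphs\<close>

lemma reach_restrict:
  assumes "\<And>x y. x \<in> S \<Longrightarrow> E x y \<Longrightarrow> y \<in> S" "x \<in> S" "reach E n x y"
  shows "reach (\<lambda>x y. x \<in> S \<and> y \<in> S \<and> E x y) n x y"
  using assms(2,3)
proof (induction n arbitrary: x)
  case (Suc n)
  then show ?case using assms(1) by (auto; blast)
qed simp

context wf_digraph
begin

lemma awalk_imp_reach: "awalk u p v \<Longrightarrow> reach (dominates G) (length p) u v"
proof (induction p arbitrary: u)
  case (Cons e p)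
  then have e: "e \<in> arcs G" "u = tail G e" "awalk (head G e) p v" by (auto simp: awalk_Cons_iff)
  then have "dominates G u (head G e)" by (auto intro: in_arcs_imp_in_arcs_ends)
  then show ?case using Cons.IH[OF e(3)] by auto
qed (auto simp: awalk_Nil_iff)

lemma reach_imp_awalk:
  assumes "u \<in> verts G" "reach (dominates G) n u v"
  shows "\<exists>p. awalk u p v \<and> length p \<le> n"
  using assms
proof (induction n arbitrary: u)
  case (Suc n)
  show ?case
  proof (cases "u = v")
    case True
    then show ?thesis using Suc.prems by (intro exI[of _ "[]"]) (simp add: awalk_Nil_iff)
  next
    case False
    then obtain w where w: "dominates G u w" "reach (dominates G) n w v" using Suc.prems by auto
    from w(1) obtain e where e: "e \<in> arcs G" "tail G e = u" "head G e = w" by auto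
    obtain p where "awalk w p v" "length p \<le> n" using Suc.IH[OF _ w(2)] e by auto
    then show ?thesis using e by (intro exI[of _ "e # p"]) (simp add: awalk_Cons_iff)
  qed
qed (auto simp: awalk_Nil_iff intro!: exI[of _ "[]"])

lemma unit_awalk_cost: "awalk_cost (\<lambda>_. 1) p = length p"
  by (induction p) auto

lemma unit_distance_le:
  assumes "u \<in> verts G" "reach (dominates G) n u v"
  shows "\<mu> (\<lambda>_. 1) u v \<le> ereal n"
proof -
  obtain p where p: "awalk u p v" "length p \<le> n" using reach_imp_awalk[OF assms] by blast
  have "\<mu> (\<lambda>_. 1) u v \<le> ereal (length p)" using min_cost_le_walk_cost[OF p(1), of "\<lambda>_. 1"] by (simp add: unit_awalk_cost)
  also have "\<dots> \<le> ereal n" using p(2) by simp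
  finally show ?thesis .
qed

lemma unit_distance_ge:
  assumes "\<not> reach (dominates G) n u v"
  shows "ereal (Suc n) \<le> \<mu> (\<lambda>_. 1) u v"
  unfolding \<mu>_def
proof (rule INF_greatest)
  fix p assume "p \<in> {p. awalk u p v}"
  then have "reach (dominates G) (length p) u v" using awalk_imp_reach by blast
  then have "\<not> length p \<le> n" using assms reach_mono[of "dominates G" "length p" u v n] by blast
  then show "ereal (Suc n) \<le> ereal (awalk_cost (\<lambda>_. 1) p)" by (simp add: unit_awalk_cost)
qed

text \<open>\<open>k\<close> is the least uniform bound on distances, and a pair violating the bound
  \<open>k - 1\<close> attains the supremum. The pair \<open>u\<close>, \<open>v\<close> rules out
  \<open>k \<le> 1\<close>.\<close>

lemma diameter_nat:
  assumes all: "\<And>u v. \<lbrakk>u \<in> verts G; v \<in> verts G\<rbrakk> \<Longrightarrow> reach (dominates G) n u v"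
    and uv: "u \<in> verts G" "v \<in> verts G" "\<not> reach (dominates G) 1 u v"
  shows "\<exists>k\<in>{2..n}. diameter G = ereal k"
proof -
  let ?P = "\<lambda>k. \<forall>u\<in>verts G. \<forall>v\<in>verts G. reach (dominates G) k u v"
  define k where "k = (LEAST k. ?P k)"
  have P: "?P n" using all by blast
  then have k: "?P k" and kn: "k \<le> n" unfolding k_def by (rule LeastI, rule Least_le)
  have k2: "2 \<le> k"
  proof (rule ccontr)
    assume "\<not> 2 \<le> k"
    then show False using k uv reach_mono[of "dominates G" k u v 1] by simp
  qed
  then obtain j where j: "k = Suc j" using not0_implies_Suc[of k] by auto
  have "\<not> ?P j" using not_less_Least[of j ?P] j unfolding k_def by simp
  then obtain a b where ab: "a \<in> verts G" "b \<in> verts G" "\<not> reach (dominates G) j a b" by blast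
  have "diameter G = ereal k"
  proof (rule antisym)
    show "diameter G \<le> ereal k" unfolding diameter_def using unit_distance_le k by (intro SUP_least) blast
    have "ereal k \<le> \<mu> (\<lambda>_. 1) a b" using unit_distance_ge[OF ab(3)] j by simp
    also have "\<dots> \<le> diameter G" unfolding diameter_def using ab by (meson SUP_upper SUP_upper2)
    finally show "ereal k \<le> diameter G" .
  qed
  then show ?thesis using k2 kn by auto
qed

lemma connected_if_reach:
  assumes "verts G \<noteq> {}" "\<And>u v. \<lbrakk>u \<in> verts G; v \<in> verts G\<rbrakk> \<Longrightarrow> reach (dominates G) n u v"
  shows "Digraph_Component.connected G"
  unfolding Digraph_Component.connected_def strongly_connected_def
proof (intro conjI ballI)
  fix u v assume "u \<in> verts (with_proj (mk_symmetric G))" "v \<in> verts (with_proj (mk_symmetric G))"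
  then have uv: "u \<in> verts G" "v \<in> verts G" by auto
  obtain p where "awalk u p v" using reach_imp_awalk[OF uv(1) assms(2)[OF uv]] by blast
  then have "u \<rightarrow>\<^sup>* v" using reachable_awalk by blast
  then show "u \<rightarrow>\<^sup>*\<^bsub>with_proj (mk_symmetric G)\<^esub> v" by (rule reachable_mk_symmetricI)
qed (use assms in simp)

lemma connected_subgraph_verts:
  assumes closed: "\<And>e. e \<in> arcs G \<Longrightarrow> tail G e \<in> S \<longleftrightarrow> head G e \<in> S"
    and H: "subgraph H G" "Digraph_Component.connected H" and u: "u \<in> verts H" "u \<in> S"
  shows "verts H \<subseteq> S"
proof
  fix v assume v: "v \<in> verts H"
  have step: "a \<in> S \<longleftrightarrow> b \<in> S" if "(a, b) \<in> (arcs_ends H)\<^sup>s" for a b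
  proof -
    have "(a, b) \<in> arcs_ends H \<or> (b, a) \<in> arcs_ends H" using that by (auto simp: symcl_def)
    then have "dominates G a b \<or> dominates G b a" using adj_mono[OF _ H(1)] by blast
    then show ?thesis using closed by auto
  qed
  have "(u, v) \<in> rtrancl_on (verts H) ((arcs_ends H)\<^sup>s)" using H(2) u v unfolding connected_conv by blast
  then show "v \<in> S" by (induction rule: rtrancl_on_induct) (use u step in auto)
qed

lemma subgraph_induce_subgraphI:
  assumes "subgraph H G" "verts H \<subseteq> S"
  shows "subgraph H (G \<restriction> S)"
proof -
  interpret H: wf_digraph H using assms by auto
  have "tail H = tail G" "head H = head G" using assms by (auto simp: compatible_def)
  then show ?thesis using assms H.wellformed wellformed_induce_subgraph[of S]
    by (auto simp: subgraph_def compatible_def subset_iff)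
qed

lemma max_connected_subgraph_closed_iff:
  assumes closed: "\<And>e. e \<in> arcs G \<Longrightarrow> tail G e \<in> S \<longleftrightarrow> head G e \<in> S"
    and S: "S \<subseteq> verts G" "Digraph_Component.connected (G \<restriction> S)"
  shows "max_subgraph Digraph_Component.connected (G \<restriction> S)"
    and "\<lbrakk>max_subgraph Digraph_Component.connected H; u \<in> verts H; u \<in> S\<rbrakk> \<Longrightarrow> H = G \<restriction> S"
proof -
  have sub: "subgraph (G \<restriction> S) G"
    using S(1) wf_digraph_axioms wellformed_induce_subgraph[of S] by (auto simp: subgraph_def compatible_def)
  obtain u0 where u0: "u0 \<in> S" using S(2) by (auto simp: connected_conv)
  show "max_subgraph Digraph_Component.connected (G \<restriction> S)"
    unfolding max_subgraph_def
  proof (intro conjI allI impI notI)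
    fix H' assume H': "H' \<noteq> G \<restriction> S \<and> subgraph (G \<restriction> S) H'" "subgraph H' G \<and> Digraph_Component.connected H'"
    have v: "S \<subseteq> verts H'" using H'(1) by (auto simp: subgraph_def)
    then have "verts H' \<subseteq> S" using connected_subgraph_verts[OF closed, of H' u0] H'(2) u0 by blast
    then have "subgraph H' (G \<restriction> S)" using subgraph_induce_subgraphI H'(2) by blast
    then have "H' = G \<restriction> S" using H'(1) by (intro pre_digraph.equality) (auto simp: subgraph_def compatible_def)
    then show False using H'(1) by blast
  qed (use sub S in auto)
  assume H: "max_subgraph Digraph_Component.connected H" and u: "u \<in> verts H" "u \<in> S"
  have HG: "subgraph H G" "Digraph_Component.connected H" using H unfolding max_subgraph_def by auto
  have "subgraph H (G \<restriction> S)" using subgraph_induce_subgraphI[OF HG(1)] connected_subgraph_verts[OF closed HG u] by blast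
  then show "H = G \<restriction> S" using H sub S(2) unfolding max_subgraph_def by metis
qed

lemma two_connected_components:
  assumes "\<And>e. e \<in> arcs G \<Longrightarrow> tail G e \<in> S \<longleftrightarrow> head G e \<in> S"
    and "S \<union> T = verts G" "S \<inter> T = {}"
    and "Digraph_Component.connected (G \<restriction> S)" "Digraph_Component.connected (G \<restriction> T)"
  shows "connected_components G = {G \<restriction> S, G \<restriction> T}"
proof -
  have closed: "tail G e \<in> T \<longleftrightarrow> head G e \<in> T" if "e \<in> arcs G" for e
    using assms(1)[OF that] assms(2,3) wellformed[OF that] by blast
  have S: "S \<subseteq> verts G" and T: "T \<subseteq> verts G" using assms(2) by auto
  have "H = G \<restriction> S \<or> H = G \<restriction> T" if H: "max_subgraph Digraph_Component.connected H" for H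
  proof -
    have "verts H \<noteq> {}" "verts H \<subseteq> verts G" using H by (auto simp: max_subgraph_def connected_conv subgraph_def)
    then obtain u where u: "u \<in> verts H" "u \<in> S \<union> T" using assms(2) by blast
    then show ?thesis
      using max_connected_subgraph_closed_iff(2)[OF assms(1) S assms(4) H u(1)]
        max_connected_subgraph_closed_iff(2)[OF closed T assms(5) H u(1)] by blast
  qed
  then show ?thesis
    using max_connected_subgraph_closed_iff(1)[OF assms(1) S assms(4)]
      max_connected_subgraph_closed_iff(1)[OF closed T assms(5)]
    unfolding connected_components_def by blast
qed

end

section \<open>Induced subgraphs of the non-commuting, non-generating graph\<close>

lemma verts_Xi [simp]: "verts (Xi G) = carrier G - center G"
  by (simp add: Xi_def)

context group
begin

lemma arcs_Xi: "arcs (Xi G) = {(x, y). adjacent G x y}"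
  unfolding adjacent_arcs_iff by (auto simp: Xi_def)

lemma ends_Xi [simp]: "tail (Xi G) = fst" "head (Xi G) = snd"
  by (simp_all add: Xi_def)

lemma dominates_induced_Xi:
  "dominates (Xi G \<restriction> S) x y \<longleftrightarrow> x \<in> S \<and> y \<in> S \<and> adjacent G x y"
  by (auto simp: arcs_ends_def arc_to_ends_def arcs_Xi image_iff)

lemma isolated_Xi_iff:
  "isolated (Xi G) x \<longleftrightarrow> x \<in> carrier G \<and> x \<notin> center G \<and> (\<forall>y. \<not> adjacent G x y)"
  unfolding isolated_def in_arcs_def out_arcs_def arcs_Xi ends_Xi using adjacent_sym by auto

lemma Xi_induced: "Xi G = Xi G \<restriction> (carrier G - center G)"
  using adjacent_carrier adjacent_not_center
  by (intro pre_digraph.equality) (auto simp: arcs_Xi)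

lemma Xi_plus_induced: "Xi_plus G = Xi G \<restriction> {x. \<exists>y. adjacent G x y}"
proof -
  have "{v \<in> verts (Xi G). \<not> isolated (Xi G) v} = {x. \<exists>y. adjacent G x y}"
    using adjacent_carrier adjacent_not_center by (auto simp: isolated_Xi_iff)
  then show ?thesis by (simp only: Xi_plus_def remove_isolated_def)
qed

text \<open>\<open>inv x\<close> is a neighbour of \<open>y\<close> as well, but commutes with
  \<open>x\<close>.\<close>

lemma not_adjacent_inv_pair:
  assumes xy: "adjacent G x y" and S: "x \<in> S" "\<And>u v. u \<in> S \<Longrightarrow> adjacent G u v \<Longrightarrow> v \<in> S" and "inv x \<noteq> x"
  shows "\<exists>u\<in>S. \<exists>v\<in>S. u \<noteq> v \<and> \<not> adjacent G u v"
proof -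
  have x: "x \<in> carrier G" and y: "y \<in> carrier G" using adjacent_carrier[OF xy] by auto
  obtain H where H: "subgroup H G" "H \<noteq> carrier G" "x \<in> H" "y \<in> H" using xy by (rule adjacentE)
  have "inv x \<otimes> y \<noteq> y \<otimes> inv x"
  proof
    assume e: "inv x \<otimes> y = y \<otimes> inv x"
    have "x \<otimes> (inv x \<otimes> y) \<otimes> x = x \<otimes> (y \<otimes> inv x) \<otimes> x" unfolding e ..
    then have "y \<otimes> x = x \<otimes> y" using x y by (simp add: m_assoc inv_mult_cancel)
    then show False using adjacent_not_commute[OF xy] by simp
  qed
  then have "adjacent G y (inv x)"
    using adjacent_sym[OF adjacentI[OF H(1,2) subgroup.m_inv_closed[OF H(1,3)] H(4)]] by blast
  then have "inv x \<in> S" using S xy by blast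
  moreover have "\<not> adjacent G x (inv x)" using adjacent_not_commute[of x "inv x"] x by auto
  ultimately show ?thesis using S(1) assms(4) by metis
qed

text \<open>One of \<open>x\<close>, \<open>y\<close>, \<open>x \<otimes> y\<close> is not its own
  inverse, since otherwise \<open>x\<close> and \<open>y\<close> would commute; each of the three
  has a neighbour among the others. This is behind the lower bound \<open>2\<close> for all
  diameters.\<close>

lemma not_adjacent_pair:
  assumes xy: "adjacent G x y" and S: "x \<in> S" "\<And>u v. u \<in> S \<Longrightarrow> adjacent G u v \<Longrightarrow> v \<in> S"
  shows "\<exists>u\<in>S. \<exists>v\<in>S. u \<noteq> v \<and> \<not> adjacent G u v"
proof -
  have x: "x \<in> carrier G" and y: "y \<in> carrier G" using adjacent_carrier[OF xy] by auto
  have yS: "y \<in> S" using S xy by blast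
  have com: "x \<otimes> y \<noteq> y \<otimes> x" using adjacent_not_commute[OF xy] .
  obtain H where H: "subgroup H G" "H \<noteq> carrier G" "x \<in> H" "y \<in> H" using xy by (rule adjacentE)
  have "x \<otimes> (x \<otimes> y) \<noteq> (x \<otimes> y) \<otimes> x" using com x y by (simp add: m_assoc)
  then have xp: "adjacent G x (x \<otimes> y)" using adjacentI[OF H(1,2,3) subgroup.m_closed[OF H(1,3,4)]] by blast
  have pS: "x \<otimes> y \<in> S" using S xp by blast
  consider "inv x \<noteq> x" | "inv y \<noteq> y" | "inv (x \<otimes> y) \<noteq> x \<otimes> y"
    using com inv_mult_group[OF x y] by (cases "inv x = x"; cases "inv y = y") auto
  then show ?thesis
  proof cases
    case 1
    show ?thesis by (rule not_adjacent_inv_pair[OF xy S 1])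
  next
    case 2
    show ?thesis by (rule not_adjacent_inv_pair[OF adjacent_sym[OF xy] yS S(2) 2])
  next
    case 3
    show ?thesis by (rule not_adjacent_inv_pair[OF adjacent_sym[OF xp] pS S(2) 3])
  qed
qed

lemma diameter_induced_Xi:
  assumes closed: "\<And>u v. u \<in> S \<Longrightarrow> adjacent G u v \<Longrightarrow> v \<in> S"
    and xy: "x \<in> S" "adjacent G x y"
    and reach: "\<And>u v. \<lbrakk>u \<in> S; v \<in> S\<rbrakk> \<Longrightarrow> reach (adjacent G) n u v"
  shows "\<exists>k\<in>{2..n}. diameter (Xi G \<restriction> S) = ereal k" and "Digraph_Component.connected (Xi G \<restriction> S)"
proof -
  interpret Xi: wf_digraph "Xi G" by (rule wf_digraph_Xi)
  interpret wf_digraph "Xi G \<restriction> S" by (rule Xi.wellformed_induce_subgraph)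
  have dom: "dominates (Xi G \<restriction> S) = (\<lambda>x y. x \<in> S \<and> y \<in> S \<and> adjacent G x y)"
    using dominates_induced_Xi by blast
  have all: "reach (dominates (Xi G \<restriction> S)) n u v" if "u \<in> verts (Xi G \<restriction> S)" "v \<in> verts (Xi G \<restriction> S)" for u v
    unfolding dom by (rule reach_restrict[OF closed]) (use that reach in auto)
  have "\<exists>u\<in>S. \<exists>v\<in>S. u \<noteq> v \<and> \<not> adjacent G u v"
    by (rule not_adjacent_pair[OF xy(2,1)]) (rule closed)
  then obtain u v where uv: "u \<in> S" "v \<in> S" "u \<noteq> v" "\<not> adjacent G u v" by blast
  show "\<exists>k\<in>{2..n}. diameter (Xi G \<restriction> S) = ereal k"
    by (rule diameter_nat[OF all, of u v]) (use uv in \<open>auto simp: dominates_induced_Xi\<close>)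
  show "Digraph_Component.connected (Xi G \<restriction> S)"
    by (rule connected_if_reach[OF _ all]) (use xy in auto)
qed

end

section \<open>Central quotients\<close>

text \<open>The last nontrivial term of the derived series.\<close>

lemma (in group) solvable_imp_abelian_normal:
  assumes "solvable G" "carrier G \<noteq> {\<one>}"
  shows "\<exists>A. A \<lhd> G \<and> A \<noteq> {\<one>} \<and> (\<forall>a\<in>A. \<forall>b\<in>A. a \<otimes> b = b \<otimes> a)"
proof -
  let ?D = "\<lambda>n. (derived G ^^ n) (carrier G)"
  obtain n where n: "?D n = {\<one>}" using assms(1) solvable_iff_trivial_derived_seq by blast
  define m where "m = (LEAST n. ?D n = {\<one>})"
  have m: "?D m = {\<one>}" unfolding m_def by (rule LeastI[of _ n]) (rule n)
  obtain k where k: "m = Suc k" using m assms(2) by (cases m) auto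
  have ne: "?D k \<noteq> {\<one>}" using not_less_Least[of k "\<lambda>n. ?D n = {\<one>}"] k unfolding m_def[symmetric] by simp
  have nrm: "?D i \<lhd> G" for i
    by (induction i) (simp_all add: normal_self derived_is_normal)
  have "a \<otimes> b = b \<otimes> a" if ab: "a \<in> ?D k" "b \<in> ?D k" for a b
  proof -
    have c: "a \<in> carrier G" "b \<in> carrier G" using mem_normal[OF nrm] ab by blast+
    have "a \<otimes> b \<otimes> inv a \<otimes> inv b \<in> derived_set G (?D k)"
      by (intro UN_I[OF ab(1)] UN_I[OF ab(2)] singletonI)
    then have "a \<otimes> b \<otimes> inv a \<otimes> inv b \<in> derived G (?D k)"
      unfolding derived_def[of G "?D k"] by (rule generate.incl)
    then have "commutator G a b = \<one>" using m k by (simp add: commutator_def)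
    then show ?thesis using commutator_eq_one_iff c by blast
  qed
  then show ?thesis using ne nrm by blast
qed

section \<open>Preimages under an epimorphism\<close>

locale epimorphism = group_hom +
  assumes surj: "h ` carrier G = carrier H"
begin

definition "pre K = {x \<in> carrier G. h x \<in> K}"

lemma mem_pre_iff: "x \<in> pre K \<longleftrightarrow> x \<in> carrier G \<and> h x \<in> K"
  by (simp add: pre_def)

lemma pre_subgroup:
  assumes "subgroup K H"
  shows "subgroup (pre K) G"
  using subgroup.m_closed[OF assms] subgroup.m_inv_closed[OF assms] subgroup.one_closed[OF assms]
  by (intro G.subgroupI) (auto simp: pre_def intro: exI[of _ "\<one>\<^bsub>G\<^esub>"])

lemma pre_normal:
  assumes "K \<lhd> H"
  shows "pre K \<lhd> G"
  unfolding G.normal_inv_iff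
  using pre_subgroup[OF normal_imp_subgroup[OF assms]] H.normal_conj[OF assms] by (auto simp: pre_def)

lemma image_normal: "N \<lhd> G \<Longrightarrow> h ` N \<lhd> H"
  by (rule normal.surj_hom_normal_subgroup[OF _ group_hom_axioms surj])

lemma image_pre: "K \<subseteq> carrier H \<Longrightarrow> h ` pre K = K"
  using surj by (auto simp: pre_def)

lemma kernel_subset_pre: "subgroup K H \<Longrightarrow> kernel G H h \<subseteq> pre K"
  using subgroup.one_closed[of K H] by (auto simp: pre_def kernel_def)

lemma kernel_less_pre:
  assumes "subgroup K H" "K \<noteq> {\<one>\<^bsub>H\<^esub>}"
  shows "kernel G H h \<subset> pre K"
proof -
  obtain k where k: "k \<in> K" "k \<noteq> \<one>\<^bsub>H\<^esub>" using assms subgroup.one_closed[OF assms(1)] by blast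
  then obtain x where "x \<in> carrier G" "h x = k" using surj subgroup.mem_carrier[OF assms(1) k(1)] by (metis imageE)
  then have "x \<in> pre K" "x \<notin> kernel G H h" using k by (auto simp: pre_def kernel_def)
  then show ?thesis using kernel_subset_pre[OF assms(1)] by blast
qed

lemma pre_image:
  assumes N: "subgroup N G" "kernel G H h \<subseteq> N"
  shows "pre (h ` N) = N"
proof
  show "N \<subseteq> pre (h ` N)" using G.mem_subgroup[OF N(1)] by (auto simp: pre_def)
  show "pre (h ` N) \<subseteq> N"
  proof
    fix x assume "x \<in> pre (h ` N)"
    then obtain n where n: "x \<in> carrier G" "n \<in> N" "h x = h n" by (auto simp: pre_def)
    have nc: "n \<in> carrier G" using G.mem_subgroup[OF N(1) n(2)] .
    have "x \<otimes>\<^bsub>G\<^esub> inv\<^bsub>G\<^esub> n \<in> kernel G H h" using n nc by (simp add: kernel_def)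
    then have "(x \<otimes>\<^bsub>G\<^esub> inv\<^bsub>G\<^esub> n) \<otimes>\<^bsub>G\<^esub> n \<in> N" using subgroup.m_closed[OF N(1) _ n(2)] N(2) by blast
    then show "x \<in> N" using n nc by (simp add: G.m_assoc)
  qed
qed

lemma pre_eq_carrier_iff:
  assumes "K \<subseteq> carrier H"
  shows "pre K = carrier G \<longleftrightarrow> K = carrier H"
proof
  show "K = carrier H" if "pre K = carrier G" using image_pre[OF assms] surj that by simp
  show "pre K = carrier G" if "K = carrier H" using that by (auto simp: pre_def)
qed

lemma cyclic_mod_pre_iff:
  assumes K: "K \<lhd> H"
  shows "cyclic_mod G (pre K) \<longleftrightarrow> cyclic_mod H K"
proof -
  have sub: "subgroup K H" using K normal_imp_subgroup by blast
  have "cyclic_extension G (pre K) w = carrier G \<longleftrightarrow> cyclic_extension H K (h w) = carrier H"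
    (is "?L \<longleftrightarrow> ?R") if w: "w \<in> carrier G" for w
  proof
    assume L: ?L
    have "y \<in> cyclic_extension H K (h w)" if y: "y \<in> carrier H" for y
    proof -
      have "y \<in> h ` carrier G" using y surj by simp
      then obtain x where x: "x \<in> carrier G" "h x = y" by auto
      then have "x \<in> cyclic_extension G (pre K) w" using L by simp
      then obtain p i where p: "p \<in> pre K" "x = p \<otimes>\<^bsub>G\<^esub> w [^]\<^bsub>G\<^esub> (i::int)" by (rule G.cyclic_extensionE)
      then have "y = h p \<otimes>\<^bsub>H\<^esub> h w [^]\<^bsub>H\<^esub> i" using x w by (auto simp: pre_def hom_int_pow)
      then show ?thesis using H.cyclic_extensionI[of "h p" K "h w" i] p by (simp add: pre_def)
    qed
    then show ?R using subgroup.subset[OF H.subgroup_cyclic_extension[OF K hom_closed[OF w]]] by blast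
  next
    assume R: ?R
    have "x \<in> cyclic_extension G (pre K) w" if x: "x \<in> carrier G" for x
    proof -
      have "h x \<in> cyclic_extension H K (h w)" using R x by simp
      then obtain k i where k: "k \<in> K" "h x = k \<otimes>\<^bsub>H\<^esub> h w [^]\<^bsub>H\<^esub> (i::int)" by (rule H.cyclic_extensionE)
      have kc: "k \<in> carrier H" using subgroup.mem_carrier[OF sub k(1)] .
      let ?p = "x \<otimes>\<^bsub>G\<^esub> inv\<^bsub>G\<^esub> (w [^]\<^bsub>G\<^esub> i)"
      have "h ?p = k" using x w k(2) kc by (simp add: hom_int_pow H.m_assoc)
      then have "?p \<in> pre K" using k x w by (simp add: pre_def)
      then have "?p \<otimes>\<^bsub>G\<^esub> w [^]\<^bsub>G\<^esub> i \<in> cyclic_extension G (pre K) w" by (rule G.cyclic_extensionI)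
      then show ?thesis using x w by (simp add: G.m_assoc)
    qed
    then show ?L using subgroup.subset[OF G.subgroup_cyclic_extension[OF pre_normal[OF K] w]] by blast
  qed
  then show ?thesis unfolding cyclic_mod_def using surj by (metis (no_types, lifting) hom_closed imageE)
qed

text \<open>Preimages of proper subgroups are proper, and commuting elements have commuting images.
  Hence an isolated vertex of \<open>G\<close> has an image without neighbours.\<close>

lemma adjacent_lift:
  assumes "x \<in> carrier G" "y \<in> carrier G" "adjacent H (h x) (h y)"
  shows "adjacent G x y"
proof -
  obtain K where K: "subgroup K H" "K \<noteq> carrier H" "h x \<in> K" "h y \<in> K" using assms(3) by (rule H.adjacentE)
  show ?thesis
  proof (rule G.adjacentI[OF pre_subgroup[OF K(1)]])
    show "pre K \<noteq> carrier G" using pre_eq_carrier_iff[OF subgroup.subset[OF K(1)]] K(2) by simp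
    show "x \<otimes>\<^bsub>G\<^esub> y \<noteq> y \<otimes>\<^bsub>G\<^esub> x" using H.adjacent_not_commute[OF assms(3)] assms by (metis hom_mult)
  qed (use assms K in \<open>auto simp: pre_def\<close>)
qed

end

locale central_quotient = group +
  fixes Q p
  defines "Q \<equiv> G Mod center G" and "p \<equiv> (\<lambda>x. center G #> x)"
begin

sublocale epi: epimorphism G Q p
proof -
  interpret Z: normal "center G" G by (rule normal_center)
  show "epimorphism G Q p"
    unfolding Q_def p_def
    by (intro epimorphism.intro group_hom.intro group_hom_axioms.intro epimorphism_axioms.intro
        is_group Z.factorgroup_is_group Z.r_coset_hom_Mod) (auto simp: carrier_FactGroup)
qed

lemma kernel_eq: "kernel G Q p = center G"
proof -
  have "center G #> x = center G \<longleftrightarrow> x \<in> center G" if x: "x \<in> carrier G" for x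
    using coset_join2[OF x subgroup_center] rcos_self[OF x subgroup_center] by auto
  then show ?thesis using center_subset by (auto simp: kernel_def Q_def p_def)
qed

lemma p_eq_one_iff: "x \<in> carrier G \<Longrightarrow> p x = \<one>\<^bsub>Q\<^esub> \<longleftrightarrow> x \<in> center G"
  using kernel_eq by (auto simp: kernel_def)

lemma normal_lift:
  assumes K: "K \<lhd> Q" "K \<noteq> {\<one>\<^bsub>Q\<^esub>}"
  shows "epi.pre K \<lhd> G" "center G \<subset> epi.pre K"
  using epi.pre_normal[OF K(1)] epi.kernel_less_pre[OF normal_imp_subgroup[OF K(1)] K(2)]
  by (simp_all add: kernel_eq)

lemma normal_image:
  assumes N: "N \<lhd> G" "center G \<subset> N"
  shows "p ` N \<lhd> Q" "p ` N \<noteq> {\<one>\<^bsub>Q\<^esub>}" "epi.pre (p ` N) = N"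
proof -
  show "p ` N \<lhd> Q" by (rule epi.image_normal[OF N(1)])
  obtain n where n: "n \<in> N" "n \<notin> center G" using N by blast
  then have "p n \<noteq> \<one>\<^bsub>Q\<^esub>" using p_eq_one_iff mem_normal[OF N(1) n(1)] by blast
  then show "p ` N \<noteq> {\<one>\<^bsub>Q\<^esub>}" using n(1) by blast
  show "epi.pre (p ` N) = N"
    using epi.pre_image[OF normal_imp_subgroup[OF N(1)]] N(2) kernel_eq by auto
qed

lemma every_proper_quotient_cyclic_iff: "every_proper_quotient_cyclic Q \<longleftrightarrow> all_cyclic_mod G"
proof -
  have "cyclic_group (Q Mod K) \<longleftrightarrow> cyclic_mod G (epi.pre K)" if "K \<lhd> Q" for K
    using epi.H.cyclic_group_FactGroup_iff[OF that] epi.cyclic_mod_pre_iff[OF that] by simp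
  then show ?thesis
    unfolding every_proper_quotient_cyclic_def all_cyclic_mod_def
    using normal_lift normal_image by metis
qed

lemma has_proper_noncyclic_quotient_iff: "has_proper_noncyclic_quotient Q \<longleftrightarrow> \<not> all_cyclic_mod G"
  unfolding every_proper_quotient_cyclic_iff[symmetric] every_proper_quotient_cyclic_def
    has_proper_noncyclic_quotient_def by blast

lemma not_simple_normal:
  assumes "\<not> is_simple Q" "carrier G \<noteq> center G"
  shows "\<exists>N. N \<lhd> G \<and> center G \<subset> N \<and> N \<noteq> carrier G"
proof -
  obtain x where x: "x \<in> carrier G" "x \<notin> center G" using assms(2) center_subset by blast
  then have "p x \<in> carrier Q" "p x \<noteq> \<one>\<^bsub>Q\<^esub>" using p_eq_one_iff by auto
  then obtain K where K: "K \<lhd> Q" "K \<noteq> carrier Q" "K \<noteq> {\<one>\<^bsub>Q\<^esub>}"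
    using assms(1) epi.H.is_group unfolding is_simple_def by blast
  then have "epi.pre K \<noteq> carrier G"
    using epi.pre_eq_carrier_iff subgroup.subset[OF normal_imp_subgroup[OF K(1)]] by blast
  then show ?thesis using normal_lift[OF K(1,3)] by blast
qed

end

context group
begin

lemma diameter_Xi_plus:
  assumes edge: "adjacent G x y"
    and reach: "\<And>x x' y y'. adjacent G x x' \<Longrightarrow> adjacent G y y' \<Longrightarrow> reach (adjacent G) n x y"
  shows "\<exists>k\<in>{2..n}. diameter (Xi_plus G) = ereal k"
    and "\<not> has_isolated_vertex (Xi G) \<Longrightarrow>
      Digraph_Component.connected (Xi G) \<and> (\<exists>k\<in>{2..n}. diameter (Xi G) = ereal k)"
proof -
  let ?S = "{x. \<exists>y. adjacent G x y}"
  have closed: "v \<in> ?S" if "u \<in> ?S" "adjacent G u v" for u v using that adjacent_sym by blast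
  have R: "reach (adjacent G) n u v" if "u \<in> ?S" "v \<in> ?S" for u v using that reach by blast
  have x: "x \<in> ?S" using edge by blast
  have diam: "\<exists>k\<in>{2..n}. diameter (Xi G \<restriction> ?S) = ereal k"
    by (rule diameter_induced_Xi(1)[OF _ x edge]) (rule closed, assumption+, rule R)
  have con: "Digraph_Component.connected (Xi G \<restriction> ?S)"
    by (rule diameter_induced_Xi(2)[OF _ x edge]) (rule closed, assumption+, rule R)
  show "\<exists>k\<in>{2..n}. diameter (Xi_plus G) = ereal k"
    unfolding Xi_plus_induced by (rule diam)
  assume "\<not> has_isolated_vertex (Xi G)"
  then have "?S = carrier G - center G"
    using adjacent_carrier adjacent_not_center unfolding has_isolated_vertex_def isolated_Xi_iff by blast
  then have e: "Xi G \<restriction> ?S = Xi G" using Xi_induced by simp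
  then show "Digraph_Component.connected (Xi G) \<and> (\<exists>k\<in>{2..n}. diameter (Xi G) = ereal k)"
    using diam con unfolding e by blast
qed

lemma not_isolated_if_reach:
  assumes edge: "adjacent G a b"
    and reach: "\<And>x y. \<lbrakk>x \<in> carrier G - center G; y \<in> carrier G - center G\<rbrakk> \<Longrightarrow> reach (adjacent G) n x y"
  shows "\<not> has_isolated_vertex (Xi G)"
proof
  assume "has_isolated_vertex (Xi G)"
  then obtain x where x: "x \<in> carrier G" "x \<notin> center G" "\<And>y. \<not> adjacent G x y"
    unfolding has_isolated_vertex_def isolated_Xi_iff by blast
  have a: "a \<in> carrier G - center G" using edge adjacent_carrier adjacent_not_center by blast
  have "x = a" using reach[of x a] x a by (cases n) auto
  then show False using x(3) edge by blast
qed

lemma connected_Xi_if_reach: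
  assumes edge: "adjacent G a b"
    and reach: "\<And>x y. \<lbrakk>x \<in> carrier G - center G; y \<in> carrier G - center G\<rbrakk> \<Longrightarrow> reach (adjacent G) n x y"
  shows "Digraph_Component.connected (Xi G) \<and> (\<exists>k\<in>{2..n}. diameter (Xi G) = ereal k)"
proof (rule diameter_Xi_plus(2)[OF edge _ not_isolated_if_reach[OF edge reach]])
  fix x x' y y' assume "adjacent G x x'" "adjacent G y y'"
  then show "reach (adjacent G) n x y" using reach adjacent_carrier adjacent_not_center by blast
qed

lemma Xi_two_components:
  assumes "S \<union> T = carrier G - center G" "S \<inter> T = {}"
    and S: "a \<in> S" "adjacent G a a'" and T: "b \<in> T" "adjacent G b b'"
    and no_edge: "\<And>x y. \<lbrakk>x \<in> S; y \<in> T\<rbrakk> \<Longrightarrow> \<not> adjacent G x y"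
    and reach: "\<And>x y. \<lbrakk>x \<in> S; y \<in> S\<rbrakk> \<Longrightarrow> reach (adjacent G) 2 x y"
      "\<And>x y. \<lbrakk>x \<in> T; y \<in> T\<rbrakk> \<Longrightarrow> reach (adjacent G) 2 x y"
  shows "\<exists>C D. C \<noteq> D \<and> connected_components (Xi G) = {C, D} \<and> diameter C = 2 \<and> diameter D = 2"
proof -
  have ST: "v \<in> S \<or> v \<in> T" if "adjacent G u v" for u v
    using assms(1) adjacent_carrier[OF that] adjacent_not_center[OF that] by blast
  have cS: "v \<in> S" if "u \<in> S" "adjacent G u v" for u v using ST[OF that(2)] no_edge that by blast
  have cT: "v \<in> T" if "u \<in> T" "adjacent G u v" for u v using ST[OF that(2)] no_edge adjacent_sym that by blast
  have diamS: "\<exists>k\<in>{2..2::nat}. diameter (Xi G \<restriction> S) = ereal k"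
    by (rule diameter_induced_Xi(1)[OF _ S]) (rule cS, assumption+, rule reach(1))
  have conS: "Digraph_Component.connected (Xi G \<restriction> S)"
    by (rule diameter_induced_Xi(2)[OF _ S]) (rule cS, assumption+, rule reach(1))
  have diamT: "\<exists>k\<in>{2..2::nat}. diameter (Xi G \<restriction> T) = ereal k"
    by (rule diameter_induced_Xi(1)[OF _ T]) (rule cT, assumption+, rule reach(2))
  have conT: "Digraph_Component.connected (Xi G \<restriction> T)"
    by (rule diameter_induced_Xi(2)[OF _ T]) (rule cT, assumption+, rule reach(2))
  have "connected_components (Xi G) = {Xi G \<restriction> S, Xi G \<restriction> T}"
  proof (rule wf_digraph.two_connected_components[OF wf_digraph_Xi _ _ assms(2) conS conT])
    show "tail (Xi G) e \<in> S \<longleftrightarrow> head (Xi G) e \<in> S" if "e \<in> arcs (Xi G)" for e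
      using that cS adjacent_sym by (auto simp: arcs_Xi)
  qed (use assms(1) in auto)
  moreover have "Xi G \<restriction> S \<noteq> Xi G \<restriction> T"
    using S(1) assms(2) by (metis IntI empty_iff induce_subgraph_verts)
  moreover have "diameter (Xi G \<restriction> S) = 2" "diameter (Xi G \<restriction> T) = 2" using diamS diamT by auto
  ultimately show ?thesis by blast
qed

end

context central_quotient
begin

text \<open>The centralizer of \<open>B\<close> in \<open>Q\<close> is an abelian Frobenius-like
  kernel, so its preimage \<open>?C\<close> is abelian modulo the centre, which is
  \<open>class_two\<close>. As no abelian normal subgroup of \<open>G\<close> properly contains the
  centre, \<open>?C\<close> is centralized by the centre only, which is
  \<open>not_centralized\<close>.\<close>

lemma abelian_normal_lift:
  assumes cyc: "all_cyclic_mod G" and N: "N \<lhd> G" "center G \<subset> N" "N \<noteq> carrier G"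
    and no_abelian: "\<And>A. \<lbrakk>A \<lhd> G; center G \<subset> A\<rbrakk> \<Longrightarrow> \<exists>x\<in>A. \<exists>y\<in>A. x \<otimes> y \<noteq> y \<otimes> x"
  shows "center Q = {\<one>\<^bsub>Q\<^esub>}" "all_cyclic_mod Q"
    and "\<lbrakk>B \<lhd> Q; B \<noteq> {\<one>\<^bsub>Q\<^esub>}; \<And>x y. \<lbrakk>x \<in> B; y \<in> B\<rbrakk> \<Longrightarrow> x \<otimes>\<^bsub>Q\<^esub> y = y \<otimes>\<^bsub>Q\<^esub> x\<rbrakk>
      \<Longrightarrow> \<exists>C. class_two_frobenius_like G C"
proof -
  have cycQ: "cyclic_mod Q K" if K: "K \<lhd> Q" "K \<noteq> {\<one>\<^bsub>Q\<^esub>}" for K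
    using normal_lift[OF K] epi.cyclic_mod_pre_iff[OF K(1)] cyc unfolding all_cyclic_mod_def by blast
  show Z: "center Q = {\<one>\<^bsub>Q\<^esub>}"
  proof (rule ccontr)
    assume "center Q \<noteq> {\<one>\<^bsub>Q\<^esub>}"
    then have "cyclic_mod Q (center Q)" using cycQ[OF epi.H.normal_center] by blast
    then have com: "u \<otimes>\<^bsub>Q\<^esub> v = v \<otimes>\<^bsub>Q\<^esub> u" if "u \<in> carrier Q" "v \<in> carrier Q" for u v
      using epi.H.abelian_if_cyclic_mod[OF epi.H.subgroup_self epi.H.normal_center _ _ that]
        epi.H.center_commute by blast
    obtain x where x: "x \<in> carrier G" "x \<notin> center G" using N mem_normal[OF N(1)] by blast
    \<comment> \<open>For abelian \<open>Q\<close> every subgroup above the centre is normal.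
      Generated by the centre and one element, \<open>?A\<close> is also abelian, against
      \<open>no_abelian\<close>.\<close>
    let ?A = "cyclic_extension G (center G) x"
    have A: "subgroup ?A G" by (rule subgroup_cyclic_extension[OF normal_center x(1)])
    have ZA: "center G \<subseteq> ?A" using cyclic_extension_incl[OF normal_center x(1)] by blast
    have "g \<otimes> a \<otimes> inv g \<in> ?A" if g: "g \<in> carrier G" and a: "a \<in> ?A" for g a
    proof -
      have ac: "a \<in> carrier G" using mem_subgroup[OF A a] .
      have "p (g \<otimes> a \<otimes> inv g \<otimes> inv a) = \<one>\<^bsub>Q\<^esub>"
        using com[of "p g" "p a"] g ac by (simp add: epi.H.m_assoc) 
      then have "g \<otimes> a \<otimes> inv g \<otimes> inv a \<in> center G"
        using p_eq_one_iff[of "g \<otimes> a \<otimes> inv g \<otimes> inv a"] g ac by blast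
      then have "g \<otimes> a \<otimes> inv g \<otimes> inv a \<otimes> a \<in> ?A" using subgroup.m_closed[OF A _ a] ZA by blast
      then show ?thesis using g ac by (simp add: m_assoc)
    qed
    then have An: "?A \<lhd> G" unfolding normal_inv_iff using A by blast
    have "center G \<subset> ?A" using ZA cyclic_extension_self[OF normal_center x(1)] x(2) by blast
    then obtain a b where ab: "a \<in> ?A" "b \<in> ?A" "a \<otimes> b \<noteq> b \<otimes> a" using no_abelian[OF An] by blast
    have sub: "?A \<subseteq> centralizer G {x}"
      by (rule cyclic_extension_minimal) (use x subgroup_centralizer1 center_subset_centralizer[of "{x}"] in \<open>auto simp: mem_centralizer1_iff\<close>)
    have "?A \<subseteq> centralizer G {a}"
    proof (rule cyclic_extension_minimal[OF subgroup_centralizer1])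
      show a: "a \<in> carrier G" using mem_subgroup[OF A ab(1)] .
      show "center G \<subseteq> centralizer G {a}" using center_subset_centralizer[of "{a}"] a by blast
      show "x \<in> centralizer G {a}" using centralizer1_sym[OF x(1) a] sub ab(1) by blast
    qed
    then show False using ab by (auto simp: mem_centralizer1_iff)
  qed
  show cycQ': "all_cyclic_mod Q" unfolding all_cyclic_mod_def Z using cycQ by blast
  assume B: "B \<lhd> Q" "B \<noteq> {\<one>\<^bsub>Q\<^esub>}" "\<And>x y. \<lbrakk>x \<in> B; y \<in> B\<rbrakk> \<Longrightarrow> x \<otimes>\<^bsub>Q\<^esub> y = y \<otimes>\<^bsub>Q\<^esub> x"
  have "center Q \<subset> B" unfolding Z using B(2) subgroup.one_closed[OF normal_imp_subgroup[OF B(1)]] by blast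
  then interpret F: abelian_frobenius_like Q "centralizer Q B"
    using epi.H.centralizer_frobenius_like[OF cycQ' B(1) _ B(3)] by blast
  let ?D = "centralizer Q B" and ?C = "epi.pre (centralizer Q B)"
  have D1: "?D \<noteq> {\<one>\<^bsub>Q\<^esub>}" using F.not_central Z by blast
  have C: "?C \<lhd> G" "center G \<subset> ?C" using normal_lift[OF F.C D1] by auto
  have cent: "centralizer G ?C = center G"
    by (rule centralizer_normal_eq_center[OF cyc no_abelian C])
  have "class_two_frobenius_like G ?C"
  proof (intro class_two_frobenius_like.intro class_two_frobenius_like_axioms.intro
      frobenius_like.intro frobenius_like_axioms.intro is_group C(1) cyc)
    show "\<not> ?C \<subseteq> center G" "center G \<subseteq> ?C" using C(2) by auto
    show "?C \<noteq> carrier G" using epi.pre_eq_carrier_iff[OF subgroup.subset[OF F.sub]] F.proper by simp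
    show "y \<otimes> w \<noteq> w \<otimes> y" if "y \<in> ?C" "y \<notin> center G" "w \<in> carrier G" "w \<notin> ?C" for y w
    proof
      assume e: "y \<otimes> w = w \<otimes> y"
      have y: "y \<in> carrier G" "p y \<in> ?D" and w: "p w \<notin> ?D" using that by (auto simp: epi.mem_pre_iff)
      have "p y \<otimes>\<^bsub>Q\<^esub> p w = p w \<otimes>\<^bsub>Q\<^esub> p y" using arg_cong[OF e, of p] y(1) that(3) by simp
      then show False using F.no_commute[OF y(2) _ _ w] p_eq_one_iff[OF y(1)] that Z by auto
    qed
    show "\<exists>z\<in>center G. a \<otimes> b = z \<otimes> (b \<otimes> a)" if "a \<in> ?C" "b \<in> ?C" for a b
    proof -
      have ab: "a \<in> carrier G" "b \<in> carrier G" "p a \<in> ?D" "p b \<in> ?D" using that by (auto simp: epi.mem_pre_iff)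
      have "p (a \<otimes> b \<otimes> inv (b \<otimes> a)) = \<one>\<^bsub>Q\<^esub>" using F.abelian[OF ab(3,4)] ab(1,2) by simp
      then have "a \<otimes> b \<otimes> inv (b \<otimes> a) \<in> center G"
        using p_eq_one_iff[of "a \<otimes> b \<otimes> inv (b \<otimes> a)"] ab(1,2) by blast
      then show ?thesis using ab(1,2) by (intro bexI[of _ "a \<otimes> b \<otimes> inv (b \<otimes> a)"]) (simp_all add: m_assoc)
    qed
    show "\<not> ?C \<subseteq> centralizer G {a}" if "a \<in> ?C" "a \<notin> center G" for a
    proof
      assume s: "?C \<subseteq> centralizer G {a}"
      have "a \<in> carrier G" using mem_normal[OF C(1) that(1)] .
      then have "a \<in> centralizer G ?C" using s by (auto simp: mem_centralizer_iff)
      then show False using cent that(2) by blast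
    qed
  qed
  then show "\<exists>C. class_two_frobenius_like G C" by blast
qed

end

theorem theorem1p2:
  fixes G :: "('a, 'b) monoid_scheme"
  assumes "group G"
    and "\<not> is_simple (G Mod center G)"
    and "arcs (Xi G) \<noteq> {}"
  shows
    "(has_isolated_vertex (Xi G) \<and> diameter (Xi_plus G) = 2 \<and>
        (has_proper_noncyclic_quotient (G Mod center G) \<longrightarrow> solvable G))
     \<or> (has_isolated_vertex (Xi (G Mod center G)) \<and> diameter (Xi_plus G) \<in> {2, 3, 4} \<and>
        infinite (carrier (G Mod center G)) \<and> \<not> solvable (G Mod center G) \<and>
        primitive_group (G Mod center G) \<and> every_proper_quotient_cyclic (G Mod center G))
     \<or> (Digraph_Component.connected (Xi G) \<and> diameter (Xi G) \<in> {2, 3})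
     \<or> (Digraph_Component.connected (Xi G) \<and> diameter (Xi G) = 4 \<and>
        infinite (carrier G) \<and> has_proper_noncyclic_quotient (G Mod center G))
     \<or> (\<exists>C D. C \<noteq> D \<and> connected_components (Xi G) = {C, D} \<and>
        diameter C = 2 \<and> diameter D = 2)"
    (is "?i \<or> ?ii \<or> ?iii \<or> ?iv \<or> ?v")
proof -
  interpret group G by (rule assms(1))
  define Q p where "Q = G Mod center G" and "p = (\<lambda>x. center G #>\<^bsub>G\<^esub> x)"
  interpret central_quotient G Q p
    by (intro central_quotient.intro is_group) (simp_all add: Q_def p_def)
  obtain a b where ab: "adjacent G a b" using assms(3) unfolding arcs_Xi by blast
  have three: "?iii" if "Digraph_Component.connected (Xi G) \<and> (\<exists>k\<in>{2..3::nat}. diameter (Xi G) = ereal k)"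
  proof -
    have "{2..3::nat} = {2, 3}" by auto
    then show ?thesis using that by auto
  qed
  \<comment> \<open>Diameter \<open>2\<close> gives the first or the third alternative, according to
    whether \<open>Xi_plus\<close> differs from \<open>Xi\<close>.\<close>
  have two: "?i \<or> ?iii"
    if r: "\<And>x x' y y'. adjacent G x x' \<Longrightarrow> adjacent G y y' \<Longrightarrow> reach (adjacent G) 2 x y"
      and s: "has_proper_noncyclic_quotient Q \<longrightarrow> solvable G"
  proof (cases "has_isolated_vertex (Xi G)")
    case True
    have "\<exists>k\<in>{2..2::nat}. diameter (Xi_plus G) = ereal k" by (rule diameter_Xi_plus(1)[OF ab r])
    then show ?thesis using True s unfolding Q_def by simp
  next
    case False
    have "Digraph_Component.connected (Xi G) \<and> (\<exists>k\<in>{2..2::nat}. diameter (Xi G) = ereal k)"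
      by (rule diameter_Xi_plus(2)[OF ab r False])
    then show ?thesis by simp
  qed
  show ?thesis
  proof (cases "all_cyclic_mod G")
    case False
    then obtain K where K: "K \<lhd> G" "center G \<subset> K" "\<not> cyclic_mod G K" unfolding all_cyclic_mod_def by blast
    interpret noncyclic_quotient G K
      by (intro noncyclic_quotient.intro noncyclic_quotient_axioms.intro is_group K)
    have nq: "has_proper_noncyclic_quotient (G Mod center G)"
      using False has_proper_noncyclic_quotient_iff unfolding Q_def by simp
    from distance_cases show ?thesis
    proof (elim disjE)
      assume "\<forall>x\<in>carrier G - center G. \<forall>y\<in>carrier G - center G. reach (adjacent G) 3 x y"
      then have ?iii by (intro three connected_Xi_if_reach[OF ab]) blast
      then show ?thesis by blast
    next
      assume "(\<forall>x x' y y'. adjacent G x x' \<longrightarrow> adjacent G y y' \<longrightarrow> reach (adjacent G) 2 x y) \<and> solvable G"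
      then have "?i \<or> ?iii" by (intro two) blast+
      then show ?thesis by blast
    next
      assume *: "(\<forall>x\<in>carrier G - center G. \<forall>y\<in>carrier G - center G. reach (adjacent G) 4 x y) \<and> infinite (carrier G)"
      then have "Digraph_Component.connected (Xi G) \<and> (\<exists>k\<in>{2..4::nat}. diameter (Xi G) = ereal k)"
        by (intro connected_Xi_if_reach[OF ab]) blast
      moreover have "{2..4::nat} = {2, 3, 4}" by auto
      ultimately have "?iii \<or> ?iv" using * nq by auto
      then show ?thesis by blast
    next
      assume "\<exists>T U. T \<union> U = carrier G - center G \<and> T \<inter> U = {}
        \<and> (\<exists>x\<in>T. \<exists>y\<in>T. adjacent G x y) \<and> (\<exists>x\<in>U. \<exists>y\<in>U. adjacent G x y)
        \<and> (\<forall>x\<in>T. \<forall>y\<in>U. \<not> adjacent G x y)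
        \<and> (\<forall>x\<in>T. \<forall>y\<in>T. reach (adjacent G) 2 x y) \<and> (\<forall>x\<in>U. \<forall>y\<in>U. reach (adjacent G) 2 x y)"
      then obtain T U t t' u u' where TU: "T \<union> U = carrier G - center G" "T \<inter> U = {}"
        "t \<in> T" "adjacent G t t'" "u \<in> U" "adjacent G u u'"
        "\<forall>x\<in>T. \<forall>y\<in>U. \<not> adjacent G x y"
        "\<forall>x\<in>T. \<forall>y\<in>T. reach (adjacent G) 2 x y" "\<forall>x\<in>U. \<forall>y\<in>U. reach (adjacent G) 2 x y" by blast
      have ?v by (rule Xi_two_components[OF TU(1-6)]) (use TU(7-9) in blast)+
      then show ?thesis by blast
    qed
  next
    case cyc: True
    have nnq: "\<not> has_proper_noncyclic_quotient Q" using has_proper_noncyclic_quotient_iff cyc by blast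
    have "carrier G \<noteq> center G" using ab adjacent_carrier adjacent_not_center by blast
    then obtain N where N: "N \<lhd> G" "center G \<subset> N" "N \<noteq> carrier G"
      using not_simple_normal assms(2) unfolding Q_def by blast
    show ?thesis
    proof (cases "\<exists>A. A \<lhd> G \<and> center G \<subset> A \<and> (\<forall>x\<in>A. \<forall>y\<in>A. x \<otimes>\<^bsub>G\<^esub> y = y \<otimes>\<^bsub>G\<^esub> x)")
      case True
      then obtain A where A: "A \<lhd> G" "center G \<subset> A" "\<And>x y. \<lbrakk>x \<in> A; y \<in> A\<rbrakk> \<Longrightarrow> x \<otimes>\<^bsub>G\<^esub> y = y \<otimes>\<^bsub>G\<^esub> x" by blast
      interpret F: abelian_frobenius_like G "centralizer G A"
        by (rule centralizer_frobenius_like[OF cyc A])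
      \<comment> \<open>The solvability claim of the first alternative is vacuous here, as all
        proper quotients of \<open>Q\<close> are cyclic.\<close>
      have "?i \<or> ?iii" by (rule two[OF F.reach_2_not_isolated]) (use nnq in auto)
      then show ?thesis by blast
    next
      case False
      then have no_abelian: "\<exists>x\<in>A. \<exists>y\<in>A. x \<otimes>\<^bsub>G\<^esub> y \<noteq> y \<otimes>\<^bsub>G\<^esub> x" if "A \<lhd> G" "center G \<subset> A" for A
        using that by blast
      interpret F: centralizer_free G N
        by (intro centralizer_free.intro centralizer_free_axioms.intro is_group N
            centralizer_normal_eq_center[OF cyc no_abelian])
      note diam = diameter_Xi_plus[OF ab F.reach_3_not_isolated]
      show ?thesis
      proof (cases "has_isolated_vertex (Xi G)")
        case False
        have ?iii by (rule three[OF diam(2)[OF _ _ False]])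
        then show ?thesis by blast
      next
        case True
        then obtain x where x: "x \<in> carrier G" "x \<notin> center G" "\<And>y. \<not> adjacent G x y"
          unfolding has_isolated_vertex_def isolated_Xi_iff by blast
        have ZQ: "center Q = {\<one>\<^bsub>Q\<^esub>}"
          by (rule abelian_normal_lift(1)[OF cyc N]) (rule no_abelian)
        have cycQ: "all_cyclic_mod Q"
          by (rule abelian_normal_lift(2)[OF cyc N]) (rule no_abelian)
        show ?thesis
        proof (cases "\<exists>B. B \<lhd> Q \<and> B \<noteq> {\<one>\<^bsub>Q\<^esub>} \<and> (\<forall>x\<in>B. \<forall>y\<in>B. x \<otimes>\<^bsub>Q\<^esub> y = y \<otimes>\<^bsub>Q\<^esub> x)")
          case True
          then obtain B where B: "B \<lhd> Q" "B \<noteq> {\<one>\<^bsub>Q\<^esub>}"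
            "\<And>x y. \<lbrakk>x \<in> B; y \<in> B\<rbrakk> \<Longrightarrow> x \<otimes>\<^bsub>Q\<^esub> y = y \<otimes>\<^bsub>Q\<^esub> x" by blast
          have "\<exists>C. class_two_frobenius_like G C"
            by (rule abelian_normal_lift(3)[OF cyc N _ B]) (rule no_abelian)
          then obtain C where "class_two_frobenius_like G C" by blast
          then interpret C: class_two_frobenius_like G C .
          have "?i \<or> ?iii" by (rule two[OF C.reach_2_not_isolated]) (use nnq in auto)
          then show ?thesis by blast
        next
          case False
          have px: "p x \<in> carrier Q" "p x \<noteq> \<one>\<^bsub>Q\<^esub>" using x p_eq_one_iff by auto
          have centQ: "centralizer Q K = {\<one>\<^bsub>Q\<^esub>}" if K: "K \<lhd> Q" "K \<noteq> {\<one>\<^bsub>Q\<^esub>}" for K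
          proof -
            have "centralizer Q K = center Q"
            proof (rule epi.H.centralizer_normal_eq_center[OF cycQ _ K(1)])
              show "\<exists>x\<in>A. \<exists>y\<in>A. x \<otimes>\<^bsub>Q\<^esub> y \<noteq> y \<otimes>\<^bsub>Q\<^esub> x" if "A \<lhd> Q" "center Q \<subset> A" for A
              proof -
                have "A \<noteq> {\<one>\<^bsub>Q\<^esub>}" using that(2) ZQ by simp
                then show ?thesis using False that(1) by metis
              qed
              show "center Q \<subset> K"
                unfolding ZQ using K(2) subgroup.one_closed[OF normal_imp_subgroup[OF K(1)]] by blast
            qed
            then show ?thesis using ZQ by simp
          qed
          have iso: "\<not> adjacent Q (p x) y" for y
          proof
            assume e: "adjacent Q (p x) y"
            then have "y \<in> p ` carrier G" using epi.H.adjacent_carrier[OF e] epi.surj by simp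
            then obtain y' where y': "y' \<in> carrier G" "y = p y'" by (rule imageE)
            then show False using epi.adjacent_lift[OF x(1) y'(1)] e x(3) by simp
          qed
          interpret I: isolated_vertex Q "p x"
            by (intro isolated_vertex.intro isolated_vertex_axioms.intro epi.H.is_group centQ px iso)
          have 1: "has_isolated_vertex (Xi Q)"
            unfolding has_isolated_vertex_def epi.H.isolated_Xi_iff using px iso ZQ by blast
          \<comment> \<open>Distance at most \<open>3\<close> was shown, so of the stated values
            only \<open>2\<close> and \<open>3\<close> arise.\<close>
          have "\<exists>k\<in>{2..3::nat}. diameter (Xi_plus G) = ereal k" by (rule diam(1))
          moreover have "{2..3::nat} = {2, 3}" by auto
          ultimately have 2: "diameter (Xi_plus G) \<in> {2, 3, 4}" by auto
          have 3: "\<not> solvable Q"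
            using epi.H.solvable_imp_abelian_normal False px by blast
          have 4: "primitive_group Q"
            unfolding primitive_group_def using I.M_maximal I.M_core_free epi.H.is_group by blast
          have 5: "every_proper_quotient_cyclic Q" using every_proper_quotient_cyclic_iff cyc by simp
          have ?ii unfolding Q_def[symmetric] by (intro conjI 1 2 I.not_finite 3 4 5)
          then show ?thesis by blast
        qed
      qed
    qed
  qed
qed

end
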